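(* Let $1<p<\infty$ and let $V\subseteq W$ be $p$-operator spaces such that for every $n\in\mathbb{N}$ the inclusion $\mathcal{T}_n(V)\hookrightarrow\mathcal{T}_n(W)$ is isometric. Then for every space $L_p(\Omega)$, every $p$-completely contractive map $\varphi:V\to\mathcal{B}(L_p(\Omega))$ has a $p$-completely contractive extension $\tilde\varphi:W\to\mathcal{B}(L_p(\Omega))$.
   Context: All spaces are complex; $1<p,p'<\infty$ with $1/p+1/p'=1$. $L_p(\Omega)$ is the $L_p$ space of a measure space $\Omega$. For a vector space $X$, $\mathbb{M}_{n,m}(X)$ is the space of $n\times m$ matrices over $X$, $\mathbb{M}_n(X)=\mathbb{M}_{n,n}(X)$, and $\mathbb{M}_{n,m}=\mathbb{M}_{n,m}(\mathbb{C})$. A $p$-operator space is a Banach space $X$ together with norms $\|\cdot\|_n$ on $\mathbb{M}_n(X)$, $n\ge1$ (with $\|\cdot\|_1$ the norm of $X$), such that, writing $M_n(X)=(\mathbb{M}_n(X),\|\cdot\|_n)$: (1) $\|u\oplus v\|_{n+m}=\max\{\|u\|_n,\|v\|_m\}$ for $u\in M_n(X)$, $v\in M_m(X)$; (2) $\|\alpha u\beta\|_n\le\|\alpha\|\,\|u\|_m\,\|\beta\|$ for $u\in M_m(X)$, $\alpha\in\mathbb{M}_{n,m}$, $\beta\in\mathbb{M}_{m,n}$, where $\|\alpha\|$ is the norm in $\mathcal{B}(\ell_p^m,\ell_p^n)$ and $\|\beta\|$ the norm in $\mathcal{B}(\ell_p^n,\ell_p^m)$. $V\subseteq W$ means that $V$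 is a closed subspace of $W$ with the inherited matrix norms. $\mathcal{B}(L_p(\Omega))$ is a $p$-operator space via $\mathbb{M}_n(\mathcal{B}(L_p(\Omega)))=\mathcal{B}(\ell_p^n(L_p(\Omega)))$, where $\ell_p^n(F)$ is the $\ell_p$ direct sum of $n$ copies of $F$. A linear map $u:X\to Y$ between $p$-operator spaces induces $u_n:M_n(X)\to M_n(Y)$ entrywise; $u$ is $p$-completely contractive if $\sup_n\|u_n\|\le1$. For a $p$-operator space $X$ and $n\in\mathbb{N}$, $\mathcal{T}_n(X)$ denotes $\mathbb{M}_n(X)$ with the norm $$\|v\|_{1,n}=\inf\{\|\alpha\|_{p'}\,\|w\|_{M_r(X)}\,\|\beta\|_p:\ r\in\mathbb{N},\ v=\alpha w\beta,\ \alpha\in\mathbb{M}_{n,r},\ \beta\in\mathbb{M}_{r,n},\ w\in M_r(X)\},$$ where $\|\alpha\|_{p'}=\left(\sum_{i,j}|\alpha_{ij}|^{p'}\right)^{1/p'}$ and $\|\beta\|_p=\left(\sum_{k,l}|\beta_{kl}|^{p}\right)^{1/p}$. *)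

theory Defs
  imports "HOL-Analysis.Analysis" "Jordan_Normal_Form.Matrix"
begin

section \<open>Matrices over a complex vector space\<close>

text \<open>
  A complex vector space is a subspace of an ambient type of class \<^class>\<open>ab_group_add\<close> with an
  explicit scalar multiplication \<open>sc\<close> satisfying \<^locale>\<open>vector_space\<close>.  A family of norms on the
  square matrices of all sizes is one function on matrices, since a matrix carries its dimensions;
  only its values on \<open>n \<times> n\<close> matrices with \<open>n \<ge> 1\<close> and entries in the space are relevant.
\<close>

definition mats :: "nat \<Rightarrow> nat \<Rightarrow> 'a set \<Rightarrow> 'a mat set" where
  "mats n m X = {v \<in> carrier_mat n m. elements_mat v \<subseteq> X}"

definition mat_scale :: "(complex \<Rightarrow> 'a \<Rightarrow> 'a) \<Rightarrow> complex \<Rightarrow> 'a mat \<Rightarrow> 'a mat" where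
  "mat_scale sc c v = map_mat (sc c) v"

definition mat_dsum :: "'a::zero mat \<Rightarrow> 'a mat \<Rightarrow> 'a mat" where
  "mat_dsum u v =
     four_block_mat u (0\<^sub>m (dim_row u) (dim_col v)) (0\<^sub>m (dim_row v) (dim_col u)) v"

text \<open>The product \<open>\<alpha> w \<beta>\<close> of a vector-valued matrix \<open>w\<close> with scalar matrices \<open>\<alpha>\<close> and \<open>\<beta>\<close>.\<close>

definition mat_sandwich ::
  "(complex \<Rightarrow> 'a::ab_group_add \<Rightarrow> 'a) \<Rightarrow> complex mat \<Rightarrow> 'a mat \<Rightarrow> complex mat \<Rightarrow> 'a mat" where
  "mat_sandwich sc \<alpha> w \<beta> = mat (dim_row \<alpha>) (dim_col \<beta>)
     (\<lambda>(i, j). \<Sum>k<dim_row w. \<Sum>l<dim_col w. sc (\<alpha> $$ (i, k) * \<beta> $$ (l, j)) (w $$ (k, l)))"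


section \<open>Norms of scalar matrices\<close>

text \<open>The \<open>\<ell>\<^sub>p\<close> norm of an \<open>n\<close>-tuple whose entries have norms \<open>a 0, \<dots>, a (n - 1)\<close>.\<close>

definition lp_norm :: "real \<Rightarrow> nat \<Rightarrow> (nat \<Rightarrow> real) \<Rightarrow> real" where
  "lp_norm p n a = (\<Sum>i<n. a i powr p) powr (1 / p)"

text \<open>For \<open>\<alpha> \<in> M\<^bsub>n,m\<^esub>\<close>, the operator norm of \<open>\<alpha> : \<ell>\<^sub>p\<^sup>m \<rightarrow> \<ell>\<^sub>p\<^sup>n\<close>.\<close>

definition lp_op_norm :: "real \<Rightarrow> complex mat \<Rightarrow> real" where
  "lp_op_norm p \<alpha> =
     Sup {lp_norm p (dim_row \<alpha>) (\<lambda>i. cmod (\<Sum>j<dim_col \<alpha>. \<alpha> $$ (i, j) * x j)) | x.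
            lp_norm p (dim_col \<alpha>) (\<lambda>j. cmod (x j)) \<le> 1}"

definition entry_norm :: "real \<Rightarrow> complex mat \<Rightarrow> real" where
  "entry_norm q \<alpha> = (\<Sum>i<dim_row \<alpha>. \<Sum>j<dim_col \<alpha>. cmod (\<alpha> $$ (i, j)) powr q) powr (1 / q)"


section \<open>\<open>p\<close>-operator spaces\<close>

definition norm1 :: "('a mat \<Rightarrow> real) \<Rightarrow> 'a \<Rightarrow> real" where
  "norm1 N x = N (mat 1 1 (\<lambda>_. x))"

locale p_operator_space = vector_space sc
  for sc :: "complex \<Rightarrow> 'a::ab_group_add \<Rightarrow> 'a" +
  fixes p :: real and X :: "'a set" and N :: "'a mat \<Rightarrow> real"
  assumes subspace_carrier: "subspace X"
    and norm_nonneg: "\<And>n u. \<lbrakk>n \<ge> 1; u \<in> mats n n X\<rbrakk> \<Longrightarrow> 0 \<le> N u"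
    and norm_eq_0_iff: "\<And>n u. \<lbrakk>n \<ge> 1; u \<in> mats n n X\<rbrakk> \<Longrightarrow> N u = 0 \<longleftrightarrow> u = 0\<^sub>m n n"
    and norm_triangle:
      "\<And>n u v. \<lbrakk>n \<ge> 1; u \<in> mats n n X; v \<in> mats n n X\<rbrakk> \<Longrightarrow> N (u + v) \<le> N u + N v"
    and norm_scale:
      "\<And>n u c. \<lbrakk>n \<ge> 1; u \<in> mats n n X\<rbrakk> \<Longrightarrow> N (mat_scale sc c u) = cmod c * N u"
    and complete:
      "\<And>f :: nat \<Rightarrow> 'a. \<lbrakk>range f \<subseteq> X;
          \<forall>e>0. \<exists>K. \<forall>m\<ge>K. \<forall>n\<ge>K. norm1 N (f m - f n) < e\<rbrakk>
        \<Longrightarrow> \<exists>x\<in>X. (\<lambda>n. norm1 N (f n - x)) \<longlonglongrightarrow> 0"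
    and norm_dsum:
      "\<And>n m u v. \<lbrakk>n \<ge> 1; m \<ge> 1; u \<in> mats n n X; v \<in> mats m m X\<rbrakk>
        \<Longrightarrow> N (mat_dsum u v) = max (N u) (N v)"
    and norm_sandwich:
      "\<And>n m \<alpha> u \<beta>. \<lbrakk>n \<ge> 1; m \<ge> 1; u \<in> mats m m X; \<alpha> \<in> carrier_mat n m; \<beta> \<in> carrier_mat m n\<rbrakk>
        \<Longrightarrow> N (mat_sandwich sc \<alpha> u \<beta>) \<le> lp_op_norm p \<alpha> * N u * lp_op_norm p \<beta>"

text \<open>\<open>V \<subseteq> W\<close>: a closed subspace with the inherited matrix norms, that is, with the same \<open>N\<close>.\<close>

definition p_operator_subspace ::
  "(complex \<Rightarrow> 'a::ab_group_add \<Rightarrow> 'a) \<Rightarrow> real \<Rightarrow> 'a set \<Rightarrow> 'a set \<Rightarrow> ('a mat \<Rightarrow> real) \<Rightarrow> bool"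
where
  "p_operator_subspace sc p V W N \<longleftrightarrow>
     p_operator_space sc p W N \<and> module.subspace sc V \<and> V \<subseteq> W \<and>
     (\<forall>f x. range f \<subseteq> V \<and> x \<in> W \<and> (\<lambda>n::nat. norm1 N (f n - x)) \<longlonglongrightarrow> 0 \<longrightarrow> x \<in> V)"

lemma p_operator_subspace_imp_p_operator_space:
  assumes "p_operator_subspace sc p V W N"
  shows "p_operator_space sc p V N"
proof -
  from assms interpret W: p_operator_space sc p W N
    by (simp add: p_operator_subspace_def)
  have sub: "W.subspace V" and VW: "V \<subseteq> W"
    and cl: "\<And>f x. \<lbrakk>range f \<subseteq> V; x \<in> W; (\<lambda>n::nat. norm1 N (f n - x)) \<longlonglongrightarrow> 0\<rbrakk> \<Longrightarrow> x \<in> V"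
    using assms by (auto simp: p_operator_subspace_def)
  have mono: "u \<in> mats n m V \<Longrightarrow> u \<in> mats n m W" for u n m
    using VW by (auto simp: mats_def)
  show ?thesis
  proof unfold_locales
    fix f :: "nat \<Rightarrow> 'a"
    assume f: "range f \<subseteq> V" "\<forall>e>0. \<exists>K. \<forall>m\<ge>K. \<forall>n\<ge>K. norm1 N (f m - f n) < e"
    then show "\<exists>x\<in>V. (\<lambda>n. norm1 N (f n - x)) \<longlonglongrightarrow> 0"
      using W.complete[of f] VW cl by blast
  qed (use sub in \<open>auto intro: mono W.norm_nonneg W.norm_triangle W.norm_scale W.norm_sandwich
        simp: W.norm_eq_0_iff[OF _ mono] W.norm_dsum[OF _ _ mono mono]\<close>)
qed

text \<open>The norm of \<open>T\<^sub>n(X)\<close> at a matrix \<open>v \<in> M\<^sub>n(X)\<close>, with \<open>n = dim_row v\<close>.\<close>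

definition T_norm ::
  "real \<Rightarrow> real \<Rightarrow> (complex \<Rightarrow> 'a::ab_group_add \<Rightarrow> 'a) \<Rightarrow> 'a set \<Rightarrow> ('a mat \<Rightarrow> real) \<Rightarrow> 'a mat \<Rightarrow> real"
where
  "T_norm p p' sc X N v =
     Inf {entry_norm p' \<alpha> * N w * entry_norm p \<beta> | r \<alpha> w \<beta>.
            r \<ge> 1 \<and> \<alpha> \<in> carrier_mat (dim_row v) r \<and> \<beta> \<in> carrier_mat r (dim_row v) \<and>
            w \<in> mats r r X \<and> v = mat_sandwich sc \<alpha> w \<beta>}"


section \<open>The space \<open>L\<^sub>p(\<Omega>)\<close>\<close>

definition Lp_functions :: "real \<Rightarrow> 'm measure \<Rightarrow> ('m \<Rightarrow> complex) set" where
  "Lp_functions p \<Omega> = {f \<in> borel_measurable \<Omega>. integrable \<Omega> (\<lambda>x. cmod (f x) powr p)}"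

definition Lp_rel :: "real \<Rightarrow> 'm measure \<Rightarrow> (('m \<Rightarrow> complex) \<times> ('m \<Rightarrow> complex)) set" where
  "Lp_rel p \<Omega> =
     {(f, g). f \<in> Lp_functions p \<Omega> \<and> g \<in> Lp_functions p \<Omega> \<and> (AE x in \<Omega>. f x = g x)}"

definition Lp :: "real \<Rightarrow> 'm measure \<Rightarrow> ('m \<Rightarrow> complex) set set" where
  "Lp p \<Omega> = Lp_functions p \<Omega> // Lp_rel p \<Omega>"

definition Lp_class :: "real \<Rightarrow> 'm measure \<Rightarrow> ('m \<Rightarrow> complex) \<Rightarrow> ('m \<Rightarrow> complex) set" where
  "Lp_class p \<Omega> f = Lp_rel p \<Omega> `` {f}"

text \<open>
  The operations on classes are defined by means of a chosen representative; up to equality almost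
  everywhere, and hence as classes, their results do not depend on the choice.
\<close>

definition Lp_rep :: "('m \<Rightarrow> complex) set \<Rightarrow> 'm \<Rightarrow> complex" where
  "Lp_rep \<xi> = (SOME f. f \<in> \<xi>)"

definition Lp_add ::
  "real \<Rightarrow> 'm measure \<Rightarrow> ('m \<Rightarrow> complex) set \<Rightarrow> ('m \<Rightarrow> complex) set \<Rightarrow> ('m \<Rightarrow> complex) set" where
  "Lp_add p \<Omega> \<xi> \<eta> = Lp_class p \<Omega> (\<lambda>x. Lp_rep \<xi> x + Lp_rep \<eta> x)"

definition Lp_scale ::
  "real \<Rightarrow> 'm measure \<Rightarrow> complex \<Rightarrow> ('m \<Rightarrow> complex) set \<Rightarrow> ('m \<Rightarrow> complex) set" where
  "Lp_scale p \<Omega> c \<xi> = Lp_class p \<Omega> (\<lambda>x. c * Lp_rep \<xi> x)"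

definition Lp_norm :: "real \<Rightarrow> 'm measure \<Rightarrow> ('m \<Rightarrow> complex) set \<Rightarrow> real" where
  "Lp_norm p \<Omega> \<xi> = (\<integral>x. cmod (Lp_rep \<xi> x) powr p \<partial>\<Omega>) powr (1 / p)"


section \<open>The \<open>p\<close>-operator space \<open>B(L\<^sub>p(\<Omega>))\<close>\<close>

type_synonym 'm Lp_op = "('m \<Rightarrow> complex) set \<Rightarrow> ('m \<Rightarrow> complex) set"

text \<open>
  Operators are extensional functions on \<open>L\<^sub>p(\<Omega>)\<close>, so that two operators are equal if and only if
  they agree on \<open>L\<^sub>p(\<Omega>)\<close>.
\<close>

definition Lp_ops :: "real \<Rightarrow> 'm measure \<Rightarrow> 'm Lp_op set" where
  "Lp_ops p \<Omega> = {T \<in> Lp p \<Omega> \<rightarrow>\<^sub>E Lp p \<Omega>.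
     (\<forall>\<xi>\<in>Lp p \<Omega>. \<forall>\<eta>\<in>Lp p \<Omega>. T (Lp_add p \<Omega> \<xi> \<eta>) = Lp_add p \<Omega> (T \<xi>) (T \<eta>)) \<and>
     (\<forall>c. \<forall>\<xi>\<in>Lp p \<Omega>. T (Lp_scale p \<Omega> c \<xi>) = Lp_scale p \<Omega> c (T \<xi>)) \<and>
     (\<exists>C. \<forall>\<xi>\<in>Lp p \<Omega>. Lp_norm p \<Omega> (T \<xi>) \<le> C * Lp_norm p \<Omega> \<xi>)}"

definition Lp_op_add :: "real \<Rightarrow> 'm measure \<Rightarrow> 'm Lp_op \<Rightarrow> 'm Lp_op \<Rightarrow> 'm Lp_op" where
  "Lp_op_add p \<Omega> S T = (\<lambda>\<xi>\<in>Lp p \<Omega>. Lp_add p \<Omega> (S \<xi>) (T \<xi>))"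

definition Lp_op_scale :: "real \<Rightarrow> 'm measure \<Rightarrow> complex \<Rightarrow> 'm Lp_op \<Rightarrow> 'm Lp_op" where
  "Lp_op_scale p \<Omega> c T = (\<lambda>\<xi>\<in>Lp p \<Omega>. Lp_scale p \<Omega> c (T \<xi>))"

text \<open>The \<open>i\<close>-th component \<open>\<Sum>j. T\<^bsub>ij\<^esub> \<xi>\<^sub>j\<close> of the image of the tuple \<open>\<xi>\<close> under a matrix of operators.\<close>

definition Lp_mat_apply ::
  "real \<Rightarrow> 'm measure \<Rightarrow> 'm Lp_op mat \<Rightarrow> (nat \<Rightarrow> ('m \<Rightarrow> complex) set) \<Rightarrow> nat \<Rightarrow> ('m \<Rightarrow> complex) set"
where
  "Lp_mat_apply p \<Omega> T \<xi> i = Lp_class p \<Omega> (\<lambda>x. \<Sum>j<dim_col T. Lp_rep ((T $$ (i, j)) (\<xi> j)) x)"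

text \<open>The norm of \<open>T \<in> M\<^sub>n(B(L\<^sub>p(\<Omega>)))\<close> as an operator on \<open>\<ell>\<^sub>p\<^sup>n(L\<^sub>p(\<Omega>))\<close>.\<close>

definition Lp_mat_norm :: "real \<Rightarrow> 'm measure \<Rightarrow> 'm Lp_op mat \<Rightarrow> real" where
  "Lp_mat_norm p \<Omega> T =
     Sup {lp_norm p (dim_row T) (\<lambda>i. Lp_norm p \<Omega> (Lp_mat_apply p \<Omega> T \<xi> i)) | \<xi>.
            (\<forall>j<dim_col T. \<xi> j \<in> Lp p \<Omega>) \<and>
            lp_norm p (dim_col T) (\<lambda>j. Lp_norm p \<Omega> (\<xi> j)) \<le> 1}"


section \<open>\<open>p\<close>-completely contractive maps\<close>

text \<open>
  The value \<open>sup\<^sub>n \<parallel>u\<^sub>n\<parallel>\<close>, possibly infinite, for a map \<open>u\<close> on \<open>X\<close>, where \<open>N\<close> and \<open>N'\<close> are the matrix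
  norms of the domain and the codomain.
\<close>

definition cb_norm :: "'a set \<Rightarrow> ('a mat \<Rightarrow> real) \<Rightarrow> ('b mat \<Rightarrow> real) \<Rightarrow> ('a \<Rightarrow> 'b) \<Rightarrow> ereal" where
  "cb_norm X N N' u =
     (SUP n\<in>{1..}. SUP v\<in>{v \<in> mats n n X. N v \<le> 1}. ereal (N' (map_mat u v)))"

text \<open>\<open>\<phi> : X \<rightarrow> B(L\<^sub>p(\<Omega>))\<close> is linear and \<open>p\<close>-completely contractive.\<close>

definition p_completely_contractive ::
  "(complex \<Rightarrow> 'a::ab_group_add \<Rightarrow> 'a) \<Rightarrow> 'a set \<Rightarrow> ('a mat \<Rightarrow> real) \<Rightarrow> real \<Rightarrow> 'm measure
     \<Rightarrow> ('a \<Rightarrow> 'm Lp_op) \<Rightarrow> bool"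
where
  "p_completely_contractive sc X N p \<Omega> \<phi> \<longleftrightarrow>
     (\<forall>x\<in>X. \<phi> x \<in> Lp_ops p \<Omega>) \<and>
     (\<forall>x\<in>X. \<forall>y\<in>X. \<phi> (x + y) = Lp_op_add p \<Omega> (\<phi> x) (\<phi> y)) \<and>
     (\<forall>c. \<forall>x\<in>X. \<phi> (sc c x) = Lp_op_scale p \<Omega> c (\<phi> x)) \<and>
     cb_norm X N (Lp_mat_norm p \<Omega>) \<phi> \<le> 1"

end

theory Submission
  imports Defs "HOL-Library.Function_Algebras"
begin

text \<open>
  A completely contractive \<open>\<phi>\<close> on \<open>V\<close> is the same as the functional
  \<open>g \<otimes> v \<otimes> f \<mapsto> \<integral> g \<cdot> \<phi>(v) f\<close> on tensors with simple functions \<open>f\<close> and \<open>g\<close>; such a tensor is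
  concretely the function \<open>(x, y) \<mapsto> g(x) f(y) v\<close> on \<open>\<Omega> \<times> \<Omega>\<close>.  Finitely many simple functions
  live on a common finite partition, where a tensor becomes a matrix and the natural gauge on
  tensors becomes the norm of \<open>T\<^sub>n\<close>.  Equality of the norms of \<open>T\<^sub>n(V)\<close> and \<open>T\<^sub>n(W)\<close> therefore says
  that the functional is bounded by the gauge computed in \<open>W\<close>, and a single application of
  Hahn--Banach extends it.  Reflexivity of \<open>L\<^sub>p\<close>, for an arbitrary measure, turns the extended
  functional back into operators.
\<close>

text \<open>Write \<open>q\<close> for the exponent conjugate to \<open>p\<close>. The gauge of a
  tensor is handled through its admissible bounds \<open>s\<close>: some representation has
  \<open>N w \<le> 1\<close>, while the q-th powers of the norms of the left functions and the p-th
  powers of the norms of the right functions each sum to at most \<open>s\<close>. As 1/p + 1/q = 1,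
  such a representation has size at most s^(1/q) s^(1/p) = s. With this normalisation
  representations add along direct sums of matrices, where \<open>N\<close> is a maximum, and their
  bounds add too; subadditivity of the gauge is thus the direct sum axiom.

  Duality comes from minimising a uniformly convex functional rather than from Radon--Nikodym, since
  no finiteness of the measure is available. Simple functions are kept as genuine functions, so that
  equality of tensors is a pointwise identity, to be evaluated at one sample point per cell; null
  sets enter only once operators act. Operators are recovered by choice, for one vector at a time,
  and linearity comes back from uniqueness of the representing functions.\<close>

section \<open>A Hahn--Banach theorem for graphs\<close>

text \<open>\<open>R x s\<close> is read as: \<open>s\<close> bounds the gauge of \<open>x\<close>.
  The functional is controlled only where some bound exists. Graphs are plain relations, and
  domination alone makes them single-valued on that domain, because \<open>R_scale\<close> with
  factor 0 yields \<open>R 0 0\<close>. Zorn's lemma therefore runs over dominated linear relations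
  instead of functions.\<close>

lemma real_hahn_banach_graph:
  fixes sc :: "real \<Rightarrow> 'b::ab_group_add \<Rightarrow> 'b" and R :: "'b \<Rightarrow> real \<Rightarrow> bool"
    and H0 :: "('b \<times> real) set"
  assumes "vector_space sc"
    and H0_zero: "(0, 0) \<in> H0"
    and H0_add: "\<And>x s y t. (x, s) \<in> H0 \<Longrightarrow> (y, t) \<in> H0 \<Longrightarrow> (x + y, s + t) \<in> H0"
    and H0_scale: "\<And>c x s. (x, s) \<in> H0 \<Longrightarrow> (sc c x, c * s) \<in> H0"
    and R_add: "\<And>x s y t. R x s \<Longrightarrow> R y t \<Longrightarrow> R (x + y) (s + t)"
    and R_scale: "\<And>c x s. R x s \<Longrightarrow> R (sc c x) (\<bar>c\<bar> * s)"
    and H0_le: "\<And>x t s. (x, t) \<in> H0 \<Longrightarrow> R x s \<Longrightarrow> t \<le> s"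
  shows "\<exists>f. (\<forall>x s y t. R x s \<longrightarrow> R y t \<longrightarrow> f (x + y) = f x + f y) \<and>
             (\<forall>c x s. R x s \<longrightarrow> f (sc c x) = c * f x) \<and>
             (\<forall>x s. R x s \<longrightarrow> f x \<le> s) \<and>
             (\<forall>x t s. (x, t) \<in> H0 \<longrightarrow> R x s \<longrightarrow> f x = t)"
proof -
  interpret vector_space sc by fact
  define good where "good = {H. H0 \<subseteq> H \<and>
      (\<forall>x s y t. (x, s) \<in> H \<longrightarrow> (y, t) \<in> H \<longrightarrow> (x + y, s + t) \<in> H) \<and>
      (\<forall>c x s. (x, s) \<in> H \<longrightarrow> (sc c x, c * s) \<in> H) \<and>
      (\<forall>x t s. (x, t) \<in> H \<longrightarrow> R x s \<longrightarrow> t \<le> s)}"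
  have goodD: "H0 \<subseteq> H" "\<And>x s y t. (x, s) \<in> H \<Longrightarrow> (y, t) \<in> H \<Longrightarrow> (x + y, s + t) \<in> H"
    "\<And>c x s. (x, s) \<in> H \<Longrightarrow> (sc c x, c * s) \<in> H"
    "\<And>x t s. (x, t) \<in> H \<Longrightarrow> R x s \<Longrightarrow> t \<le> s" if "H \<in> good" for H
    using that unfolding good_def by auto
  have "\<exists>M\<in>good. \<forall>X\<in>good. M \<subseteq> X \<longrightarrow> X = M"
  proof (rule subset_Zorn_nonempty)
    have "H0 \<in> good"
      using H0_add H0_scale H0_le by (auto simp: good_def)
    then show "good \<noteq> {}" by blast
  next
    fix C assume C: "C \<noteq> {}" "subset.chain good C"
    have Cg: "\<And>H. H \<in> C \<Longrightarrow> H \<in> good" using C by (auto simp: subset.chain_def)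
    have Ct: "\<And>G H. G \<in> C \<Longrightarrow> H \<in> C \<Longrightarrow> G \<subseteq> H \<or> H \<subseteq> G"
      using C by (auto simp: subset.chain_def)
    have 1: "(x + y, s + t) \<in> \<Union>C" if xy: "(x, s) \<in> \<Union>C" "(y, t) \<in> \<Union>C" for x s y t
    proof -
      obtain G H where GH: "G \<in> C" "H \<in> C" "(x, s) \<in> G" "(y, t) \<in> H" using xy by auto
      then obtain K where "K \<in> C" "(x, s) \<in> K" "(y, t) \<in> K" using Ct[OF GH(1,2)] by auto
      then show ?thesis using goodD(2)[OF Cg] by blast
    qed
    have 2: "H0 \<subseteq> \<Union>C" using C(1) goodD(1)[OF Cg] by blast
    have 3: "(sc c x, c * s) \<in> \<Union>C" if "(x, s) \<in> \<Union>C" for c x s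
      using that goodD(3)[OF Cg] by blast
    have 4: "t \<le> s" if "(x, t) \<in> \<Union>C" "R x s" for x t s
      using that goodD(4)[OF Cg] by blast
    show "\<Union>C \<in> good" using 1 2 3 4 by (simp add: good_def del: Union_iff)
  qed
  then obtain M where M: "M \<in> good" and max: "\<And>X. X \<in> good \<Longrightarrow> M \<subseteq> X \<Longrightarrow> X = M" by blast
  have M_add: "\<And>x s y t. (x, s) \<in> M \<Longrightarrow> (y, t) \<in> M \<Longrightarrow> (x + y, s + t) \<in> M"
    and M_scale: "\<And>c x s. (x, s) \<in> M \<Longrightarrow> (sc c x, c * s) \<in> M"
    and M_le: "\<And>x t s. (x, t) \<in> M \<Longrightarrow> R x s \<Longrightarrow> t \<le> s"
    and M_H0: "H0 \<subseteq> M"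
    using goodD[OF M] by auto
  have M_zero: "(0, 0) \<in> M" using M_H0 H0_zero by blast
  have R_neg: "R (- x) s" if "R x s" for x s
    using R_scale[OF that, of "-1"] by simp
  have total: "\<exists>t. (x, t) \<in> M" if Rx: "R x r" for x r
  proof -
    \<comment> \<open>A pair \<open>(u, t)\<close> of the graph with a bound \<open>s\<close> on
      \<open>u - x\<close> forces the value at \<open>x\<close> to be at least \<open>t - s\<close>.
      By \<open>LU\<close> every such lower bound lies below every upper bound coming from some
      \<open>u + x\<close>, so \<open>Sup L\<close> is an admissible value.\<close>
    define L where "L = {t - s | u t s. (u, t) \<in> M \<and> R (u - x) s}"
    have LU: "l \<le> s - t" if "l \<in> L" "(u, t) \<in> M" "R (u + x) s" for l u t s
    proof -
      obtain u' t' s' where l: "l = t' - s'" "(u', t') \<in> M" "R (u' - x) s'"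
        using \<open>l \<in> L\<close> by (auto simp: L_def)
      have "R ((u' - x) + (u + x)) (s' + s)" using R_add l that by blast
      then have "R (u' + u) (s' + s)" by simp
      from M_le[OF M_add[OF l(2) that(2)] this] show ?thesis using l by simp
    qed
    have "0 - r \<in> L" unfolding L_def using M_zero R_neg[OF Rx] by force
    then have ne: "L \<noteq> {}" by blast
    have bdd: "bdd_above L"
      using LU[OF _ M_zero, of _ r] Rx by (auto intro!: bdd_aboveI[of _ r])
    define a where "a = Sup L"
    have a1: "t - s \<le> a" if "(u, t) \<in> M" "R (u - x) s" for u t s
      unfolding a_def by (rule cSup_upper[OF _ bdd]) (use that in \<open>auto simp: L_def\<close>)
    have a2: "t + a \<le> s" if "(u, t) \<in> M" "R (u + x) s" for u t s
    proof -
      have "a \<le> s - t" unfolding a_def using LU that ne by (intro cSup_least) auto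
      then show ?thesis by simp
    qed
    \<comment> \<open>\<open>x\<close> may already lie in the domain of \<open>M\<close>; for
      relations this is harmless, and maximality gives \<open>M' = M\<close> in either case.\<close>
    define M' where "M' = {(u + sc c x, t + c * a) | u t c. (u, t) \<in> M}"
    have "M' \<in> good"
      unfolding good_def
    proof (intro CollectI conjI allI impI)
      have "(u, t) \<in> M'" if "(u, t) \<in> M" for u t
        unfolding M'_def using that by (intro CollectI exI[of _ u] exI[of _ t] exI[of _ 0]) auto
      then show "H0 \<subseteq> M'" using M_H0 by auto
    next
      fix y s z t assume "(y, s) \<in> M'" "(z, t) \<in> M'"
      then obtain u v c d s' t' where "y = u + sc c x" "s = s' + c * a" "(u, s') \<in> M"
        "z = v + sc d x" "t = t' + d * a" "(v, t') \<in> M" by (auto simp: M'_def)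
      then show "(y + z, s + t) \<in> M'" unfolding M'_def
        by (intro CollectI exI[of _ "u + v"] exI[of _ "s' + t'"] exI[of _ "c + d"])
          (auto simp: scale_left_distrib algebra_simps M_add)
    next
      fix k y s assume "(y, s) \<in> M'"
      then obtain u c s' where "y = u + sc c x" "s = s' + c * a" "(u, s') \<in> M"
        by (auto simp: M'_def)
      then show "(sc k y, k * s) \<in> M'" unfolding M'_def
        by (intro CollectI exI[of _ "sc k u"] exI[of _ "k * s'"] exI[of _ "k * c"])
          (auto simp: scale_right_distrib algebra_simps M_scale)
    next
      fix y t s assume "(y, t) \<in> M'" and Ry: "R y s"
      then obtain u c t' where y: "y = u + sc c x" "t = t' + c * a" "(u, t') \<in> M"
        by (auto simp: M'_def)
      consider "c = 0" | "c > 0" | "c < 0" by linarith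
      then show "t \<le> s"
      proof cases
        case 1 then show ?thesis using y Ry M_le by auto
      next
        case 2
        have "R (sc (1/c) u + x) (s / c)"
          using R_scale[OF Ry, of "1/c"] y 2 by (simp add: scale_right_distrib)
        from a2[OF M_scale[OF y(3), of "1/c"] this]
        have "c * (1 / c * t' + a) \<le> c * (s / c)" using 2 by (intro mult_left_mono) auto
        then show ?thesis using 2 y by (simp add: distrib_left)
      next
        case 3
        have "R (sc (-1/c) u - x) (s / (-c))"
          using R_scale[OF Ry, of "-1/c"] y 3 by (simp add: scale_right_distrib abs_if divide_simps)
        from a1[OF M_scale[OF y(3), of "-1/c"] this]
        have "(- c) * (-1 / c * t' - s / (- c)) \<le> (- c) * a" using 3 by (intro mult_left_mono) auto
        then show ?thesis using 3 y by (simp add: right_diff_distrib)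
      qed
    qed
    moreover have "M \<subseteq> M'"
    proof clarify
      fix u t assume "(u, t) \<in> M"
      then show "(u, t) \<in> M'"
        unfolding M'_def by (intro CollectI exI[of _ u] exI[of _ t] exI[of _ 0]) auto
    qed
    moreover have "(x, a) \<in> M'"
      unfolding M'_def using M_zero by (intro CollectI exI[of _ 0] exI[of _ 1]) auto
    ultimately show ?thesis using max by blast
  qed
  \<comment> \<open>Two values at one point differ by a value at 0, which \<open>R 0 0\<close>
    forces to be at most 0.\<close>
  have unique: "t = t'" if "(x, t) \<in> M" "(x, t') \<in> M" "R x s" for x t t' s
  proof -
    have le: "a \<le> b" if "(x, a) \<in> M" "(x, b) \<in> M" for a b
    proof (rule ccontr)
      assume ab: "\<not> a \<le> b"
      have "(x + sc (-1) x, a + (-1) * b) \<in> M" using that M_add M_scale by blast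
      then have "(0, a - b) \<in> M" by simp
      moreover have "R 0 0" using R_scale[OF \<open>R x s\<close>, of 0] by simp
      ultimately show False using M_le ab by fastforce
    qed
    then show ?thesis using that by (meson antisym)
  qed
  define f where "f x = (SOME t. (x, t) \<in> M)" for x
  have fM: "(x, f x) \<in> M" if "R x s" for x s
    unfolding f_def using total[OF that] by (rule someI_ex)
  have feq: "f x = t" if "(x, t) \<in> M" "R x s" for x t s
    using unique fM that by blast
  show ?thesis
  proof (intro exI[of _ f] conjI allI impI)
    show "f (x + y) = f x + f y" if "R x s" "R y t" for x s y t
      using feq[OF M_add[OF fM fM] R_add] that by blast
    show "f (sc c x) = c * f x" if "R x s" for c x s
      using feq[OF M_scale[OF fM] R_scale] that by blast
    show "f x \<le> s" if "R x s" for x s using M_le fM that by blast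
    show "f x = t" if "(x, t) \<in> H0" "R x s" for x t s using feq M_H0 that by blast
  qed
qed

text \<open>A complex linear functional is recovered from its real part \<open>f\<close> as
  \<open>f x - \<i> f (\<i> x)\<close>. The bound on the modulus follows by rotating
  \<open>x\<close> until the value is real and nonnegative.\<close>

lemma complex_hahn_banach_graph:
  fixes sc :: "complex \<Rightarrow> 'b::ab_group_add \<Rightarrow> 'b" and R :: "'b \<Rightarrow> real \<Rightarrow> bool"
    and H0 :: "('b \<times> complex) set"
  assumes "vector_space sc"
    and H0_zero: "(0, 0) \<in> H0"
    and H0_add: "\<And>x s y t. (x, s) \<in> H0 \<Longrightarrow> (y, t) \<in> H0 \<Longrightarrow> (x + y, s + t) \<in> H0"
    and H0_scale: "\<And>c x s. (x, s) \<in> H0 \<Longrightarrow> (sc c x, c * s) \<in> H0"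
    and R_add: "\<And>x s y t. R x s \<Longrightarrow> R y t \<Longrightarrow> R (x + y) (s + t)"
    and R_scale: "\<And>c x s. R x s \<Longrightarrow> R (sc c x) (cmod c * s)"
    and H0_le: "\<And>x t s. (x, t) \<in> H0 \<Longrightarrow> R x s \<Longrightarrow> cmod t \<le> s"
  shows "\<exists>g. (\<forall>x s y t. R x s \<longrightarrow> R y t \<longrightarrow> g (x + y) = g x + g y) \<and>
             (\<forall>c x s. R x s \<longrightarrow> g (sc c x) = c * g x) \<and>
             (\<forall>x s. R x s \<longrightarrow> cmod (g x) \<le> s) \<and>
             (\<forall>x t s. (x, t) \<in> H0 \<longrightarrow> R x s \<longrightarrow> g x = t)"
proof -
  interpret vector_space sc by fact
  define H where "H = {(x, Re t) | x t. (x, t) \<in> H0}"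
  have "\<exists>f. (\<forall>x s y t. R x s \<longrightarrow> R y t \<longrightarrow> f (x + y) = f x + f y) \<and>
             (\<forall>c x s. R x s \<longrightarrow> f (sc (complex_of_real c) x) = c * f x) \<and>
             (\<forall>x s. R x s \<longrightarrow> f x \<le> s) \<and>
             (\<forall>x t s. (x, t) \<in> H \<longrightarrow> R x s \<longrightarrow> f x = t)"
  proof (rule real_hahn_banach_graph)
    show "vector_space (\<lambda>c. sc (complex_of_real c))"
      by unfold_locales (simp_all add: scale_right_distrib scale_left_distrib)
    show "(0, 0) \<in> H" unfolding H_def using H0_zero by force
    show "(x + y, s + t) \<in> H" if xy: "(x, s) \<in> H" "(y, t) \<in> H" for x s y t
    proof -
      obtain s' t' where "(x, s') \<in> H0" "s = Re s'" "(y, t') \<in> H0" "t = Re t'"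
        using xy by (auto simp: H_def)
      then show ?thesis unfolding H_def using H0_add[of x s' y t'] by force
    qed
    show "(sc (complex_of_real c) x, c * s) \<in> H" if xs: "(x, s) \<in> H" for c x s
    proof -
      obtain s' where "(x, s') \<in> H0" "s = Re s'" using xs by (auto simp: H_def)
      then show ?thesis unfolding H_def using H0_scale[of x s' "of_real c"] by force
    qed
    show "R (x + y) (s + t)" if "R x s" "R y t" for x s y t using R_add that .
    show "R (sc (complex_of_real c) x) (\<bar>c\<bar> * s)" if "R x s" for c x s
      using R_scale[OF that, of "of_real c"] by simp
    show "t \<le> s" if Ht: "(x, t) \<in> H" and "R x s" for x t s
    proof -
      obtain t' where "(x, t') \<in> H0" "t = Re t'" using Ht by (auto simp: H_def)
      then show ?thesis using H0_le[of x t' s] complex_Re_le_cmod[of t'] that by linarith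
    qed
  qed
  then obtain f where f_add: "\<And>x s y t. R x s \<Longrightarrow> R y t \<Longrightarrow> f (x + y) = f x + f y"
    and f_scale: "\<And>c x s. R x s \<Longrightarrow> f (sc (complex_of_real c) x) = c * f x"
    and f_le: "\<And>x s. R x s \<Longrightarrow> f x \<le> s"
    and f_eq: "\<And>x t s. (x, t) \<in> H \<Longrightarrow> R x s \<Longrightarrow> f x = t" by blast
  define g where "g x = Complex (f x) (- f (sc \<i> x))" for x
  have g_scale: "g (sc c x) = c * g x" if Rx: "R x s" for c x s
  proof -
    have Rs: "\<exists>s. R (sc c x) s" for c using R_scale[OF Rx] by blast
    have split: "f (sc c x) = Re c * f x + Im c * f (sc \<i> x)" for c
    proof -
      have "sc c x = sc (of_real (Re c)) x + sc (of_real (Im c)) (sc \<i> x)"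
        by (subst complex_eq[of c]) (simp add: scale_left_distrib mult.commute)
      then have "f (sc c x) = f (sc (of_real (Re c)) x) + f (sc (of_real (Im c)) (sc \<i> x))"
        using f_add Rs by (metis scale_scale)
      then show ?thesis using f_scale Rs Rx by metis
    qed
    show ?thesis
      unfolding g_def scale_scale split[of c] split[of "\<i> * c"]
      by (simp add: complex_eq_iff algebra_simps)
  qed
  show ?thesis
  proof (intro exI[of _ g] conjI allI impI)
    show "g (x + y) = g x + g y" if "R x s" "R y t" for x s y t
      using f_add[OF that] f_add[OF R_scale[OF that(1), of \<i>] R_scale[OF that(2), of \<i>]]
      by (simp add: g_def scale_right_distrib complex_eq_iff)
    show "g (sc c x) = c * g x" if "R x s" for c x s using g_scale that .
    show "cmod (g x) \<le> s" if Rx: "R x s" for x s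
    proof (cases "g x = 0")
      case True
      have "f x = 0" using True by (simp add: g_def complex_eq_iff)
      then show ?thesis using f_le[OF Rx] True by simp
    next
      case False
      define c where "c = cnj (g x) / cmod (g x)"
      have c1: "cmod c = 1" using False by (simp add: c_def norm_divide)
      have "g (sc c x) = g x * cnj (g x) / cmod (g x)"
        using g_scale[OF Rx, of c] by (simp add: c_def mult.commute)
      also have "\<dots> = of_real (cmod (g x))"
        using False by (simp flip: complex_norm_square add: power2_eq_square)
      finally have "g (sc c x) = of_real (cmod (g x))" .
      then have "f (sc c x) = cmod (g x)" by (simp add: g_def complex_eq_iff)
      then show ?thesis using f_le[OF R_scale[OF Rx, of c]] c1 by simp
    qed
    show "g x = t" if "(x, t) \<in> H0" "R x s" for x t s
    proof -
      have 1: "(x, Re t) \<in> H" "(sc \<i> x, Re (\<i> * t)) \<in> H" unfolding H_def using H0_scale that by blast+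
      have "f x = Re t" "f (sc \<i> x) = - Im t"
        using f_eq[OF 1(1) that(2)] f_eq[OF 1(2) R_scale[OF that(2)]] by simp_all
      then show ?thesis by (simp add: g_def complex_eq_iff)
    qed
  qed
qed

section \<open>Functions in \<open>L\<^sub>p\<close> and simple functions\<close>

definition pow_integral :: "real \<Rightarrow> 'm measure \<Rightarrow> ('m \<Rightarrow> complex) \<Rightarrow> real" where
  "pow_integral r M f = (\<integral>x. cmod (f x) powr r \<partial>M)"

lemma pow_integral_nonneg [simp]: "0 \<le> pow_integral r M f"
  by (simp add: pow_integral_def)

lemma Lp_functionsD:
  assumes "f \<in> Lp_functions r M"
  shows "f \<in> borel_measurable M" "integrable M (\<lambda>x. cmod (f x) powr r)"
  using assms by (auto simp: Lp_functions_def)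

lemma Lp_functions_bound:
  assumes [measurable]: "f \<in> borel_measurable M"
    and "integrable M w" and "AE x in M. cmod (f x) powr r \<le> w x"
  shows "f \<in> Lp_functions r M"
  unfolding Lp_functions_def
proof (intro CollectI conjI)
  show "integrable M (\<lambda>x. cmod (f x) powr r)"
    by (rule Bochner_Integration.integrable_bound[OF assms(2)])
      (use assms(3) in \<open>auto elim!: eventually_mono\<close>)
qed fact

lemma powr_add_le:
  fixes a b r :: real
  assumes "0 \<le> a" "0 \<le> b" "0 < r"
  shows "(a + b) powr r \<le> 2 powr r * (a powr r + b powr r)"
proof -
  have "(a + b) powr r \<le> (2 * max a b) powr r" using assms by (intro powr_mono2) auto
  also have "\<dots> = 2 powr r * max a b powr r" using assms by (simp add: powr_mult)
  also have "\<dots> \<le> 2 powr r * (a powr r + b powr r)"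
    by (intro mult_left_mono) (auto simp: max_def)
  finally show ?thesis .
qed

lemma Lp_functions_cmult:
  assumes "f \<in> Lp_functions r M"
  shows "(\<lambda>x. c * f x) \<in> Lp_functions r M"
  using assms by (auto simp: Lp_functions_def norm_mult powr_mult)

lemma Lp_functions_cmod:
  "f \<in> Lp_functions r M \<Longrightarrow> (\<lambda>x. complex_of_real (cmod (f x))) \<in> Lp_functions r M"
  by (auto simp: Lp_functions_def)

lemma pow_integral_cmult: "pow_integral r M (\<lambda>x. c * f x) = cmod c powr r * pow_integral r M f"
  by (simp add: pow_integral_def norm_mult powr_mult)

lemma Lp_functions_add:
  assumes "f \<in> Lp_functions r M" "g \<in> Lp_functions r M" "0 < r"
  shows "(\<lambda>x. f x + g x) \<in> Lp_functions r M"
proof (rule Lp_functions_bound)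
  show "(\<lambda>x. f x + g x) \<in> borel_measurable M"
    using assms by (intro borel_measurable_add) (auto dest: Lp_functionsD)
  show "integrable M (\<lambda>x. 2 powr r * (cmod (f x) powr r + cmod (g x) powr r))"
    using assms by (auto dest: Lp_functionsD)
  have "cmod (f x + g x) powr r \<le> 2 powr r * (cmod (f x) powr r + cmod (g x) powr r)" for x
  proof -
    have "cmod (f x + g x) powr r \<le> (cmod (f x) + cmod (g x)) powr r"
      using assms by (intro powr_mono2) (auto simp: norm_triangle_ineq)
    also have "\<dots> \<le> 2 powr r * (cmod (f x) powr r + cmod (g x) powr r)"
      using assms by (intro powr_add_le) auto
    finally show ?thesis .
  qed
  then show "AE x in M. cmod (f x + g x) powr r \<le> 2 powr r * (cmod (f x) powr r + cmod (g x) powr r)"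
    by simp
qed

lemma Lp_functions_diff:
  assumes "f \<in> Lp_functions r M" "g \<in> Lp_functions r M" "0 < r"
  shows "(\<lambda>x. f x - g x) \<in> Lp_functions r M"
  using Lp_functions_add[OF assms(1) Lp_functions_cmult[OF assms(2), of "-1"] assms(3)] by simp

lemma Lp_functions_zero: "0 < r \<Longrightarrow> (\<lambda>x. 0) \<in> Lp_functions r M"
  by (simp add: Lp_functions_def)

lemma Lp_functions_sum:
  assumes "0 < r" "\<And>i. i \<in> I \<Longrightarrow> f i \<in> Lp_functions r M"
  shows "(\<lambda>x. \<Sum>i\<in>I. f i x) \<in> Lp_functions r M"
  using assms(2)
  by (induction I rule: infinite_finite_induct)
    (auto intro!: Lp_functions_add Lp_functions_zero assms(1))

lemma pow_integral_cong_AE: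
  assumes "f \<in> borel_measurable M" "g \<in> borel_measurable M" "AE x in M. f x = g x"
  shows "pow_integral r M f = pow_integral r M g"
  unfolding pow_integral_def
  using assms by (intro integral_cong_AE) (auto elim!: eventually_mono)

lemma pow_integral_eq_0_iff:
  assumes "f \<in> Lp_functions r M"
  shows "pow_integral r M f = 0 \<longleftrightarrow> (AE x in M. f x = 0)"
  unfolding pow_integral_def
  using integral_nonneg_eq_0_iff_AE[OF Lp_functionsD(2)[OF assms]] by simp

section \<open>Simple functions with support of finite measure, and their density\<close>

definition simple_fns :: "'m measure \<Rightarrow> ('m \<Rightarrow> complex) set" where
  "simple_fns M = {f. Bochner_Integration.simple_bochner_integrable M f \<and> (\<forall>x. x \<notin> space M \<longrightarrow> f x = 0)}"

lemma simple_fnsI: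
  assumes "simple_function M f" "emeasure M {x\<in>space M. f x \<noteq> 0} \<noteq> \<infinity>"
    "\<And>x. x \<notin> space M \<Longrightarrow> f x = 0"
  shows "f \<in> simple_fns M"
  using assms by (auto simp: simple_fns_def simple_bochner_integrable.simps)

lemma simple_fnsD:
  assumes "f \<in> simple_fns M"
  shows "simple_function M f" "emeasure M {x\<in>space M. f x \<noteq> 0} \<noteq> \<infinity>"
    "\<And>x. x \<notin> space M \<Longrightarrow> f x = 0" "f \<in> borel_measurable M"
  using assms
  by (auto simp: simple_fns_def simple_bochner_integrable.simps intro: borel_measurable_simple_function)

lemma simple_fns_zero: "(\<lambda>x. 0) \<in> simple_fns M"
  by (rule simple_fnsI) auto

lemma simple_fns_add:
  "f \<in> simple_fns M \<Longrightarrow> g \<in> simple_fns M \<Longrightarrow> (\<lambda>x. f x + g x) \<in> simple_fns M"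
  using simple_bochner_integrable_compose2[of "(+)" M f g] by (auto simp: simple_fns_def)

lemma simple_fns_cmult: "f \<in> simple_fns M \<Longrightarrow> (\<lambda>x. c * f x) \<in> simple_fns M"
  using simple_bochner_integrable_compose2[of "\<lambda>x y. c * x" M f f] by (auto simp: simple_fns_def)

lemma simple_fns_indicator:
  assumes "A \<in> sets M" "emeasure M A \<noteq> \<infinity>"
  shows "(\<lambda>x. indicator A x) \<in> simple_fns M"
proof (rule simple_fnsI)
  have "{x \<in> space M. indicator A x \<noteq> (0::complex)} = A"
    using sets.sets_into_space[OF assms(1)] by (auto simp: indicator_def)
  then show "emeasure M {x \<in> space M. indicator A x \<noteq> (0::complex)} \<noteq> \<infinity>" using assms by simp
  show "simple_function M (\<lambda>x. indicator A x :: complex)" using assms(1) by simp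
qed (use sets.sets_into_space[OF assms(1)] in \<open>auto simp: indicator_def\<close>)

lemma simple_fns_Lp:
  assumes "f \<in> simple_fns M"
  shows "f \<in> Lp_functions r M"
proof -
  have "Bochner_Integration.simple_bochner_integrable M (\<lambda>x. cmod (f x) powr r)"
    using assms simple_bochner_integrable_compose2[of "\<lambda>x y. cmod x powr r" M f f]
    by (auto simp: simple_fns_def)
  then have "integrable M (\<lambda>x. cmod (f x) powr r)"
    by (auto simp: integrable.simps intro: has_bochner_integral_simple_bochner_integrable)
  then show ?thesis using simple_fnsD[OF assms] by (simp add: Lp_functions_def)
qed

text \<open>The dominated pointwise approximation by functions with finitely many values is
  standard; what remains is that their supports have finite measure.\<close>

lemma simple_fns_dense:
  assumes f: "f \<in> Lp_functions r M" and "0 < r"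
  shows "\<exists>F. (\<forall>n. F n \<in> simple_fns M) \<and> (\<forall>x\<in>space M. (\<lambda>n. F n x) \<longlonglongrightarrow> f x) \<and>
    (\<forall>n. \<forall>x\<in>space M. cmod (F n x) \<le> 2 * cmod (f x))"
proof -
  obtain G where G: "\<And>i. simple_function M (G i)" "\<And>x. x \<in> space M \<Longrightarrow> (\<lambda>i. G i x) \<longlonglongrightarrow> f x"
    "\<And>i x. x \<in> space M \<Longrightarrow> dist (G i x) 0 \<le> 2 * dist (f x) 0"
    using borel_measurable_implies_sequence_metric[OF Lp_functionsD(1)[OF f], of 0] by blast
  define F where "F n x = G n x * indicator (space M) x" for n x
  have F: "F n x = G n x" if "x \<in> space M" for n x using that by (simp add: F_def)
  have sf: "simple_function M (F n)" for n
    using G(1)[of n] simple_function_cong[of M "F n" "G n"] F by auto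
  have bd: "cmod (F n x) \<le> 2 * cmod (f x)" if "x \<in> space M" for n x
    using F that G(3)[OF that, of n] by simp
  have "F n \<in> simple_fns M" for n
  proof (rule simple_fnsI[OF sf])
    have [measurable]: "F n \<in> borel_measurable M" using sf borel_measurable_simple_function by blast
    define Z where "Z = {x \<in> space M. F n x \<noteq> 0}"
    \<comment> \<open>The least nonzero value of |F n|^r, attained because there are finitely many
      values. On the support |F n|^r is at least \<open>c\<close>, so Markov's inequality bounds its
      measure.\<close>
    define c where "c = (if Z = {} then 1 else Min ((\<lambda>x. cmod (F n x) powr r) ` Z))"
    have fin: "finite ((\<lambda>x. cmod (F n x) powr r) ` Z)"
    proof -
      have "(\<lambda>x. cmod (F n x) powr r) ` Z \<subseteq> (\<lambda>z. cmod z powr r) ` (F n ` space M)"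
        by (auto simp: Z_def)
      then show ?thesis using simple_functionD(1)[OF sf] finite_subset by blast
    qed
    have c0: "c > 0"
    proof (cases "Z = {}")
      case False
      then have "c \<in> (\<lambda>x. cmod (F n x) powr r) ` Z" using Min_in[OF fin] by (simp add: c_def)
      then show ?thesis by (auto simp: Z_def)
    qed (simp add: c_def)
    have cle: "c \<le> cmod (F n x) powr r" if "x \<in> Z" for x
      using Min_le[OF fin] that by (auto simp: c_def)
    have "F n \<in> Lp_functions r M"
    proof (rule Lp_functions_bound)
      show "integrable M (\<lambda>x. 2 powr r * cmod (f x) powr r)"
        using Lp_functionsD(2)[OF f] by simp
      show "AE x in M. cmod (F n x) powr r \<le> 2 powr r * cmod (f x) powr r"
        using bd[of _ n] \<open>0 < r\<close> by (intro AE_I2) (simp add: powr_mult[symmetric] powr_mono2)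
    qed simp
    then have int: "integrable M (\<lambda>x. cmod (F n x) powr r)" by (rule Lp_functionsD)
    have "emeasure M Z \<le> emeasure M {x \<in> space M. c \<le> cmod (F n x) powr r}"
      by (rule emeasure_mono) (use cle in \<open>auto simp: Z_def\<close>)
    also have "\<dots> < \<infinity>"
      using integral_Markov_inequality[OF int _ c0] ennreal_less_top le_less_trans
      by (fastforce simp: less_top)
    finally show "emeasure M {x \<in> space M. F n x \<noteq> 0} \<noteq> \<infinity>" by (simp add: Z_def)
  qed (simp add: F_def)
  then show ?thesis using F G bd by (intro exI[of _ F]) auto
qed

section \<open>Uniform convexity\<close>

text \<open>Strict convexity of the power function, as its tangent at 1: t^r - r t decreases before
  1 and increases after it.\<close>

lemma powr_ge_tangent:
  fixes x r :: real
  assumes "1 < r" "0 \<le> x" "x \<noteq> 1"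
  shows "1 + r * (x - 1) < x powr r"
proof (cases "x = 0")
  case True
  then show ?thesis using assms by simp
next
  case False
  then have x: "0 < x" using assms by simp
  define f where "f t = t powr r - r * t" for t :: real
  have der: "DERIV f t :> r * (t powr (r - 1) - 1)" if "0 < t" for t
    unfolding f_def using that by (auto intro!: derivative_eq_intros simp: algebra_simps)
  have "f 1 < f x"
  proof (cases "1 < x")
    case True
    have "\<exists>y. DERIV f t :> y \<and> 0 < y" if "1 < t" "t < x" for t
      using der[of t] that assms gr_one_powr[of t "r - 1"] by (intro exI conjI) auto
    then show ?thesis
      by (rule DERIV_pos_imp_increasing_open[OF True])
        (auto intro!: continuous_intros simp: f_def)
  next
    case False
    then have x1: "x < 1" using assms by simp
    have "\<exists>y. DERIV f t :> y \<and> y < 0" if "x < t" "t < 1" for t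
    proof -
      have "t powr (r - 1) < 1" using powr_less_mono2[of "r - 1" t 1] assms x that by simp
      then show ?thesis using der[of t] x that assms by (intro exI conjI) (auto simp: mult_pos_neg)
    qed
    then show ?thesis
      by (rule DERIV_neg_imp_decreasing_open[OF x1])
        (use x in \<open>auto intro!: continuous_intros simp: f_def\<close>)
  qed
  then show ?thesis by (simp add: f_def algebra_simps)
qed

section \<open>The duality map and convexity of the modulus power\<close>

definition dual_map :: "real \<Rightarrow> complex \<Rightarrow> complex" where
  "dual_map r z = of_real (cmod z powr (r - 2)) * cnj z"

text \<open>Up to the factor \<open>r\<close>, \<open>dual_map r\<close> is the gradient of |z|^r:
  the derivative in direction h is r Re (dual_map r z h). This identity is the case of equality in
  the Hoelder inequality.\<close>

lemma dual_map_mult_self: "dual_map r z * z = of_real (cmod z powr r)"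
proof (cases "z = 0")
  case False
  have "dual_map r z * z = of_real (cmod z powr (r - 2)) * of_real ((cmod z)\<^sup>2)"
    unfolding complex_norm_square by (simp add: dual_map_def mult.commute mult.left_commute)
  also have "\<dots> = of_real (cmod z powr (r - 2) * cmod z powr 2)"
    using False by simp
  also have "cmod z powr (r - 2) * cmod z powr 2 = cmod z powr r"
    by (simp only: powr_add[symmetric]) simp
  finally show ?thesis .
qed (simp add: dual_map_def)

lemma cmod_dual_map: "cmod (dual_map r z) = cmod z powr (r - 1)"
proof (cases "z = 0")
  case False
  then have "cmod (dual_map r z) = cmod z powr (r - 2) * cmod z powr 1"
    by (simp add: dual_map_def norm_mult)
  then show ?thesis by (simp only: flip: powr_add) simp
qed (simp add: dual_map_def)

text \<open>For r < 2 the factor |z|^(r-2) is unbounded near 0, so continuity at 0 is read off from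
  the modulus |z|^(r-1).\<close>

lemma tendsto_dual_map:
  assumes "(f \<longlongrightarrow> z) F" "1 < r"
  shows "((\<lambda>x. dual_map r (f x)) \<longlongrightarrow> dual_map r z) F"
proof (cases "z = 0")
  case True
  have "((\<lambda>x. cmod (f x) powr (r - 1)) \<longlongrightarrow> cmod z powr (r - 1)) F"
    using assms by (intro tendsto_powr' tendsto_norm tendsto_const) auto
  then have "((\<lambda>x. cmod (dual_map r (f x))) \<longlongrightarrow> 0) F" using True by (simp add: cmod_dual_map)
  then show ?thesis using True tendsto_norm_zero_cancel by (fastforce simp: dual_map_def)
next
  case False
  then show ?thesis unfolding dual_map_def using assms
    by (intro tendsto_mult tendsto_of_real tendsto_powr tendsto_norm tendsto_cnj tendsto_const) auto
qed

lemma dual_map_measurable [measurable (raw)]: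
  "f \<in> borel_measurable M \<Longrightarrow> (\<lambda>x. dual_map r (f x)) \<in> borel_measurable M"
  unfolding dual_map_def
  by (intro borel_measurable_times borel_measurable_continuous_on[OF continuous_on_of_real_id]
      borel_measurable_continuous_on[OF continuous_on_cnj[OF continuous_on_id]]
      powr_real_measurable borel_measurable_norm) auto

text \<open>Bounding the real part of \<open>dual_map r a * b\<close> by its modulus leaves the
  inequality of \<open>powr_ge_tangent\<close> at the quotient |b| / |a|. When the moduli agree that
  inequality is an equality, and strictness comes from the arguments: the real part equals the
  modulus only if \<open>b\<close> is a positive multiple of \<open>a\<close>, hence
  \<open>a\<close> itself.\<close>

lemma cmod_powr_ge_tangent:
  assumes "1 < r"
  shows "cmod a powr r + r * Re (dual_map r a * (b - a)) \<le> cmod b powr r"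
    and "a \<noteq> b \<Longrightarrow> cmod a powr r + r * Re (dual_map r a * (b - a)) < cmod b powr r"
proof -
  have expand: "Re (dual_map r a * (b - a)) = Re (dual_map r a * b) - cmod a powr r"
    by (simp add: right_diff_distrib dual_map_mult_self)
  show strict: "cmod a powr r + r * Re (dual_map r a * (b - a)) < cmod b powr r" if "a \<noteq> b"
  proof (cases "a = 0")
    case True
    then show ?thesis using that assms by (simp add: dual_map_def)
  next
    case a: False
    have apos: "cmod a powr r > 0" using a by simp
    have ab: "cmod a powr (r - 1) * cmod b = cmod a powr r * (cmod b / cmod a)"
      using a by (simp add: powr_diff)
    have aa: "cmod a powr (r - 1) * cmod a = cmod a powr r"
      using a by (simp add: powr_diff)
    have Re_le: "Re (dual_map r a * b) \<le> cmod a powr r * (cmod b / cmod a)"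
      using complex_Re_le_cmod[of "dual_map r a * b"] by (simp add: norm_mult cmod_dual_map ab)
    have b: "cmod b powr r = cmod a powr r * (cmod b / cmod a) powr r"
      using a by (simp add: powr_divide)
    show ?thesis
    proof (cases "cmod b = cmod a")
      case True
      have "Re (dual_map r a * b) < cmod a powr r"
      proof -
        have "Re (dual_map r a * b) \<noteq> cmod (dual_map r a * b)"
        proof
          assume eq: "Re (dual_map r a * b) = cmod (dual_map r a * b)"
          then have "Im (dual_map r a * b) = 0"
            using cmod_power2[of "dual_map r a * b"] by simp
          then have "dual_map r a * b = of_real (cmod (dual_map r a * b))"
            using eq by (simp add: complex_eq_iff del: times_complex.sel)
          also have "\<dots> = dual_map r a * a"
            using True aa by (simp add: dual_map_mult_self norm_mult cmod_dual_map flip: of_real_mult)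
          finally show False using that a by (simp add: dual_map_def)
        qed
        moreover have "cmod (dual_map r a * b) = cmod a powr r"
          using True aa by (simp add: norm_mult cmod_dual_map)
        ultimately show ?thesis using complex_Re_le_cmod[of "dual_map r a * b"] by simp
      qed
      then have "r * Re (dual_map r a * b) < r * cmod a powr r" using assms by simp
      then show ?thesis unfolding expand using True by (simp add: algebra_simps)
    next
      case False
      have "1 + r * (cmod b / cmod a - 1) < (cmod b / cmod a) powr r"
        using assms a False by (intro powr_ge_tangent) auto
      then have "cmod a powr r * (1 + r * (cmod b / cmod a - 1)) < cmod a powr r * (cmod b / cmod a) powr r"
        using apos by simp
      moreover have "r * Re (dual_map r a * b) \<le> r * (cmod a powr r * (cmod b / cmod a))"
        using Re_le assms by (intro mult_left_mono) auto
      ultimately show ?thesis unfolding expand b by (simp add: algebra_simps)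
    qed
  qed
  show "cmod a powr r + r * Re (dual_map r a * (b - a)) \<le> cmod b powr r"
    using strict by (cases "a = b") auto
qed

text \<open>The tangents at the midpoint, evaluated at \<open>a\<close> and at \<open>b\<close>,
  have opposite linear terms.\<close>

lemma midpoint_powr_less:
  assumes "1 < r" "a \<noteq> b"
  shows "2 * cmod ((a + b) / 2) powr r < cmod a powr r + cmod b powr r"
proof -
  let ?m = "(a + b) / 2"
  have ne: "?m \<noteq> a" "?m \<noteq> b" using assms by (auto simp: field_simps)
  have "b - ?m = - (a - ?m)" by (simp add: field_simps)
  then have "r * Re (dual_map r ?m * (b - ?m)) = - (r * Re (dual_map r ?m * (a - ?m)))"
    by (metis mult_minus_right uminus_complex.sel(1))
  then show ?thesis
    using cmod_powr_ge_tangent(2)[OF assms(1) ne(1)] cmod_powr_ge_tangent(2)[OF assms(1) ne(2)]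
    by linarith
qed

lemma midpoint_powr_le:
  assumes "1 < r"
  shows "2 * cmod ((a + b) / 2) powr r \<le> cmod a powr r + cmod b powr r"
  using midpoint_powr_less[OF assms, of a b] by (cases "a = b") auto

text \<open>The constant comes from compactness of the unit sphere of the two-dimensional \<open>\<ell>\<^sub>r\<close>; the
  general case follows by homogeneity.\<close>

lemma uniform_convexity_pointwise:
  assumes r: "1 < r" and e: "0 < e"
  shows "\<exists>K>0. \<forall>a b. cmod (a - b) powr r \<le>
    e * (cmod a powr r + cmod b powr r) + K * (cmod a powr r + cmod b powr r - 2 * cmod ((a + b) / 2) powr r)"
proof -
  define D where "D z = cmod (fst z) powr r + cmod (snd z) powr r - 2 * cmod ((fst z + snd z) / 2) powr r" for z
  define C where "C = {z :: complex \<times> complex. cmod (fst z) powr r + cmod (snd z) powr r = 1 \<and>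
    e \<le> cmod (fst z - snd z) powr r}"
  have cont: "continuous_on UNIV D"
    unfolding D_def using r
    by (intro continuous_on_diff continuous_on_add continuous_on_mult_left continuous_on_powr'
        continuous_on_norm continuous_on_divide continuous_on_fst continuous_on_snd
        continuous_on_const continuous_on_id) auto
  have "compact C"
  proof -
    have c1: "continuous_on UNIV (\<lambda>z :: complex \<times> complex. cmod (fst z) powr r + cmod (snd z) powr r)"
      "continuous_on UNIV (\<lambda>z :: complex \<times> complex. cmod (fst z - snd z) powr r)"
      using r
      by (auto intro!: continuous_on_diff continuous_on_add continuous_on_powr' continuous_on_norm
          continuous_on_fst continuous_on_snd continuous_on_const continuous_on_id)
    have "closed C" unfolding C_def Collect_conj_eq
      by (intro closed_Int closed_Collect_eq closed_Collect_le continuous_intros c1)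
    moreover have "bounded C"
    proof -
      have "C \<subseteq> cball 0 1 \<times> cball 0 1"
      proof
        fix z assume z: "z \<in> C"
        then have "cmod (fst z) powr r \<le> 1" "cmod (snd z) powr r \<le> 1"
          using powr_ge_zero[of "cmod (fst z)" r] powr_ge_zero[of "cmod (snd z)" r]
          unfolding C_def by (simp_all del: powr_ge_zero)
        then have "cmod (fst z) \<le> 1" "cmod (snd z) \<le> 1"
          using r gr_one_powr[of "cmod (fst z)" r] gr_one_powr[of "cmod (snd z)" r] by linarith+
        then show "z \<in> cball 0 1 \<times> cball 0 1" by (cases z) simp
      qed
      then show ?thesis by (rule bounded_subset[rotated]) (intro bounded_Times bounded_cball)
    qed
    ultimately show ?thesis by (simp add: compact_eq_bounded_closed)
  qed
  obtain c where c: "c > 0" "\<And>z. z \<in> C \<Longrightarrow> c \<le> D z"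
  proof (cases "C = {}")
    case True
    then show ?thesis using that[of 1] by auto
  next
    case False
    then obtain z where z: "z \<in> C" "\<And>y. y \<in> C \<Longrightarrow> D z \<le> D y"
      using continuous_attains_inf[OF \<open>compact C\<close> _ continuous_on_subset[OF cont]] by auto
    have "fst z \<noteq> snd z" using z(1) e r by (auto simp: C_def)
    then have "D z > 0" using midpoint_powr_less[OF r] by (simp add: D_def)
    then show ?thesis using that z by blast
  qed
  have D0: "0 \<le> D z" for z using midpoint_powr_le[OF r] by (simp add: D_def)
  \<comment> \<open>Let t = |a|^r + |b|^r. If |a - b|^r is below e t, the first term suffices.
    Otherwise scaling to t = 1 lands in \<open>C\<close>, so t is at most D/c, while |a - b|^r is at
    most 2^r t; this is the origin of the constant.\<close>
  show ?thesis
  proof (intro exI[of _ "2 powr r / c"] conjI allI)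
    show "0 < 2 powr r / c" using c by simp
    fix a b
    define t where "t = cmod a powr r + cmod b powr r"
    have t0: "0 \<le> t" by (simp add: t_def)
    have "cmod (a - b) powr r \<le> e * t + 2 powr r / c * D (a, b)"
    proof (cases "t = 0")
      case True
      then have "a = 0 \<and> b = 0" unfolding t_def
        using powr_ge_zero[of "cmod a" r] powr_ge_zero[of "cmod b" r]
        by (simp add: add_nonneg_eq_0_iff)
      then show ?thesis using r by (simp add: t_def D_def)
    next
      case False
      then have t: "t > 0" using t0 by simp
      show ?thesis
      proof (cases "e * t \<le> cmod (a - b) powr r")
        case True
        define s where "s = t powr (1 / r)"
        have s: "s > 0" "s powr r = t" using t r by (simp_all add: s_def powr_powr)
        have cs: "cmod (z / of_real s) powr r = cmod z powr r / t" for z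
          using s by (simp add: norm_divide powr_divide)
        have dv: "a / of_real s - b / of_real s = (a - b) / of_real s"
          "(a / of_real s + b / of_real s) / 2 = ((a + b) / 2) / of_real s"
          by (simp_all add: diff_divide_distrib add_divide_distrib mult.commute)
        have "(a / of_real s, b / of_real s) \<in> C"
          unfolding C_def using True t by (simp add: cs dv t_def[symmetric] field_simps flip: add_divide_distrib)
        from c(2)[OF this] have "c \<le> D (a, b) / t"
          unfolding D_def fst_conv snd_conv dv cs by (simp add: diff_divide_distrib add_divide_distrib)
        then have "t \<le> D (a, b) / c" using c t by (simp add: field_simps)
        moreover have "cmod (a - b) powr r \<le> 2 powr r * t"
        proof -
          have "cmod (a - b) powr r \<le> (cmod a + cmod b) powr r"
            using r norm_triangle_ineq4 by (intro powr_mono2) auto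
          then show ?thesis using powr_add_le[of "cmod a" "cmod b" r] r by (simp add: t_def)
        qed
        ultimately have "cmod (a - b) powr r \<le> 2 powr r * (D (a, b) / c)"
          by (meson mult_left_mono order_trans powr_ge_zero)
        then show ?thesis using e t by (simp add: add_increasing del: divide_le_eq)
      next
        case False
        have "0 \<le> 2 powr r / c * D (a, b)" using c D0[of "(a, b)"] by simp
        then show ?thesis using False by linarith
      qed
    qed
    then show "cmod (a - b) powr r \<le> e * (cmod a powr r + cmod b powr r)
      + 2 powr r / c * (cmod a powr r + cmod b powr r - 2 * cmod ((a + b) / 2) powr r)"
      by (simp add: t_def D_def)
  qed
qed

section \<open>Riesz representation on an arbitrary measure space\<close>

locale conj_exp =
  fixes p q :: real
  assumes p1: "1 < p" and q1: "1 < q" and pq: "1 / p + 1 / q = 1"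
begin

lemma swap: "conj_exp q p"
  using p1 q1 pq by unfold_locales (simp_all add: add.commute)

lemma p0: "0 < p" and q0: "0 < q"
  using p1 q1 by simp_all

lemma pq_mult: "(q - 1) * p = q"
proof -
  have "p + q = p * q" using pq p1 q1 by (simp add: field_simps)
  then show ?thesis by (simp add: algebra_simps)
qed

lemma dual_map_Lp:
  assumes "f \<in> Lp_functions q M"
  shows "(\<lambda>x. dual_map q (f x)) \<in> Lp_functions p M"
    and "pow_integral p M (\<lambda>x. dual_map q (f x)) = pow_integral q M f"
  using Lp_functionsD[OF assms] pq_mult
  by (auto simp: Lp_functions_def pow_integral_def cmod_dual_map powr_powr)

lemma integrable_mult:
  assumes f: "f \<in> Lp_functions p M" and g: "g \<in> Lp_functions q M"
  shows "integrable M (\<lambda>x. f x * g x)"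
proof (rule Bochner_Integration.integrable_bound)
  show "integrable M (\<lambda>x. cmod (f x) powr p / p + cmod (g x) powr q / q)"
    using Lp_functionsD(2)[OF f] Lp_functionsD(2)[OF g] by auto
  show "(\<lambda>x. f x * g x) \<in> borel_measurable M"
    using f g by (intro borel_measurable_times) (auto dest: Lp_functionsD)
  show "AE x in M. norm (f x * g x) \<le> norm (cmod (f x) powr p / p + cmod (g x) powr q / q)"
  proof (rule AE_I2)
    fix x
    have "cmod (f x) * cmod (g x) \<le> cmod (f x) powr p / p + cmod (g x) powr q / q"
      by (rule Youngs_inequality[OF p1 q1 pq]) auto
    then show "norm (f x * g x) \<le> norm (cmod (f x) powr p / p + cmod (g x) powr q / q)"
      by (simp add: norm_mult)
  qed
qed

end

text \<open>With \<open>d\<^sub>n = |g\<^sub>n\<^sub>+\<^sub>1 - g\<^sub>n|\<close>, the function \<open>k = (\<Sum>n. 2^(nr) d\<^sub>n^r)^(1/r)\<close> is in \<open>L\<^sub>r\<close> and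
  \<open>d\<^sub>n \<le> 2^(-n) k\<close>, which gives convergence and domination at once.\<close>

lemma Lp_fast_Cauchy:
  assumes r: "0 < r" and g: "\<And>n. g n \<in> Lp_functions r M"
    and fast: "\<And>n. pow_integral r M (\<lambda>x. g (Suc n) x - g n x) \<le> 2 powr (- real n * r) * (1/2) ^ n"
  shows "\<exists>g' w. g' \<in> Lp_functions r M \<and> w \<in> Lp_functions r M \<and>
    (AE x in M. (\<lambda>n. g n x) \<longlonglongrightarrow> g' x) \<and> (AE x in M. \<forall>n. cmod (g n x) \<le> cmod (w x))"
proof -
  define d where "d n x = 2 powr (real n * r) * cmod (g (Suc n) x - g n x) powr r" for n x
  have gm [measurable]: "g n \<in> borel_measurable M" for n using Lp_functionsD g by blast
  have dm [measurable]: "d n \<in> borel_measurable M" for n unfolding d_def by measurable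
  have d0: "0 \<le> d n x" for n x by (simp add: d_def)
  have dint: "integrable M (d n)" for n
    unfolding d_def using Lp_functionsD(2)[OF Lp_functions_diff[OF g g r]] by simp
  have dle: "(\<integral>x. d n x \<partial>M) \<le> (1/2) ^ n" for n
  proof -
    have "(\<integral>x. d n x \<partial>M) = 2 powr (real n * r) * pow_integral r M (\<lambda>x. g (Suc n) x - g n x)"
      by (simp add: d_def pow_integral_def)
    also have "\<dots> \<le> 2 powr (real n * r) * (2 powr (- real n * r) * (1/2) ^ n)"
      by (intro mult_left_mono fast) simp
    also have "\<dots> = (1/2) ^ n" by (simp add: powr_minus field_simps)
    finally show ?thesis .
  qed
  have "(\<integral>\<^sup>+x. (\<Sum>n. ennreal (d n x)) \<partial>M) = (\<Sum>n. \<integral>\<^sup>+x. ennreal (d n x) \<partial>M)"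
    by (rule nn_integral_suminf) measurable
  also have "\<dots> = (\<Sum>n. ennreal (\<integral>x. d n x \<partial>M))"
    by (intro suminf_cong nn_integral_eq_integral dint) (simp add: d0)
  also have "\<dots> \<le> (\<Sum>n. ennreal ((1/2) ^ n))"
    by (intro suminf_le ennreal_leI dle) auto
  also have "\<dots> = ennreal (\<Sum>n. (1/2) ^ n)"
    by (intro suminf_ennreal2) (auto simp: summable_geometric)
  also have "\<dots> < \<infinity>" by simp
  finally have "(\<integral>\<^sup>+x. (\<Sum>n. ennreal (d n x)) \<partial>M) \<noteq> \<infinity>" by simp
  then have "AE x in M. (\<Sum>n. ennreal (d n x)) \<noteq> \<infinity>"
    by (intro nn_integral_PInf_AE) auto
  then have summ: "AE x in M. summable (\<lambda>n. d n x)"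
    by eventually_elim (rule summable_suminf_not_top, auto simp: d0)
  define T where "T x = (\<Sum>n. d n x)" for x
  have Tint: "integrable M T" unfolding T_def
  proof (rule integrable_suminf)
    show "AE x in M. summable (\<lambda>n. norm (d n x))" using summ by (simp add: d0)
    show "summable (\<lambda>n. \<integral>x. norm (d n x) \<partial>M)"
      by (rule summable_comparison_test'[of "\<lambda>n. (1/2) ^ n"]) (auto simp: d0 dle summable_geometric)
  qed (rule dint)
  have T0: "0 \<le> T x" if "summable (\<lambda>n. d n x)" for x
    unfolding T_def using that d0 by (rule suminf_nonneg)
  define k where "k x = \<bar>T x\<bar> powr (1 / r)" for x
  have k0: "0 \<le> k x" for x by (simp add: k_def)
  have inc: "cmod (g (Suc n) x - g n x) \<le> k x * (1/2) ^ n" if s: "summable (\<lambda>n. d n x)" for x n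
  proof -
    have "d n x \<le> T x" unfolding T_def
      using sum_le_suminf[OF s, of "{n}"] d0 by simp
    then have "(2 ^ n * cmod (g (Suc n) x - g n x)) powr r \<le> T x"
      by (simp add: d_def powr_mult powr_powr flip: powr_realpow)
    then have "((2 ^ n * cmod (g (Suc n) x - g n x)) powr r) powr (1 / r) \<le> T x powr (1 / r)"
      using r by (intro powr_mono2) auto
    then show ?thesis using r T0[OF s] by (simp add: k_def powr_powr field_simps power_divide)
  qed
  have bound: "cmod (g n x - g 0 x) \<le> 2 * k x" and conv: "convergent (\<lambda>n. g n x)"
    if s: "summable (\<lambda>n. d n x)" for x n
  proof -
    have ks: "summable (\<lambda>n. k x * (1/2) ^ n)" by (intro summable_mult summable_geometric) simp
    have gs: "summable (\<lambda>n. g (Suc n) x - g n x)"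
      using ks inc[OF s] by (intro summable_comparison_test'[OF ks]) auto
    have tel: "g n x = g 0 x + (\<Sum>i<n. g (Suc i) x - g i x)" for n
      using sum_lessThan_telescope[of "\<lambda>i. g i x" n] by simp
    have "convergent (\<lambda>n. g 0 x + (\<Sum>i<n. g (Suc i) x - g i x))"
      using gs by (auto intro!: convergent_add convergent_const simp: summable_iff_convergent)
    then show "convergent (\<lambda>n. g n x)" by (simp flip: tel)
    have "cmod (g n x - g 0 x) = cmod (\<Sum>i<n. g (Suc i) x - g i x)" by (subst tel) simp
    also have "\<dots> \<le> (\<Sum>i<n. k x * (1/2) ^ i)" by (intro sum_norm_le inc[OF s])
    also have "\<dots> \<le> (\<Sum>i. k x * (1/2) ^ i)"
      by (rule sum_le_suminf[OF ks]) (auto simp: k0)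
    also have "\<dots> = 2 * k x" by (simp add: suminf_mult suminf_geometric)
    finally show "cmod (g n x - g 0 x) \<le> 2 * k x" .
  qed
  define w where "w x = complex_of_real (cmod (g 0 x) + 2 * k x)" for x :: 'a
  define g' where "g' x = lim (\<lambda>n. g n x)" for x
  have [measurable]: "g' \<in> borel_measurable M" unfolding g'_def by measurable
  have lims: "(\<lambda>n. g n x) \<longlonglongrightarrow> g' x" if "summable (\<lambda>n. d n x)" for x
    unfolding g'_def using conv[OF that] by (simp add: convergent_LIMSEQ_iff)
  have gw: "cmod (g n x) \<le> cmod (w x)" if "summable (\<lambda>n. d n x)" for n x
    using bound[OF that, of n] norm_triangle_sub[of "g n x" "g 0 x"] k0[of x]
    by (simp add: w_def del: of_real_add)
  have Tm [measurable]: "T \<in> borel_measurable M" using Tint by auto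
  have "(\<lambda>x. complex_of_real (k x)) \<in> Lp_functions r M"
  proof (rule Lp_functions_bound)
    show "integrable M (\<lambda>x. \<bar>T x\<bar>)" using Tint by simp
    show "AE x in M. cmod (complex_of_real (k x)) powr r \<le> \<bar>T x\<bar>"
      using r by (simp add: k_def powr_powr)
  qed (simp add: k_def)
  moreover have "(\<lambda>x. complex_of_real (cmod (g 0 x))) \<in> Lp_functions r M"
    by (rule Lp_functions_bound[OF _ Lp_functionsD(2)[OF g[of 0]]]) auto
  ultimately have w: "w \<in> Lp_functions r M"
    unfolding w_def of_real_add of_real_mult using r by (intro Lp_functions_add Lp_functions_cmult) auto
  have "g' \<in> Lp_functions r M"
  proof (rule Lp_functions_bound[OF _ Lp_functionsD(2)[OF w]])
    show "AE x in M. cmod (g' x) powr r \<le> cmod (w x) powr r"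
      using summ
    proof eventually_elim
      case (elim x)
      have "cmod (g' x) \<le> cmod (w x)"
        using tendsto_norm[OF lims[OF elim]] gw[OF elim] by (intro LIMSEQ_le_const2) auto
      then show ?case using r by (intro powr_mono2) auto
    qed
  qed measurable
  moreover have "AE x in M. (\<lambda>n. g n x) \<longlonglongrightarrow> g' x" using summ by eventually_elim (rule lims)
  moreover have "AE x in M. \<forall>n. cmod (g n x) \<le> cmod (w x)" using summ by eventually_elim (use gw in blast)
  ultimately show ?thesis using w by blast
qed

context conj_exp
begin

lemma pow_integral_dct:
  assumes "0 < r" and f: "\<And>n. f n \<in> borel_measurable M" and w: "w \<in> Lp_functions r M"
    and h: "h \<in> borel_measurable M"
    and "AE x in M. (\<lambda>n. f n x) \<longlonglongrightarrow> h x" and "\<And>n. AE x in M. cmod (f n x) \<le> cmod (w x)"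
  shows "(\<lambda>n. pow_integral r M (f n)) \<longlonglongrightarrow> pow_integral r M h"
  unfolding pow_integral_def
proof (rule integral_dominated_convergence[OF _ _ Lp_functionsD(2)[OF w]])
  show "AE x in M. (\<lambda>n. cmod (f n x) powr r) \<longlonglongrightarrow> cmod (h x) powr r"
    using assms(5)
    by eventually_elim (use \<open>0 < r\<close> in \<open>auto intro!: tendsto_powr' tendsto_norm\<close>)
  show "AE x in M. norm (cmod (f n x) powr r) \<le> cmod (w x) powr r" for n
    using assms(6)[of n] by eventually_elim (use \<open>0 < r\<close> in \<open>auto intro!: powr_mono2\<close>)
qed (use f h in measurable)

text \<open>The minimiser \<open>g\<close> of \<open>\<parallel>g\<parallel>\<^sub>q\<^sup>q - Re (\<Lambda> g)\<close> exists in \<open>L\<^sub>q\<close> by uniform convexity, for any measure;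
  the Euler--Lagrange equation then represents \<open>\<Lambda>\<close> by \<open>q |g|^(q-2) cnj g\<close>.\<close>

theorem riesz_simple_fns:
  fixes \<Lambda> :: "('m \<Rightarrow> complex) \<Rightarrow> complex"
  assumes add: "\<And>f g. f \<in> simple_fns M \<Longrightarrow> g \<in> simple_fns M \<Longrightarrow> \<Lambda> (\<lambda>x. f x + g x) = \<Lambda> f + \<Lambda> g"
    and scale: "\<And>c f. f \<in> simple_fns M \<Longrightarrow> \<Lambda> (\<lambda>x. c * f x) = c * \<Lambda> f"
    and bound: "\<And>f. f \<in> simple_fns M \<Longrightarrow> pow_integral q M f \<le> 1 \<Longrightarrow> cmod (\<Lambda> f) \<le> C"
  shows "\<exists>h\<in>Lp_functions p M. \<forall>f\<in>simple_fns M. \<Lambda> f = (\<integral>x. h x * f x \<partial>M)"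
proof -
  let ?S = "simple_fns M" and ?I = "pow_integral q M"
  have C0: "0 \<le> C"
    using bound[OF simple_fns_zero] order_trans[OF norm_ge_zero] by (simp add: pow_integral_def)
  have SL: "f \<in> Lp_functions q M" if "f \<in> ?S" for f using simple_fns_Lp that by blast
  \<comment> \<open>The summand 1 keeps the normalising factor positive even when \<open>f\<close>
    vanishes almost everywhere.\<close>
  have Lam_le: "cmod (\<Lambda> f) \<le> C * (1 + ?I f) powr (1 / q)" if f: "f \<in> ?S" for f
  proof -
    define t where "t = (1 + ?I f) powr (1 / q)"
    have I0: "0 < 1 + ?I f" by (smt (verit) pow_integral_nonneg)
    have t: "0 < t" "t powr q = 1 + ?I f" using q1 I0 by (simp_all add: t_def powr_powr)
    have "?I (\<lambda>x. of_real (1 / t) * f x) = (1 / t) powr q * ?I f"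
      using t by (subst pow_integral_cmult) (simp add: norm_divide)
    also have "\<dots> = ?I f / (1 + ?I f)" using t by (simp add: powr_divide)
    also have "\<dots> \<le> 1" using I0 by simp
    finally have "cmod (\<Lambda> (\<lambda>x. of_real (1 / t) * f x)) \<le> C"
      using bound simple_fns_cmult[OF f] by blast
    then show ?thesis using t unfolding scale[OF f]
      by (simp add: norm_mult norm_divide field_simps flip: t_def)
  qed
  define J where "J f = ?I f - Re (\<Lambda> f)" for f
  \<comment> \<open>Young's inequality splits C s, with s^q = 1 + I(f), into C^p/p + (1 + I(f))/q.
    The part I(f)/q is absorbed by I(f), which leaves I(f)/p: the functional is coercive and bounded
    below.\<close>
  define B where "B = C powr p / p + 1 / q"
  have J_ge: "?I f / p - B \<le> J f" if f: "f \<in> ?S" for f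
  proof -
    have I0: "0 < 1 + ?I f" by (smt (verit) pow_integral_nonneg)
    have "Re (\<Lambda> f) \<le> C * (1 + ?I f) powr (1 / q)"
      using Lam_le[OF f] complex_Re_le_cmod[of "\<Lambda> f"] by simp
    also have "\<dots> \<le> C powr p / p + ((1 + ?I f) powr (1 / q)) powr q / q"
      by (rule Youngs_inequality[OF p1 q1 pq C0]) simp
    also have "((1 + ?I f) powr (1 / q)) powr q = 1 + ?I f" using q1 I0 by (simp add: powr_powr)
    finally have "Re (\<Lambda> f) \<le> B + ?I f * (1 / q)" by (simp add: B_def add_divide_distrib)
    also have "1 / q = 1 - 1 / p" using pq by simp
    finally show ?thesis by (simp add: J_def right_diff_distrib)
  qed
  have J_lower: "- B \<le> J f" if "f \<in> ?S" for f
  proof -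
    have "0 \<le> ?I f / p" using p1 by simp
    then show ?thesis using J_ge[OF that] by linarith
  qed
  define m where "m = Inf (J ` ?S)"
  have m_le: "m \<le> J f" if "f \<in> ?S" for f
    unfolding m_def using that J_lower by (intro cInf_lower) (auto intro!: bdd_belowI)
  have m_approx: "\<exists>f\<in>?S. J f < m + e" if "0 < e" for e
  proof -
    have "Inf (J ` ?S) < m + e" using that by (simp add: m_def)
    then show ?thesis using cInf_lessD[of "J ` ?S" "m + e"] simple_fns_zero by blast
  qed
  have Lam_diff: "\<Lambda> (\<lambda>x. (f x + g x) / 2) = (\<Lambda> f + \<Lambda> g) / 2" if "f \<in> ?S" "g \<in> ?S" for f g
    using scale[OF simple_fns_add[OF that], of "1/2"] add[OF that] by simp
  \<comment> \<open>The linear part of \<open>J\<close> cancels in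
    \<open>J f + J g - 2 J((f + g)/2)\<close>, so for near-minimisers the defect in the midpoint
    inequality is at most 2 d. Half of \<open>e\<close> goes to each term of
    \<open>uniform_convexity_pointwise\<close>: \<open>L\<close> bounds the energies of
    \<open>f\<close> and \<open>g\<close>, and \<open>d\<close> is at most e/(4 K).\<close>
  have close: "\<exists>d>0. \<forall>f\<in>?S. \<forall>g\<in>?S. J f < m + d \<longrightarrow> J g < m + d \<longrightarrow> ?I (\<lambda>x. f x - g x) \<le> e"
    if e: "0 < e" for e
  proof -
    define L where "L = \<bar>p * (m + 1 + B)\<bar>"
    have "0 < e / (4 * (L + 1))" using e by (simp add: L_def)
    then obtain K where K: "K > 0" "\<And>a b. cmod (a - b) powr q \<le>
      e / (4 * (L + 1)) * (cmod a powr q + cmod b powr q)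
      + K * (cmod a powr q + cmod b powr q - 2 * cmod ((a + b) / 2) powr q)"
      using uniform_convexity_pointwise[OF q1] by blast
    define d where "d = min 1 (e / (4 * K))"
    have "?I (\<lambda>x. f x - g x) \<le> e"
      if f: "f \<in> ?S" "J f < m + d" and g: "g \<in> ?S" "J g < m + d" for f g
    proof -
      have IL: "?I f \<le> L" if "f \<in> ?S" "J f < m + d" for f
      proof -
        have "?I f / p \<le> m + 1 + B" using J_ge[OF that(1)] that(2) by (simp add: d_def)
        then have "?I f \<le> p * (m + 1 + B)" using p1 by (simp add: field_simps)
        then show ?thesis by (simp add: L_def)
      qed
      have mid: "(\<lambda>x. (f x + g x) / 2) \<in> ?S"
        using simple_fns_cmult[OF simple_fns_add[OF f(1) g(1)], of "1/2"] by simp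
      note int = Lp_functionsD(2)[OF SL[OF f(1)]] Lp_functionsD(2)[OF SL[OF g(1)]]
        Lp_functionsD(2)[OF SL[OF mid]]
      have "?I (\<lambda>x. f x - g x) \<le> (\<integral>x. e / (4 * (L + 1)) * (cmod (f x) powr q + cmod (g x) powr q)
          + K * (cmod (f x) powr q + cmod (g x) powr q - 2 * cmod ((f x + g x) / 2) powr q) \<partial>M)"
        unfolding pow_integral_def
      proof (rule integral_mono)
        show "integrable M (\<lambda>x. cmod (f x - g x) powr q)"
          using Lp_functionsD(2)[OF Lp_functions_diff[OF SL[OF f(1)] SL[OF g(1)]]] q1 by simp
        show "integrable M (\<lambda>x. e / (4 * (L + 1)) * (cmod (f x) powr q + cmod (g x) powr q)
          + K * (cmod (f x) powr q + cmod (g x) powr q - 2 * cmod ((f x + g x) / 2) powr q))"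
          using int by (intro Bochner_Integration.integrable_add integrable_mult_right Bochner_Integration.integrable_diff) auto
      qed (rule K(2))
      also have "\<dots> = e / (4 * (L + 1)) * (?I f + ?I g)
          + K * (?I f + ?I g - 2 * ?I (\<lambda>x. (f x + g x) / 2))"
        unfolding pow_integral_def using int by simp
      also have "?I f + ?I g - 2 * ?I (\<lambda>x. (f x + g x) / 2) = J f + J g - 2 * J (\<lambda>x. (f x + g x) / 2)"
        unfolding J_def Lam_diff[OF f(1) g(1)] by (simp add: field_simps)
      also have "e / (4 * (L + 1)) * (?I f + ?I g) + K * (J f + J g - 2 * J (\<lambda>x. (f x + g x) / 2))
          \<le> e / (4 * (L + 1)) * (2 * (L + 1)) + K * (2 * (e / (4 * K)))"
      proof (intro add_mono mult_left_mono)
        show "?I f + ?I g \<le> 2 * (L + 1)" using IL[OF f] IL[OF g] by simp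
        show "J f + J g - 2 * J (\<lambda>x. (f x + g x) / 2) \<le> 2 * (e / (4 * K))"
          using f g m_le[OF mid] unfolding d_def by linarith
      qed (use e K L_def in auto)
      also have "\<dots> = e"
      proof -
        have "L + 1 \<noteq> 0" by (simp add: L_def)
        then have "e / (4 * (L + 1)) * (2 * (L + 1)) = e / 2" by (simp add: divide_simps)
        moreover have "K * (2 * (e / (4 * K))) = e / 2" using K(1) by simp
        ultimately show ?thesis by linarith
      qed
      finally show ?thesis .
    qed
    moreover have "d > 0" using e K by (simp add: d_def)
    ultimately show ?thesis by blast
  qed
  \<comment> \<open>The rate demanded by \<open>Lp_fast_Cauchy\<close>.\<close>
  define eps where "eps n = 2 powr (- real n * q) * (1/2) ^ n" for n
  have "\<exists>d. \<forall>n. 0 < d n \<and> (\<forall>f\<in>?S. \<forall>g\<in>?S. J f < m + d n \<longrightarrow> J g < m + d n \<longrightarrow> ?I (\<lambda>x. f x - g x) \<le> eps n)"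
    by (intro choice allI) (use close in \<open>simp add: eps_def\<close>)
  then obtain d where d: "\<And>n. 0 < d n" "\<And>n f g. f \<in> ?S \<Longrightarrow> g \<in> ?S \<Longrightarrow> J f < m + d n \<Longrightarrow> J g < m + d n
     \<Longrightarrow> ?I (\<lambda>x. f x - g x) \<le> eps n" by blast
  \<comment> \<open>The minimum over all earlier tolerances lets both \<open>g n\<close> and
    \<open>g (Suc n)\<close> meet the tolerance \<open>d n\<close>; the bound 1/(n+1) makes the
    sequence minimising.\<close>
  define D where "D n = min (1 / real (Suc n)) (Min (d ` {..n}))" for n
  have D: "0 < D n" "D n \<le> 1 / real (Suc n)" "\<And>k. k \<le> n \<Longrightarrow> D n \<le> d k" for n
    using d(1) by (auto simp: D_def min_le_iff_disj)
  have "\<exists>g. \<forall>n. g n \<in> ?S \<and> J (g n) < m + D n"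
    by (intro choice allI) (use m_approx[OF D(1)] in blast)
  then obtain g where g: "\<And>n. g n \<in> ?S" "\<And>n. J (g n) < m + D n" by blast
  have "?I (\<lambda>x. g (Suc n) x - g n x) \<le> eps n" for n
    using D(3)[of n "Suc n"] D(3)[of n n] g(2)[of n] g(2)[of "Suc n"] by (intro d(2) g(1)) auto
  then obtain g' w where g': "g' \<in> Lp_functions q M" and w: "w \<in> Lp_functions q M"
    and lim: "AE x in M. (\<lambda>n. g n x) \<longlonglongrightarrow> g' x" and dom: "AE x in M. \<forall>n. cmod (g n x) \<le> cmod (w x)"
    using Lp_fast_Cauchy[of q g M] SL[OF g(1)] q1 by (auto simp: eps_def)
  have g'm [measurable]: "g' \<in> borel_measurable M" using g' Lp_functionsD by blast
  have Jlim: "(\<lambda>n. J (g n)) \<longlonglongrightarrow> m"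
  proof (rule tendsto_sandwich)
    show "(\<lambda>n. m) \<longlonglongrightarrow> m" by simp
    show "(\<lambda>n. m + 1 / real (Suc n)) \<longlonglongrightarrow> m"
      using tendsto_add[OF tendsto_const[of m] LIMSEQ_inverse_real_of_nat] by (simp add: inverse_eq_divide)
    show "\<forall>\<^sub>F n in sequentially. m \<le> J (g n)" using m_le g(1) by simp
    show "\<forall>\<^sub>F n in sequentially. J (g n) \<le> m + 1 / real (Suc n)"
      using g(2) D(2) by (intro always_eventually allI) (smt (verit))
  qed
  \<comment> \<open>\<open>\<Lambda>\<close> is given on simple functions only, so
    \<open>J g'\<close> has no meaning and the minimality of \<open>g'\<close> is expressed by a
    limit: \<open>J (g n + t f)\<close> is at least \<open>m\<close>, while \<open>J (g n)\<close>
    tends to \<open>m\<close>.\<close>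
  have var: "t * Re (\<Lambda> f) \<le> ?I (\<lambda>x. g' x + of_real t * f x) - ?I g'" if f: "f \<in> ?S" for f t
  proof -
    have fL: "f \<in> Lp_functions q M" using SL f .
    have fm [measurable]: "f \<in> borel_measurable M" by (rule simple_fnsD(4)[OF f])
    have gm [measurable]: "g n \<in> borel_measurable M" for n by (rule simple_fnsD(4)[OF g(1)])
    define W where "W x = complex_of_real (cmod (w x)) + of_real (cmod (of_real t * f x))" for x
    have WL: "W \<in> Lp_functions q M"
      unfolding W_def using q1 by (intro Lp_functions_add Lp_functions_cmod Lp_functions_cmult w fL) auto
    have Wn: "cmod (W x) = cmod (w x) + cmod (of_real t * f x)" for x
      unfolding W_def by (simp only: of_real_add[symmetric] norm_of_real) simp
    have "(\<lambda>n. ?I (\<lambda>x. g n x + of_real t * f x)) \<longlonglongrightarrow> ?I (\<lambda>x. g' x + of_real t * f x)"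
    proof (rule pow_integral_dct[OF _ _ WL])
      show "AE x in M. (\<lambda>n. g n x + of_real t * f x) \<longlonglongrightarrow> g' x + of_real t * f x"
        using lim by eventually_elim (intro tendsto_intros)
      show "AE x in M. cmod (g n x + of_real t * f x) \<le> cmod (W x)" for n
        using dom
      proof eventually_elim
        case (elim x)
        show ?case
          using norm_triangle_ineq[of "g n x" "of_real t * f x"] elim[rule_format, of n] unfolding Wn by linarith
      qed
    qed (use q1 in \<open>simp_all\<close>)
    moreover have "(\<lambda>n. ?I (g n)) \<longlonglongrightarrow> ?I g'"
      by (rule pow_integral_dct[OF _ _ w _ lim]) (use q1 dom in \<open>auto elim!: eventually_mono\<close>)
    ultimately have "(\<lambda>n. J (g n) + (?I (\<lambda>x. g n x + of_real t * f x) - ?I (g n)) - t * Re (\<Lambda> f))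
        \<longlonglongrightarrow> m + (?I (\<lambda>x. g' x + of_real t * f x) - ?I g') - t * Re (\<Lambda> f)"
      by (intro tendsto_intros Jlim)
    moreover have "J (g n) + (?I (\<lambda>x. g n x + of_real t * f x) - ?I (g n)) - t * Re (\<Lambda> f)
        = J (\<lambda>x. g n x + of_real t * f x)" for n
      using add[OF g(1)[of n] simple_fns_cmult[OF f]] scale[OF f] by (simp add: J_def)
    ultimately have "(\<lambda>n. J (\<lambda>x. g n x + of_real t * f x))
        \<longlonglongrightarrow> m + (?I (\<lambda>x. g' x + of_real t * f x) - ?I g') - t * Re (\<Lambda> f)" by simp
    then have "m \<le> m + (?I (\<lambda>x. g' x + of_real t * f x) - ?I g') - t * Re (\<Lambda> f)"
      by (rule LIMSEQ_le_const) (use m_le simple_fns_add simple_fns_cmult g(1) f in blast)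
    then show ?thesis by simp
  qed
  define h where "h x = of_real q * dual_map q (g' x)" for x
  have hL: "h \<in> Lp_functions p M"
    unfolding h_def by (intro Lp_functions_cmult dual_map_Lp g')
  have le: "Re (\<Lambda> f) \<le> Re (\<integral>x. h x * f x \<partial>M)" if f: "f \<in> ?S" for f
  proof -
    have fL: "f \<in> Lp_functions q M" using SL f .
    have fm [measurable]: "f \<in> borel_measurable M" by (rule simple_fnsD(4)[OF f])
    define a where "a n x = g' x + of_real (1 / real (Suc n)) * f x" for n x
    have aL: "a n \<in> Lp_functions q M" for n
      unfolding a_def using q1 by (intro Lp_functions_add Lp_functions_cmult g' fL) auto
    have am [measurable]: "a n \<in> borel_measurable M" for n using aL Lp_functionsD by blast
    have int: "integrable M (\<lambda>x. dual_map q (a n x) * f x)" for n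
      by (intro integrable_mult dual_map_Lp aL fL)
    have Re_real: "Re (of_real c * z) = c * Re z" for c z by simp
    \<comment> \<open>Differentiation under the integral is avoided: the tangent inequality at a =
      g' + t f bounds |a|^q - |g'|^q by q t Re (dual_map q a f). Dividing by t leaves an integral
      that converges by domination as t tends to 0.\<close>
    have step: "Re (\<Lambda> f) \<le> q * Re (\<integral>x. dual_map q (a n x) * f x \<partial>M)" for n
    proof -
      define t where "t = 1 / real (Suc n)"
      have t: "t > 0" by (simp add: t_def)
      have an: "(\<lambda>x. g' x + of_real t * f x) = a n" by (simp add: a_def t_def fun_eq_iff)
      have "?I (a n) - ?I g' = (\<integral>x. cmod (a n x) powr q - cmod (g' x) powr q \<partial>M)"
        unfolding pow_integral_def using Lp_functionsD(2)[OF aL] Lp_functionsD(2)[OF g'] by simp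
      also have "\<dots> \<le> (\<integral>x. q * (t * Re (dual_map q (a n x) * f x)) \<partial>M)"
      proof (rule integral_mono)
        show "integrable M (\<lambda>x. cmod (a n x) powr q - cmod (g' x) powr q)"
          using Lp_functionsD(2)[OF aL] Lp_functionsD(2)[OF g'] by simp
        show "integrable M (\<lambda>x. q * (t * Re (dual_map q (a n x) * f x)))"
          using integrable_Re[OF int[of n]] by (intro integrable_mult_right) 
        fix x
        have "g' x - a n x = of_real (- t) * f x" by (simp add: a_def t_def)
        then have "Re (dual_map q (a n x) * (g' x - a n x)) = Re (of_real (- t) * (dual_map q (a n x) * f x))"
          by (simp only: mult.left_commute)
        also have "\<dots> = - t * Re (dual_map q (a n x) * f x)" by (rule Re_real)
        finally have "Re (dual_map q (a n x) * (g' x - a n x)) = - t * Re (dual_map q (a n x) * f x)" .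
        then show "cmod (a n x) powr q - cmod (g' x) powr q \<le> q * (t * Re (dual_map q (a n x) * f x))"
          using cmod_powr_ge_tangent(1)[OF q1, of "a n x" "g' x"] by simp
      qed
      also have "\<dots> = q * (t * Re (\<integral>x. dual_map q (a n x) * f x \<partial>M))"
        using int[of n] by (simp add: integrable_Re integral_Re del: times_complex.sel)
      finally have "t * Re (\<Lambda> f) \<le> t * (q * Re (\<integral>x. dual_map q (a n x) * f x \<partial>M))"
        using var[OF f, of t] an by (simp add: mult.left_commute)
      then show ?thesis using t by simp
    qed
    define W where "W x = complex_of_real (cmod (g' x)) + of_real (cmod (f x))" for x
    have Wn: "cmod (W x) = cmod (g' x) + cmod (f x)" for x
      unfolding W_def by (simp only: of_real_add[symmetric] norm_of_real) simp
    have WL: "W \<in> Lp_functions q M" unfolding W_def using q1 by (intro Lp_functions_add Lp_functions_cmod g' fL) auto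
    have "(\<lambda>n. \<integral>x. dual_map q (a n x) * f x \<partial>M) \<longlonglongrightarrow> (\<integral>x. dual_map q (g' x) * f x \<partial>M)"
    proof (rule integral_dominated_convergence)
      show "integrable M (\<lambda>x. cmod (dual_map q (W x) * f x))"
        by (intro integrable_norm integrable_mult dual_map_Lp WL fL)
      show "AE x in M. (\<lambda>n. dual_map q (a n x) * f x) \<longlonglongrightarrow> dual_map q (g' x) * f x"
      proof (intro AE_I2 tendsto_mult tendsto_dual_map[OF _ q1] tendsto_const)
        fix x
        have "(\<lambda>n. g' x + of_real (inverse (real (Suc n))) * f x) \<longlonglongrightarrow> g' x + of_real 0 * f x"
          by (intro tendsto_intros LIMSEQ_inverse_real_of_nat)
        then show "(\<lambda>n. a n x) \<longlonglongrightarrow> g' x" by (simp add: a_def inverse_eq_divide)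
      qed
      show "AE x in M. norm (dual_map q (a n x) * f x) \<le> cmod (dual_map q (W x) * f x)" for n
      proof (rule AE_I2)
        fix x
        have "cmod (of_real (1 / real (Suc n)) * f x) \<le> 1 * cmod (f x)"
          unfolding norm_mult norm_of_real by (intro mult_right_mono) auto
        then have "cmod (a n x) \<le> cmod (W x)"
          unfolding a_def Wn using norm_triangle_ineq[of "g' x" "of_real (1 / real (Suc n)) * f x"] by simp
        then show "norm (dual_map q (a n x) * f x) \<le> cmod (dual_map q (W x) * f x)"
          unfolding norm_mult cmod_dual_map using q1 by (intro mult_right_mono powr_mono2) auto
      qed
    qed measurable
    then have "(\<lambda>n. q * Re (\<integral>x. dual_map q (a n x) * f x \<partial>M)) \<longlonglongrightarrow> q * Re (\<integral>x. dual_map q (g' x) * f x \<partial>M)"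
      by (intro tendsto_intros)
    then have "Re (\<Lambda> f) \<le> q * Re (\<integral>x. dual_map q (g' x) * f x \<partial>M)"
      by (rule LIMSEQ_le_const) (use step in blast)
    then show ?thesis by (simp add: h_def mult.assoc)
  qed
  have neg: "\<Lambda> (\<lambda>x. - f x) = - \<Lambda> f" if "f \<in> ?S" for f using scale[OF that, of "-1"] by simp
  \<comment> \<open>The one-sided inequality applied to \<open>f\<close> and to \<open>- f\<close>
    gives equality of real parts; applied to \<open>\<i> f\<close> it then gives the imaginary
    parts.\<close>
  have Re_eq: "Re (\<Lambda> f) = Re (\<integral>x. h x * f x \<partial>M)" if f: "f \<in> ?S" for f
    using le[OF f] le[of "\<lambda>x. - f x"] simple_fns_cmult[OF f, of "-1"] by (simp add: neg[OF f])
  have "\<Lambda> f = (\<integral>x. h x * f x \<partial>M)" if f: "f \<in> ?S" for f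
  proof (rule complex_eqI)
    have "Re (\<i> * \<Lambda> f) = Re (\<i> * (\<integral>x. h x * f x \<partial>M))"
      using Re_eq[OF simple_fns_cmult[OF f, of \<i>]] scale[OF f, of \<i>] by (simp add: mult.left_commute)
    then show "Im (\<Lambda> f) = Im (\<integral>x. h x * f x \<partial>M)" by simp
  qed (rule Re_eq[OF f])
  then show ?thesis using hL by blast
qed

end

section \<open>Homogeneity, Hoelder's inequality and its converse\<close>

text \<open>Homogeneity arguments normalise by X + e, which is positive, and let e tend to 0; null
  functions then require no separate case.\<close>

lemma le_powr_limit:
  fixes a C X s :: real
  assumes "0 \<le> X" "0 < s" and le: "\<And>e. 0 < e \<Longrightarrow> a \<le> C * (X + e) powr s"
  shows "a \<le> C * X powr s"
proof -
  have "(\<lambda>n. C * (X + inverse (real (Suc n))) powr s) \<longlonglongrightarrow> C * (X + 0) powr s"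
    using assms by (intro tendsto_mult tendsto_const tendsto_powr' tendsto_add LIMSEQ_inverse_real_of_nat) auto
  then have "a \<le> C * (X + 0) powr s"
    by (rule LIMSEQ_le_const) (use le in auto)
  then show ?thesis by simp
qed

text \<open>The assumptions concern only multiples of the one tuple \<open>g\<close>, so the same
  statement serves functionals that are meaningful on simple functions and those that are meaningful
  on all of L_r.\<close>

lemma homogeneous_bound:
  fixes \<Phi> :: "(nat \<Rightarrow> 'm \<Rightarrow> complex) \<Rightarrow> complex"
  assumes "0 < r"
    and scale: "\<And>c. \<Phi> (\<lambda>k x. c * g k x) = c * \<Phi> g"
    and bound: "\<And>c. (\<Sum>k<n. pow_integral r M (\<lambda>x. c * g k x)) \<le> 1 \<Longrightarrow> cmod (\<Phi> (\<lambda>k x. c * g k x)) \<le> C"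
  shows "cmod (\<Phi> g) \<le> C * (\<Sum>k<n. pow_integral r M (g k)) powr (1 / r)"
proof (rule le_powr_limit)
  let ?X = "\<Sum>k<n. pow_integral r M (g k)"
  show X0: "0 \<le> ?X" by (intro sum_nonneg) simp
  fix e :: real assume e: "0 < e"
  define t where "t = (?X + e) powr (1 / r)"
  have t: "0 < t" "t powr r = ?X + e" using X0 e \<open>0 < r\<close> by (auto simp: t_def powr_powr)
  have "(\<Sum>k<n. pow_integral r M (\<lambda>x. of_real (1 / t) * g k x)) = (1 / t) powr r * ?X"
    unfolding pow_integral_cmult sum_distrib_left[symmetric] using t by (simp add: norm_divide)
  also have "\<dots> = ?X / (?X + e)" using t by (simp add: powr_divide)
  also have "\<dots> \<le> 1" using X0 e by simp
  finally have "cmod (\<Phi> (\<lambda>k x. of_real (1 / t) * g k x)) \<le> C" by (rule bound)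
  then show "cmod (\<Phi> g) \<le> C * (?X + e) powr (1 / r)"
    using t(1) unfolding scale t_def[symmetric] by (simp add: norm_mult norm_divide field_simps)
qed (use assms in auto)

context conj_exp
begin

text \<open>One sequence serves every \<open>h\<close> at once and controls the norms too, so that
  both sides of an estimate can pass to the limit together.\<close>

lemma simple_fns_approx:
  assumes g: "g \<in> Lp_functions q M"
  shows "\<exists>F. (\<forall>n. F n \<in> simple_fns M) \<and>
    (\<forall>h\<in>Lp_functions p M. (\<lambda>n. \<integral>x. h x * F n x \<partial>M) \<longlonglongrightarrow> (\<integral>x. h x * g x \<partial>M)) \<and>
    (\<lambda>n. pow_integral q M (F n)) \<longlonglongrightarrow> pow_integral q M g \<and>
    (\<lambda>n. pow_integral q M (\<lambda>x. F n x - g x)) \<longlonglongrightarrow> 0"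
proof -
  obtain F where "\<forall>n. F n \<in> simple_fns M" "\<forall>x\<in>space M. (\<lambda>n. F n x) \<longlonglongrightarrow> g x"
    "\<forall>n. \<forall>x\<in>space M. cmod (F n x) \<le> 2 * cmod (g x)"
    using simple_fns_dense[OF g q0] by (elim exE conjE)
  then have F: "\<And>n. F n \<in> simple_fns M" "\<And>x. x \<in> space M \<Longrightarrow> (\<lambda>n. F n x) \<longlonglongrightarrow> g x"
    "\<And>n x. x \<in> space M \<Longrightarrow> cmod (F n x) \<le> 2 * cmod (g x)" by simp_all
  have Fm [measurable]: "F n \<in> borel_measurable M" for n by (rule simple_fnsD(4)[OF F(1)])
  have gm [measurable]: "g \<in> borel_measurable M" by (rule Lp_functionsD(1)[OF g])
  show ?thesis
  proof (intro exI[of _ F] conjI allI ballI F(1))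
    fix h assume h: "h \<in> Lp_functions p M"
    have [measurable]: "h \<in> borel_measurable M" by (rule Lp_functionsD(1)[OF h])
    show "(\<lambda>n. \<integral>x. h x * F n x \<partial>M) \<longlonglongrightarrow> (\<integral>x. h x * g x \<partial>M)"
    proof (rule integral_dominated_convergence)
      show "integrable M (\<lambda>x. 2 * cmod (h x * g x))"
        using integrable_mult[OF h g] by (intro integrable_mult_right integrable_norm)
      show "AE x in M. norm (h x * F n x) \<le> 2 * cmod (h x * g x)" for n
      proof (rule AE_I2)
        fix x assume "x \<in> space M"
        then have "cmod (h x) * cmod (F n x) \<le> cmod (h x) * (2 * cmod (g x))"
          using F(3) by (intro mult_left_mono) auto
        then show "norm (h x * F n x) \<le> 2 * cmod (h x * g x)" by (simp add: norm_mult)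
      qed
      show "AE x in M. (\<lambda>n. h x * F n x) \<longlonglongrightarrow> h x * g x"
        using F(2) by (intro AE_I2 tendsto_mult tendsto_const)
    qed measurable
  next
    show "(\<lambda>n. pow_integral q M (F n)) \<longlonglongrightarrow> pow_integral q M g"
      by (rule pow_integral_dct[OF _ _ Lp_functions_cmult[OF g, of 2]])
        (use q1 F in \<open>auto simp: norm_mult\<close>)
  next
    have "(\<lambda>n. pow_integral q M (\<lambda>x. F n x - g x)) \<longlonglongrightarrow> pow_integral q M (\<lambda>x. 0)"
    proof (rule pow_integral_dct[OF _ _ Lp_functions_cmult[OF g, of 3]])
      show "AE x in M. (\<lambda>n. F n x - g x) \<longlonglongrightarrow> 0"
        using F(2) by (auto simp: LIM_zero_iff)
      show "AE x in M. cmod (F n x - g x) \<le> cmod (3 * g x)" for n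
      proof (rule AE_I2)
        fix x assume "x \<in> space M"
        then show "cmod (F n x - g x) \<le> cmod (3 * g x)"
          using F(3)[of x n] norm_triangle_ineq4[of "F n x" "g x"] by (simp add: norm_mult)
      qed
    qed (use q1 in auto)
    then show "(\<lambda>n. pow_integral q M (\<lambda>x. F n x - g x)) \<longlonglongrightarrow> 0" by (simp add: pow_integral_def)
  qed
qed

text \<open>The difference \<open>d\<close> is tested against \<open>dual_map p d\<close>, a limit
  of simple functions; the pairing is then the integral of |d|^p.\<close>

lemma simple_fns_separate:
  assumes h: "h \<in> Lp_functions p M" "h' \<in> Lp_functions p M"
    and eq: "\<And>g. g \<in> simple_fns M \<Longrightarrow> (\<integral>x. h x * g x \<partial>M) = (\<integral>x. h' x * g x \<partial>M)"
  shows "AE x in M. h x = h' x"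
proof -
  interpret sw: conj_exp q p by (rule swap)
  define d where "d x = h x - h' x" for x
  have d: "d \<in> Lp_functions p M" unfolding d_def using h p1 by (intro Lp_functions_diff) auto
  define g where "g x = dual_map p (d x)" for x
  have g: "g \<in> Lp_functions q M" unfolding g_def by (rule sw.dual_map_Lp[OF d])
  obtain F where F: "\<And>n. F n \<in> simple_fns M"
    "\<And>h. h \<in> Lp_functions p M \<Longrightarrow> (\<lambda>n. \<integral>x. h x * F n x \<partial>M) \<longlonglongrightarrow> (\<integral>x. h x * g x \<partial>M)"
    using simple_fns_approx[OF g] by blast
  have "(\<integral>x. h x * g x \<partial>M) = (\<integral>x. h' x * g x \<partial>M)"
    using F(2)[OF h(1)] F(2)[OF h(2)] eq[OF F(1)] LIMSEQ_unique by auto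
  then have "(\<integral>x. d x * g x \<partial>M) = 0"
    using integrable_mult[OF h(1) g] integrable_mult[OF h(2) g] by (simp add: d_def left_diff_distrib)
  then have "complex_of_real (pow_integral p M d) = 0"
    using dual_map_mult_self[of p] by (simp add: g_def pow_integral_def mult.commute)
  then have "AE x in M. d x = 0" using pow_integral_eq_0_iff[OF d] by simp
  then show ?thesis by (simp add: d_def)
qed

text \<open>On the unit balls Young's inequality in each summand gives the bound 1/p + 1/q = 1;
  homogeneity in each of the two tuples does the rest.\<close>

lemma Hoelder_sum:
  fixes g h :: "nat \<Rightarrow> 'm \<Rightarrow> complex"
  assumes g: "\<And>k. k < n \<Longrightarrow> g k \<in> Lp_functions q M" and h: "\<And>k. k < n \<Longrightarrow> h k \<in> Lp_functions p M"
  shows "cmod (\<Sum>k<n. \<integral>x. g k x * h k x \<partial>M) \<le>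
    (\<Sum>k<n. pow_integral q M (g k)) powr (1 / q) * (\<Sum>k<n. pow_integral p M (h k)) powr (1 / p)"
proof -
  have unit: "cmod (\<Sum>k<n. \<integral>x. g k x * h k x \<partial>M) \<le> 1"
    if g: "\<And>k. k < n \<Longrightarrow> g k \<in> Lp_functions q M" and h: "\<And>k. k < n \<Longrightarrow> h k \<in> Lp_functions p M"
      and g1: "(\<Sum>k<n. pow_integral q M (g k)) \<le> 1" and h1: "(\<Sum>k<n. pow_integral p M (h k)) \<le> 1"
    for g h :: "nat \<Rightarrow> 'm \<Rightarrow> complex"
  proof -
    have "cmod (\<Sum>k<n. \<integral>x. g k x * h k x \<partial>M) \<le>
        (\<Sum>k<n. pow_integral p M (h k) / p + pow_integral q M (g k) / q)"
    proof (rule sum_norm_le)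
      fix k assume "k \<in> {..<n}"
      then have gk: "g k \<in> Lp_functions q M" and hk: "h k \<in> Lp_functions p M" using g h by auto
      have "cmod (\<integral>x. g k x * h k x \<partial>M) \<le> (\<integral>x. cmod (h k x * g k x) \<partial>M)"
        using integral_norm_bound[of M "\<lambda>x. g k x * h k x"] by (simp add: mult.commute)
      also have "\<dots> \<le> (\<integral>x. cmod (h k x) powr p / p + cmod (g k x) powr q / q \<partial>M)"
      proof (rule integral_mono)
        show "integrable M (\<lambda>x. cmod (h k x * g k x))"
          by (intro integrable_norm integrable_mult hk gk)
        show "integrable M (\<lambda>x. cmod (h k x) powr p / p + cmod (g k x) powr q / q)"
          using Lp_functionsD(2)[OF hk] Lp_functionsD(2)[OF gk] by auto
        show "cmod (h k x * g k x) \<le> cmod (h k x) powr p / p + cmod (g k x) powr q / q" for x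
          unfolding norm_mult by (rule Youngs_inequality[OF p1 q1 pq]) auto
      qed
      also have "\<dots> = pow_integral p M (h k) / p + pow_integral q M (g k) / q"
        unfolding pow_integral_def using Lp_functionsD(2)[OF hk] Lp_functionsD(2)[OF gk] by simp
      finally show "cmod (\<integral>x. g k x * h k x \<partial>M) \<le> pow_integral p M (h k) / p + pow_integral q M (g k) / q" .
    qed
    also have "\<dots> = (\<Sum>k<n. pow_integral p M (h k)) / p + (\<Sum>k<n. pow_integral q M (g k)) / q"
      by (simp add: sum.distrib sum_divide_distrib)
    also have "\<dots> \<le> 1 / p + 1 / q" using g1 h1 p1 q1 by (intro add_mono divide_right_mono) auto
    finally show ?thesis using pq by simp
  qed
  have int: "integrable M (\<lambda>x. g k x * h k x)" if "k < n" for k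
    using integrable_mult[OF h g] that by (simp add: mult.commute)
  define A where "A = (\<Sum>k<n. pow_integral p M (h k)) powr (1 / p)"
  have "cmod (\<Sum>k<n. \<integral>x. g k x * h k x \<partial>M) \<le> A * (\<Sum>k<n. pow_integral q M (g k)) powr (1 / q)"
  proof (rule homogeneous_bound[where \<Phi> = "\<lambda>g. \<Sum>k<n. \<integral>x. g k x * h k x \<partial>M"])
    show "(\<Sum>k<n. \<integral>x. c * g k x * h k x \<partial>M) = c * (\<Sum>k<n. \<integral>x. g k x * h k x \<partial>M)" for c
      by (simp add: sum_distrib_left mult.assoc)
    fix c assume c: "(\<Sum>k<n. pow_integral q M (\<lambda>x. c * g k x)) \<le> 1"
    have "cmod (\<Sum>k<n. \<integral>x. c * g k x * h k x \<partial>M) \<le> 1 * A"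
      unfolding A_def
    proof (rule homogeneous_bound[where \<Phi> = "\<lambda>h. \<Sum>k<n. \<integral>x. c * g k x * h k x \<partial>M"])
      show "(\<Sum>k<n. \<integral>x. c * g k x * (d * h k x) \<partial>M) = d * (\<Sum>k<n. \<integral>x. c * g k x * h k x \<partial>M)" for d
        by (simp add: sum_distrib_left mult.assoc mult.left_commute)
      fix d assume d: "(\<Sum>k<n. pow_integral p M (\<lambda>x. d * h k x)) \<le> 1"
      show "cmod (\<Sum>k<n. \<integral>x. c * g k x * (d * h k x) \<partial>M) \<le> 1"
        by (rule unit[of "\<lambda>k x. c * g k x" "\<lambda>k x. d * h k x", OF _ _ c d])
          (auto intro: Lp_functions_cmult g h)
    qed (use p1 in auto)
    then show "cmod (\<Sum>k<n. \<integral>x. c * g k x * h k x \<partial>M) \<le> A" by simp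
  qed (use q1 in auto)
  then show ?thesis by (simp add: A_def mult.commute)
qed

text \<open>Take for \<open>g\<close> the dual maps of the \<open>h k\<close>, approximated by
  simple functions. If Y is the sum on the left, the hypothesis becomes Y \<le> Y^(1/q), which fails
  for Y > 1.\<close>

lemma dual_norm_le_1:
  fixes h :: "nat \<Rightarrow> 'm \<Rightarrow> complex"
  assumes h: "\<And>k. k < n \<Longrightarrow> h k \<in> Lp_functions p M"
    and le: "\<And>g. (\<And>k. k < n \<Longrightarrow> g k \<in> simple_fns M) \<Longrightarrow>
      cmod (\<Sum>k<n. \<integral>x. h k x * g k x \<partial>M) \<le> (\<Sum>k<n. pow_integral q M (g k)) powr (1 / q)"
  shows "(\<Sum>k<n. pow_integral p M (h k)) \<le> 1"
proof -
  interpret sw: conj_exp q p by (rule swap)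
  define Y where "Y = (\<Sum>k<n. pow_integral p M (h k))"
  have Y0: "0 \<le> Y" unfolding Y_def by (intro sum_nonneg) simp
  define g where "g k x = dual_map p (h k x)" for k x
  have g: "g k \<in> Lp_functions q M" "pow_integral q M (g k) = pow_integral p M (h k)" if "k < n" for k
    unfolding g_def using sw.dual_map_Lp[OF h[OF that]] by auto
  have "\<forall>k. \<exists>F. k < n \<longrightarrow> (\<forall>i. F i \<in> simple_fns M) \<and>
    (\<forall>h\<in>Lp_functions p M. (\<lambda>i. \<integral>x. h x * F i x \<partial>M) \<longlonglongrightarrow> (\<integral>x. h x * g k x \<partial>M)) \<and>
    (\<lambda>i. pow_integral q M (F i)) \<longlonglongrightarrow> pow_integral q M (g k)"
    using simple_fns_approx[OF g(1)] by blast
  from choice[OF this] obtain F where "\<forall>k. k < n \<longrightarrow> (\<forall>i. F k i \<in> simple_fns M) \<and>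
    (\<forall>h\<in>Lp_functions p M. (\<lambda>i. \<integral>x. h x * F k i x \<partial>M) \<longlonglongrightarrow> (\<integral>x. h x * g k x \<partial>M)) \<and>
    (\<lambda>i. pow_integral q M (F k i)) \<longlonglongrightarrow> pow_integral q M (g k)" by blast
  then have F: "\<And>k i. k < n \<Longrightarrow> F k i \<in> simple_fns M"
    "\<And>k h. k < n \<Longrightarrow> h \<in> Lp_functions p M \<Longrightarrow> (\<lambda>i. \<integral>x. h x * F k i x \<partial>M) \<longlonglongrightarrow> (\<integral>x. h x * g k x \<partial>M)"
    "\<And>k. k < n \<Longrightarrow> (\<lambda>i. pow_integral q M (F k i)) \<longlonglongrightarrow> pow_integral q M (g k)"
    by auto
  have "(\<integral>x. h k x * g k x \<partial>M) = of_real (pow_integral p M (h k))" for k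
    using dual_map_mult_self[of p] by (simp add: g_def pow_integral_def mult.commute)
  then have pair: "(\<Sum>k<n. \<integral>x. h k x * g k x \<partial>M) = of_real Y" by (simp add: Y_def)
  have "cmod (\<Sum>k<n. \<integral>x. h k x * g k x \<partial>M) \<le> (\<Sum>k<n. pow_integral q M (g k)) powr (1 / q)"
  proof (rule tendsto_le[OF trivial_limit_sequentially])
    show "(\<lambda>i. (\<Sum>k<n. pow_integral q M (F k i)) powr (1 / q)) \<longlonglongrightarrow> (\<Sum>k<n. pow_integral q M (g k)) powr (1 / q)"
      using q1 F(3) by (intro tendsto_powr' tendsto_sum tendsto_const) (auto simp: sum_nonneg)
    show "(\<lambda>i. cmod (\<Sum>k<n. \<integral>x. h k x * F k i x \<partial>M)) \<longlonglongrightarrow> cmod (\<Sum>k<n. \<integral>x. h k x * g k x \<partial>M)"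
      using F(2) h by (intro tendsto_norm tendsto_sum) auto
    show "\<forall>\<^sub>F i in sequentially. cmod (\<Sum>k<n. \<integral>x. h k x * F k i x \<partial>M) \<le> (\<Sum>k<n. pow_integral q M (F k i)) powr (1 / q)"
      using le[of "\<lambda>k. F k i" for i] F(1) by simp
  qed
  also have "(\<Sum>k<n. pow_integral q M (g k)) = Y" unfolding Y_def using g(2) by simp
  finally have Yle: "Y \<le> Y powr (1 / q)" unfolding pair using Y0 by simp
  show ?thesis
  proof (rule ccontr)
    assume "\<not> ?thesis"
    then have "1 < Y" by (simp add: Y_def)
    moreover have "1 / q < 1" using q1 by simp
    ultimately have "Y powr (1 / q) < Y powr 1" by (intro powr_less_mono) auto
    then show False using Yle \<open>1 < Y\<close> by simp
  qed
qed

text \<open>\<open>\<kappa>\<close> is the adjoint of \<open>T\<close> on simple functions. It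
  belongs to the relation because \<open>b\<close> is given on simple functions only: for a general
  \<open>f\<close> in L_p, the integral of \<open>\<kappa> g\<close> times \<open>f\<close> stands
  for the extended form.\<close>

definition represents :: "'m measure \<Rightarrow> (('m \<Rightarrow> complex) \<Rightarrow> ('m \<Rightarrow> complex) \<Rightarrow> complex) \<Rightarrow>
    (('m \<Rightarrow> complex) \<Rightarrow> 'm \<Rightarrow> complex) \<Rightarrow> (('m \<Rightarrow> complex) \<Rightarrow> 'm \<Rightarrow> complex) \<Rightarrow> bool" where
  "represents M b T \<kappa> \<longleftrightarrow> (\<forall>f\<in>Lp_functions p M. T f \<in> Lp_functions p M) \<and>
    (\<forall>g\<in>simple_fns M. \<kappa> g \<in> Lp_functions q M) \<and>
    (\<forall>f\<in>simple_fns M. \<forall>g\<in>simple_fns M. b f g = (\<integral>x. \<kappa> g x * f x \<partial>M)) \<and>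
    (\<forall>f\<in>Lp_functions p M. \<forall>g\<in>simple_fns M. (\<integral>x. T f x * g x \<partial>M) = (\<integral>x. \<kappa> g x * f x \<partial>M))"

text \<open>Reflexivity of \<open>L\<^sub>p\<close> enters here: both variables are represented in turn by Riesz.\<close>

lemma bilinear_form_operator:
  fixes b :: "('m \<Rightarrow> complex) \<Rightarrow> ('m \<Rightarrow> complex) \<Rightarrow> complex"
  assumes add_l: "\<And>f f' g. f \<in> simple_fns M \<Longrightarrow> f' \<in> simple_fns M \<Longrightarrow> g \<in> simple_fns M \<Longrightarrow>
      b (\<lambda>x. f x + f' x) g = b f g + b f' g"
    and scale_l: "\<And>c f g. f \<in> simple_fns M \<Longrightarrow> g \<in> simple_fns M \<Longrightarrow> b (\<lambda>x. c * f x) g = c * b f g"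
    and add_r: "\<And>f g g'. f \<in> simple_fns M \<Longrightarrow> g \<in> simple_fns M \<Longrightarrow> g' \<in> simple_fns M \<Longrightarrow>
      b f (\<lambda>x. g x + g' x) = b f g + b f g'"
    and scale_r: "\<And>c f g. f \<in> simple_fns M \<Longrightarrow> g \<in> simple_fns M \<Longrightarrow> b f (\<lambda>x. c * g x) = c * b f g"
    and bound: "\<And>f g. f \<in> simple_fns M \<Longrightarrow> g \<in> simple_fns M \<Longrightarrow> pow_integral p M f \<le> 1 \<Longrightarrow>
      pow_integral q M g \<le> 1 \<Longrightarrow> cmod (b f g) \<le> C"
  shows "\<exists>T \<kappa>. represents M b T \<kappa>"
proof -
  interpret sw: conj_exp q p by (rule swap)
  have bound': "cmod (b f g) \<le> C * pow_integral q M g powr (1 / q)"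
    if f: "f \<in> simple_fns M" "pow_integral p M f \<le> 1" and g: "g \<in> simple_fns M" for f g
  proof -
    have "cmod (c * b f g) \<le> C" if "pow_integral q M (\<lambda>x. c * g x) \<le> 1" for c
      using bound[OF f(1) simple_fns_cmult[OF g] f(2) that] scale_r[OF f(1) g, of c] by simp
    then show ?thesis
      using homogeneous_bound[of q "\<lambda>g. b f (g 0)" "\<lambda>_. g" M 1 C] q1 scale_r[OF f(1) g] by auto
  qed
  have ex: "\<exists>k\<in>Lp_functions q M. \<forall>f\<in>simple_fns M. b f g = (\<integral>x. k x * f x \<partial>M)"
    if g: "g \<in> simple_fns M" for g
    by (rule sw.riesz_simple_fns[of M "\<lambda>f. b f g"]) (rule add_l scale_l bound' g | assumption)+
  define \<kappa> where "\<kappa> g = (SOME k. k \<in> Lp_functions q M \<and>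
    (\<forall>f\<in>simple_fns M. b f g = (\<integral>x. k x * f x \<partial>M)))" for g
  have \<kappa>: "\<kappa> g \<in> Lp_functions q M" "\<And>f. f \<in> simple_fns M \<Longrightarrow> b f g = (\<integral>x. \<kappa> g x * f x \<partial>M)"
    if "g \<in> simple_fns M" for g
    using someI_ex[OF ex[OF that, unfolded Bex_def]] by (auto simp: \<kappa>_def)
  \<comment> \<open>\<open>\<kappa> g\<close> is chosen separately for each \<open>g\<close>. An
    integral identity on simple functions determines it almost everywhere, and this is what makes
    the integrals against a fixed \<open>f\<close> linear in \<open>g\<close>.\<close>
  have \<kappa>_ext: "(\<integral>x. \<kappa> g x * f x \<partial>M) = (\<integral>x. k x * f x \<partial>M)"
    if "g \<in> simple_fns M" "k \<in> Lp_functions q M" "f \<in> Lp_functions p M"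
      and eq: "\<And>f. f \<in> simple_fns M \<Longrightarrow> b f g = (\<integral>x. k x * f x \<partial>M)" for f g k
  proof (rule integral_cong_AE)
    have "AE x in M. \<kappa> g x = k x"
      by (rule sw.simple_fns_separate) (use that \<kappa> in auto)
    then show "AE x in M. \<kappa> g x * f x = k x * f x" by eventually_elim simp
  qed (use that \<kappa>(1)[OF that(1)] in \<open>auto intro!: borel_measurable_times dest: Lp_functionsD\<close>)
  \<comment> \<open>The bound required by Riesz is at hand for simple \<open>f\<close> and reaches a
    general \<open>f\<close> along an approximating sequence.\<close>
  have exT: "\<exists>h\<in>Lp_functions p M. \<forall>g\<in>simple_fns M. (\<integral>x. \<kappa> g x * f x \<partial>M) = (\<integral>x. h x * g x \<partial>M)"
    if f: "f \<in> Lp_functions p M" for f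
  proof -
    obtain F where F: "\<And>n. F n \<in> simple_fns M"
      "\<And>h. h \<in> Lp_functions q M \<Longrightarrow> (\<lambda>n. \<integral>x. h x * F n x \<partial>M) \<longlonglongrightarrow> (\<integral>x. h x * f x \<partial>M)"
      "(\<lambda>n. pow_integral p M (F n)) \<longlonglongrightarrow> pow_integral p M f"
      using sw.simple_fns_approx[OF f] by blast
    show ?thesis
    proof (rule riesz_simple_fns)
      fix g g' assume g: "g \<in> simple_fns M" "g' \<in> simple_fns M"
      have "(\<integral>x. \<kappa> (\<lambda>x. g x + g' x) x * f x \<partial>M) = (\<integral>x. (\<kappa> g x + \<kappa> g' x) * f x \<partial>M)"
      proof (rule \<kappa>_ext)
        show "b u (\<lambda>x. g x + g' x) = (\<integral>x. (\<kappa> g x + \<kappa> g' x) * u x \<partial>M)" if u: "u \<in> simple_fns M" for u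
          using u g \<kappa>(2) sw.integrable_mult[OF \<kappa>(1) simple_fns_Lp[OF u]]
          by (simp add: add_r distrib_right)
      qed (use g f \<kappa> q1 in \<open>auto intro: simple_fns_add Lp_functions_add\<close>)
      then show "(\<integral>x. \<kappa> (\<lambda>x. g x + g' x) x * f x \<partial>M) = (\<integral>x. \<kappa> g x * f x \<partial>M) + (\<integral>x. \<kappa> g' x * f x \<partial>M)"
        using sw.integrable_mult[OF \<kappa>(1) f] g by (simp add: distrib_right)
    next
      fix c g assume g: "g \<in> simple_fns M"
      have "(\<integral>x. \<kappa> (\<lambda>x. c * g x) x * f x \<partial>M) = (\<integral>x. (c * \<kappa> g x) * f x \<partial>M)"
      proof (rule \<kappa>_ext)
        show "b u (\<lambda>x. c * g x) = (\<integral>x. (c * \<kappa> g x) * u x \<partial>M)" if "u \<in> simple_fns M" for u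
          using that g \<kappa>(2) by (simp add: scale_r mult.assoc)
      qed (use g f \<kappa> in \<open>auto intro: simple_fns_cmult Lp_functions_cmult\<close>)
      then show "(\<integral>x. \<kappa> (\<lambda>x. c * g x) x * f x \<partial>M) = c * (\<integral>x. \<kappa> g x * f x \<partial>M)"
        by (simp add: mult.assoc)
    next
      fix g assume g: "g \<in> simple_fns M" "pow_integral q M g \<le> 1"
      have "cmod (b u g) \<le> C * pow_integral p M u powr (1 / p)" if u: "u \<in> simple_fns M" for u
      proof -
        have "cmod (c * b u g) \<le> C" if "pow_integral p M (\<lambda>x. c * u x) \<le> 1" for c
          using bound[OF simple_fns_cmult[OF u] g(1) that g(2)] scale_l[OF u g(1), of c] by simp
        then show ?thesis
          using homogeneous_bound[of p "\<lambda>f. b (f 0) g" "\<lambda>_. u" M 1 C] p1 scale_l[OF u g(1)] by auto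
      qed
      then have le: "cmod (\<integral>x. \<kappa> g x * F n x \<partial>M) \<le> C * pow_integral p M (F n) powr (1 / p)" for n
        by (simp add: \<kappa>(2)[OF g(1) F(1), symmetric] F(1))
      show "cmod (\<integral>x. \<kappa> g x * f x \<partial>M) \<le> C * pow_integral p M f powr (1 / p)"
      proof (rule tendsto_le[OF trivial_limit_sequentially])
        show "(\<lambda>n. C * pow_integral p M (F n) powr (1 / p)) \<longlonglongrightarrow> C * pow_integral p M f powr (1 / p)"
          using p1 F(3) by (intro tendsto_mult tendsto_powr' tendsto_const) auto
        show "(\<lambda>n. cmod (\<integral>x. \<kappa> g x * F n x \<partial>M)) \<longlonglongrightarrow> cmod (\<integral>x. \<kappa> g x * f x \<partial>M)"
          using F(2) \<kappa>(1)[OF g(1)] by (intro tendsto_norm) auto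
      qed (use le in simp)
    qed
  qed
  define T where "T f = (SOME h. h \<in> Lp_functions p M \<and>
    (\<forall>g\<in>simple_fns M. (\<integral>x. \<kappa> g x * f x \<partial>M) = (\<integral>x. h x * g x \<partial>M)))" for f
  have "T f \<in> Lp_functions p M" "\<And>g. g \<in> simple_fns M \<Longrightarrow> (\<integral>x. \<kappa> g x * f x \<partial>M) = (\<integral>x. T f x * g x \<partial>M)"
    if "f \<in> Lp_functions p M" for f
    using someI_ex[OF exT[OF that, unfolded Bex_def]] by (auto simp: T_def)
  then show ?thesis unfolding represents_def using \<kappa> by (intro exI[of _ T] exI[of _ \<kappa>]) auto
qed

end

section \<open>Classes of functions and operators on \<open>L\<^sub>p\<close>\<close>

lemma equiv_Lp_rel: "equiv (Lp_functions r M) (Lp_rel r M)"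
proof (rule equivI)
  show "Lp_rel r M \<subseteq> Lp_functions r M \<times> Lp_functions r M" by (auto simp: Lp_rel_def)
  show "refl_on (Lp_functions r M) (Lp_rel r M)" by (auto simp: refl_on_def Lp_rel_def)
  show "sym (Lp_rel r M)" by (auto simp: sym_def Lp_rel_def elim!: eventually_mono)
  show "trans (Lp_rel r M)"
  proof (rule transI)
    fix f g h assume "(f, g) \<in> Lp_rel r M" "(g, h) \<in> Lp_rel r M"
    then show "(f, h) \<in> Lp_rel r M"
      unfolding Lp_rel_def by (auto elim: eventually_elim2)
  qed
qed

lemma Lp_class_in_Lp: "f \<in> Lp_functions r M \<Longrightarrow> Lp_class r M f \<in> Lp r M"
  unfolding Lp_class_def Lp_def by (rule quotientI)

lemma Lp_class_eq_iff:
  assumes "f \<in> Lp_functions r M" "g \<in> Lp_functions r M"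
  shows "Lp_class r M f = Lp_class r M g \<longleftrightarrow> (AE x in M. f x = g x)"
  unfolding Lp_class_def eq_equiv_class_iff[OF equiv_Lp_rel assms]
  using assms by (simp add: Lp_rel_def)

lemma Lp_rep:
  assumes "\<xi> \<in> Lp r M"
  shows "Lp_rep \<xi> \<in> Lp_functions r M" "Lp_class r M (Lp_rep \<xi>) = \<xi>"
proof -
  obtain f where f: "f \<in> Lp_functions r M" "\<xi> = Lp_class r M f"
    using assms unfolding Lp_def Lp_class_def by (rule quotientE)
  have "f \<in> \<xi>" using f equiv_class_self[OF equiv_Lp_rel f(1)] by (simp add: Lp_class_def)
  then have "Lp_rep \<xi> \<in> \<xi>" unfolding Lp_rep_def by (rule someI[of "\<lambda>f. f \<in> \<xi>"])
  then have rel: "(f, Lp_rep \<xi>) \<in> Lp_rel r M" using f by (simp add: Lp_class_def)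
  then show 1: "Lp_rep \<xi> \<in> Lp_functions r M" by (simp add: Lp_rel_def)
  show "Lp_class r M (Lp_rep \<xi>) = \<xi>"
    unfolding Lp_class_def equiv_class_eq[OF equiv_Lp_rel rel, symmetric]
    by (rule f(2)[unfolded Lp_class_def, symmetric])
qed

lemma Lp_rep_class:
  assumes "f \<in> Lp_functions r M"
  shows "AE x in M. Lp_rep (Lp_class r M f) x = f x"
  using Lp_rep[OF Lp_class_in_Lp[OF assms]] Lp_class_eq_iff[OF _ assms] by blast

lemma Lp_add_class:
  assumes f: "f \<in> Lp_functions r M" and g: "g \<in> Lp_functions r M" and r: "0 < r"
  shows "Lp_add r M (Lp_class r M f) (Lp_class r M g) = Lp_class r M (\<lambda>x. f x + g x)"
  unfolding Lp_add_def
proof (subst Lp_class_eq_iff)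
  show "AE x in M. Lp_rep (Lp_class r M f) x + Lp_rep (Lp_class r M g) x = f x + g x"
    using Lp_rep_class[OF f] Lp_rep_class[OF g] by eventually_elim simp
qed (use f g r in \<open>auto intro: Lp_functions_add Lp_rep Lp_class_in_Lp\<close>)

lemma Lp_scale_class:
  assumes f: "f \<in> Lp_functions r M"
  shows "Lp_scale r M c (Lp_class r M f) = Lp_class r M (\<lambda>x. c * f x)"
  unfolding Lp_scale_def
proof (subst Lp_class_eq_iff)
  show "AE x in M. c * Lp_rep (Lp_class r M f) x = c * f x"
    using Lp_rep_class[OF f] by eventually_elim simp
qed (use f in \<open>auto intro: Lp_functions_cmult Lp_rep Lp_class_in_Lp\<close>)

lemma Lp_norm_rep: "Lp_norm r M \<xi> = pow_integral r M (Lp_rep \<xi>) powr (1 / r)"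
  by (simp add: Lp_norm_def pow_integral_def)

lemma pow_integral_rep_class:
  assumes "f \<in> Lp_functions r M"
  shows "pow_integral r M (Lp_rep (Lp_class r M f)) = pow_integral r M f"
  using assms Lp_rep_class[OF assms] Lp_rep(1)[OF Lp_class_in_Lp[OF assms]]
  by (intro pow_integral_cong_AE) (auto dest: Lp_functionsD)

lemma lp_norm_Lp_norm:
  assumes "0 < r"
  shows "lp_norm r n (\<lambda>i. Lp_norm r M (\<xi> i)) = (\<Sum>i<n. pow_integral r M (Lp_rep (\<xi> i))) powr (1 / r)"
  using assms by (simp add: lp_norm_def Lp_norm_rep powr_powr)

lemma powr_inverse_le_1_iff:
  fixes x r :: real
  assumes "0 \<le> x" "0 < r"
  shows "x powr (1 / r) \<le> 1 \<longleftrightarrow> x \<le> 1"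
proof
  assume "x powr (1 / r) \<le> 1"
  then have "(x powr (1 / r)) powr r \<le> 1 powr r" using assms by (intro powr_mono2) auto
  then show "x \<le> 1" using assms by (simp add: powr_powr)
next
  assume "x \<le> 1"
  then have "x powr (1 / r) \<le> 1 powr (1 / r)" using assms by (intro powr_mono2) auto
  then show "x powr (1 / r) \<le> 1" by simp
qed

text \<open>A crude form of Minkowski's inequality. The constant does not matter: the aim is that a
  finite matrix of bounded operators is bounded, so that the supremum in \<open>Lp_mat_norm\<close>
  is taken over a bounded set.\<close>

lemma pow_integral_sum_le:
  assumes r: "0 < r" and f: "\<And>j. j < n \<Longrightarrow> f j \<in> Lp_functions r M"
  shows "pow_integral r M (\<lambda>x. \<Sum>j<n::nat. f j x) \<le> (2 powr r) ^ n * (\<Sum>j<n. pow_integral r M (f j))"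
  using f
proof (induction n)
  case 0
  then show ?case by (simp add: pow_integral_def)
next
  case (Suc n)
  have s: "(\<lambda>x. \<Sum>j<n. f j x) \<in> Lp_functions r M" using Suc.prems r by (intro Lp_functions_sum) auto
  have fn: "f n \<in> Lp_functions r M" using Suc.prems by simp
  have c: "1 \<le> 2 powr r" using r by (simp add: ge_one_powr_ge_zero)
  have "pow_integral r M (\<lambda>x. \<Sum>j<Suc n. f j x) \<le>
      (\<integral>x. 2 powr r * (cmod (\<Sum>j<n. f j x) powr r + cmod (f n x) powr r) \<partial>M)"
    unfolding pow_integral_def
  proof (rule integral_mono)
    show "integrable M (\<lambda>x. cmod (\<Sum>j<Suc n. f j x) powr r)"
      using Suc.prems r by (intro Lp_functionsD(2) Lp_functions_sum) auto
    show "integrable M (\<lambda>x. 2 powr r * (cmod (\<Sum>j<n. f j x) powr r + cmod (f n x) powr r))"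
      using Lp_functionsD(2)[OF s] Lp_functionsD(2)[OF fn] by auto
    fix x
    have "cmod (\<Sum>j<Suc n. f j x) powr r \<le> (cmod (\<Sum>j<n. f j x) + cmod (f n x)) powr r"
      using r norm_triangle_ineq[of "\<Sum>j<n. f j x" "f n x"] by (intro powr_mono2) auto
    also have "\<dots> \<le> 2 powr r * (cmod (\<Sum>j<n. f j x) powr r + cmod (f n x) powr r)"
      using r by (intro powr_add_le) auto
    finally show "cmod (\<Sum>j<Suc n. f j x) powr r \<le> 2 powr r * (cmod (\<Sum>j<n. f j x) powr r + cmod (f n x) powr r)" .
  qed
  also have "\<dots> = 2 powr r * (pow_integral r M (\<lambda>x. \<Sum>j<n. f j x) + pow_integral r M (f n))"
    unfolding pow_integral_def using Lp_functionsD(2)[OF s] Lp_functionsD(2)[OF fn] by simp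
  also have "\<dots> \<le> 2 powr r * ((2 powr r) ^ n * (\<Sum>j<n. pow_integral r M (f j)) + (2 powr r) ^ n * pow_integral r M (f n))"
  proof (intro mult_left_mono add_mono)
    show "pow_integral r M (\<lambda>x. \<Sum>j<n. f j x) \<le> (2 powr r) ^ n * (\<Sum>j<n. pow_integral r M (f j))"
      using Suc by simp
    show "pow_integral r M (f n) \<le> (2 powr r) ^ n * pow_integral r M (f n)"
      using mult_right_mono[OF one_le_power[OF c, of n] pow_integral_nonneg[of r M "f n"]] by simp
  qed simp
  finally show ?case by (simp add: algebra_simps)
qed

section \<open>Operators on classes acting on functions, and their matrix norms\<close>

abbreviation act :: "real \<Rightarrow> 'm measure \<Rightarrow> 'm Lp_op \<Rightarrow> ('m \<Rightarrow> complex) \<Rightarrow> 'm \<Rightarrow> complex" where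
  "act r M T f \<equiv> Lp_rep (T (Lp_class r M f))"

lemma act_Lp:
  assumes "T \<in> Lp_ops r M" "f \<in> Lp_functions r M"
  shows "act r M T f \<in> Lp_functions r M"
  using assms Lp_class_in_Lp[OF assms(2)] by (auto simp: Lp_ops_def intro!: Lp_rep)

lemma act_add:
  assumes T: "T \<in> Lp_ops r M" and f: "f \<in> Lp_functions r M" and g: "g \<in> Lp_functions r M" and r: "0 < r"
  shows "AE x in M. act r M T (\<lambda>x. f x + g x) x = act r M T f x + act r M T g x"
proof -
  have "T (Lp_class r M (\<lambda>x. f x + g x)) = Lp_add r M (T (Lp_class r M f)) (T (Lp_class r M g))"
    unfolding Lp_add_class[OF f g r, symmetric]
    using T Lp_class_in_Lp[OF f] Lp_class_in_Lp[OF g] unfolding Lp_ops_def by blast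
  also have "\<dots> = Lp_class r M (\<lambda>x. act r M T f x + act r M T g x)" by (simp add: Lp_add_def)
  finally show ?thesis
    using Lp_rep_class[OF Lp_functions_add[OF act_Lp[OF T f] act_Lp[OF T g] r]] by simp
qed

lemma act_scale:
  assumes T: "T \<in> Lp_ops r M" and f: "f \<in> Lp_functions r M"
  shows "AE x in M. act r M T (\<lambda>x. c * f x) x = c * act r M T f x"
proof -
  have "T (Lp_class r M (\<lambda>x. c * f x)) = Lp_scale r M c (T (Lp_class r M f))"
    unfolding Lp_scale_class[OF f, symmetric]
    using T Lp_class_in_Lp[OF f] unfolding Lp_ops_def by blast
  also have "\<dots> = Lp_class r M (\<lambda>x. c * act r M T f x)" by (simp add: Lp_scale_def)
  finally show ?thesis using Lp_rep_class[OF Lp_functions_cmult[OF act_Lp[OF T f]]] by simp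
qed

lemma act_bounded:
  assumes T: "T \<in> Lp_ops r M" and r: "0 < r"
  shows "\<exists>C\<ge>0. \<forall>f\<in>Lp_functions r M. pow_integral r M (act r M T f) \<le> C * pow_integral r M f"
proof -
  have "\<exists>C. \<forall>\<xi>\<in>Lp r M. Lp_norm r M (T \<xi>) \<le> C * Lp_norm r M \<xi>"
    using T by (simp add: Lp_ops_def)
  then obtain C where C: "\<forall>\<xi>\<in>Lp r M. Lp_norm r M (T \<xi>) \<le> C * Lp_norm r M \<xi>" ..
  have "pow_integral r M (act r M T f) \<le> \<bar>C\<bar> powr r * pow_integral r M f" if f: "f \<in> Lp_functions r M" for f
  proof -
    have "Lp_norm r M (T (Lp_class r M f)) \<le> C * Lp_norm r M (Lp_class r M f)"
      by (rule C[rule_format, OF Lp_class_in_Lp[OF f]])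
    then have "pow_integral r M (act r M T f) powr (1 / r) \<le> C * pow_integral r M f powr (1 / r)"
      by (simp add: Lp_norm_rep pow_integral_rep_class[OF f])
    also have "\<dots> \<le> \<bar>C\<bar> * pow_integral r M f powr (1 / r)" by (intro mult_right_mono) auto
    finally have "(pow_integral r M (act r M T f) powr (1 / r)) powr r \<le> (\<bar>C\<bar> * pow_integral r M f powr (1 / r)) powr r"
      using r by (intro powr_mono2) auto
    then show ?thesis using r by (simp add: powr_powr powr_mult)
  qed
  then show ?thesis by (intro exI[of _ "\<bar>C\<bar> powr r"]) auto
qed

lemma Lp_norm_mat_apply:
  assumes r: "0 < r" and T: "T \<in> carrier_mat n n" "\<And>i j. i < n \<Longrightarrow> j < n \<Longrightarrow> T $$ (i, j) \<in> Lp_ops r M"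
    and \<xi>: "\<And>j. j < n \<Longrightarrow> \<xi> j \<in> Lp r M"
  shows "lp_norm r n (\<lambda>i. Lp_norm r M (Lp_mat_apply r M T \<xi> i)) =
    (\<Sum>i<n. pow_integral r M (\<lambda>x. \<Sum>j<n. act r M (T $$ (i, j)) (Lp_rep (\<xi> j)) x)) powr (1 / r)"
proof -
  have "pow_integral r M (Lp_rep (Lp_mat_apply r M T \<xi> i)) =
      pow_integral r M (\<lambda>x. \<Sum>j<n. act r M (T $$ (i, j)) (Lp_rep (\<xi> j)) x)" if "i < n" for i
  proof -
    have *: "(\<lambda>x. \<Sum>j<n. act r M (T $$ (i, j)) (Lp_rep (\<xi> j)) x) \<in> Lp_functions r M"
      using T(2) that Lp_rep(1)[OF \<xi>] r by (intro Lp_functions_sum) (rule r act_Lp; simp)+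
    have "Lp_mat_apply r M T \<xi> i = Lp_class r M (\<lambda>x. \<Sum>j<n. act r M (T $$ (i, j)) (Lp_rep (\<xi> j)) x)"
      using T(1) Lp_rep(2)[OF \<xi>] by (simp add: Lp_mat_apply_def)
    then show ?thesis using pow_integral_rep_class[OF *] by simp
  qed
  then show ?thesis unfolding lp_norm_Lp_norm[OF r] by simp
qed

lemma Lp_mat_norm_upper:
  assumes r: "0 < r" and T: "T \<in> carrier_mat n n" "\<And>i j. i < n \<Longrightarrow> j < n \<Longrightarrow> T $$ (i, j) \<in> Lp_ops r M"
    and f: "\<And>j. j < n \<Longrightarrow> f j \<in> Lp_functions r M" and f1: "(\<Sum>j<n. pow_integral r M (f j)) \<le> 1"
  shows "(\<Sum>i<n. pow_integral r M (\<lambda>x. \<Sum>j<n. act r M (T $$ (i, j)) (f j) x)) powr (1 / r) \<le> Lp_mat_norm r M T"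
proof -
  let ?A = "{lp_norm r (dim_row T) (\<lambda>i. Lp_norm r M (Lp_mat_apply r M T \<xi> i)) | \<xi>.
            (\<forall>j<dim_col T. \<xi> j \<in> Lp r M) \<and>
            lp_norm r (dim_col T) (\<lambda>j. Lp_norm r M (\<xi> j)) \<le> 1}"
  have "\<exists>C. \<forall>i<n. \<forall>j<n. 0 \<le> C i j \<and>
      (\<forall>f\<in>Lp_functions r M. pow_integral r M (act r M (T $$ (i, j)) f) \<le> C i j * pow_integral r M f)"
    using act_bounded[OF T(2) r] by metis
  then obtain C where C0: "\<And>i j. i < n \<Longrightarrow> j < n \<Longrightarrow> 0 \<le> C i j"
    and C: "\<And>i j f. i < n \<Longrightarrow> j < n \<Longrightarrow> f \<in> Lp_functions r M \<Longrightarrow>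
      pow_integral r M (act r M (T $$ (i, j)) f) \<le> C i j * pow_integral r M f" by auto
  have "bdd_above ?A"
  proof (rule bdd_aboveI)
    fix a assume "a \<in> ?A"
    then obtain \<xi> where \<xi>: "\<And>j. j < n \<Longrightarrow> \<xi> j \<in> Lp r M" "lp_norm r n (\<lambda>j. Lp_norm r M (\<xi> j)) \<le> 1"
      and a: "a = lp_norm r n (\<lambda>i. Lp_norm r M (Lp_mat_apply r M T \<xi> i))" using T(1) by auto
    have sum1: "(\<Sum>j<n. pow_integral r M (Lp_rep (\<xi> j))) \<le> 1"
      using \<xi>(2) r by (simp add: lp_norm_Lp_norm powr_inverse_le_1_iff sum_nonneg)
    have I1: "pow_integral r M (Lp_rep (\<xi> j)) \<le> 1" if "j < n" for j
      using member_le_sum[of j "{..<n}" "\<lambda>j. pow_integral r M (Lp_rep (\<xi> j))"] that sum1 by simp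
    have "a = (\<Sum>i<n. pow_integral r M (\<lambda>x. \<Sum>j<n. act r M (T $$ (i, j)) (Lp_rep (\<xi> j)) x)) powr (1 / r)"
      unfolding a by (rule Lp_norm_mat_apply[OF r T \<xi>(1)])
    also have "\<dots> \<le> (\<Sum>i<n. (2 powr r) ^ n * (\<Sum>j<n. C i j)) powr (1 / r)"
    proof (intro powr_mono2 sum_mono)
      fix i assume "i \<in> {..<n}"
      then have i: "i < n" by simp
      have "pow_integral r M (\<lambda>x. \<Sum>j<n. act r M (T $$ (i, j)) (Lp_rep (\<xi> j)) x) \<le>
        (2 powr r) ^ n * (\<Sum>j<n. pow_integral r M (act r M (T $$ (i, j)) (Lp_rep (\<xi> j))))"
        using T(2) i Lp_rep(1)[OF \<xi>(1)] r by (intro pow_integral_sum_le) (rule r act_Lp; simp)+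
      also have "\<dots> \<le> (2 powr r) ^ n * (\<Sum>j<n. C i j)"
      proof (intro mult_left_mono sum_mono)
        fix j assume "j \<in> {..<n}"
        then have j: "j < n" by simp
        show "pow_integral r M (act r M (T $$ (i, j)) (Lp_rep (\<xi> j))) \<le> C i j"
          using C[OF i j Lp_rep(1)[OF \<xi>(1)[OF j]]] mult_left_mono[OF I1[OF j] C0[OF i j]] by simp
      qed simp
      finally show "pow_integral r M (\<lambda>x. \<Sum>j<n. act r M (T $$ (i, j)) (Lp_rep (\<xi> j)) x) \<le> (2 powr r) ^ n * (\<Sum>j<n. C i j)" .
    qed (use r in \<open>auto intro: sum_nonneg\<close>)
    finally show "a \<le> (\<Sum>i<n. (2 powr r) ^ n * (\<Sum>j<n. C i j)) powr (1 / r)" .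
  qed
  moreover have "(\<Sum>i<n. pow_integral r M (\<lambda>x. \<Sum>j<n. act r M (T $$ (i, j)) (f j) x)) powr (1 / r) \<in> ?A"
  proof -
    define \<xi> where "\<xi> j = Lp_class r M (f j)" for j
    have \<xi>: "\<xi> j \<in> Lp r M" if "j < n" for j unfolding \<xi>_def using f[OF that] by (rule Lp_class_in_Lp)
    have "lp_norm r n (\<lambda>i. Lp_norm r M (Lp_mat_apply r M T \<xi> i)) =
      (\<Sum>i<n. pow_integral r M (\<lambda>x. \<Sum>j<n. act r M (T $$ (i, j)) (Lp_rep (\<xi> j)) x)) powr (1 / r)"
      by (rule Lp_norm_mat_apply[OF r T \<xi>])
    also have "\<dots> = (\<Sum>i<n. pow_integral r M (\<lambda>x. \<Sum>j<n. act r M (T $$ (i, j)) (f j) x)) powr (1 / r)"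
      using Lp_rep(2)[OF \<xi>] by (simp add: \<xi>_def)
    finally have eq: "lp_norm r n (\<lambda>i. Lp_norm r M (Lp_mat_apply r M T \<xi> i)) =
      (\<Sum>i<n. pow_integral r M (\<lambda>x. \<Sum>j<n. act r M (T $$ (i, j)) (f j) x)) powr (1 / r)" .
    have "lp_norm r n (\<lambda>j. Lp_norm r M (\<xi> j)) \<le> 1"
      using f1 f r by (simp add: lp_norm_Lp_norm powr_inverse_le_1_iff sum_nonneg \<xi>_def pow_integral_rep_class)
    then show ?thesis using T(1) \<xi> eq by (intro CollectI exI[of _ \<xi>]) auto
  qed
  ultimately show ?thesis unfolding Lp_mat_norm_def by (intro cSup_upper)
qed

lemma Lp_mat_norm_le_1:
  assumes r: "0 < r" and T: "T \<in> carrier_mat n n" "\<And>i j. i < n \<Longrightarrow> j < n \<Longrightarrow> T $$ (i, j) \<in> Lp_ops r M"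
    and le: "\<And>f. (\<And>j. j < n \<Longrightarrow> f j \<in> Lp_functions r M) \<Longrightarrow> (\<Sum>j<n. pow_integral r M (f j)) \<le> 1 \<Longrightarrow>
      (\<Sum>i<n. pow_integral r M (\<lambda>x. \<Sum>j<n. act r M (T $$ (i, j)) (f j) x)) \<le> 1"
  shows "Lp_mat_norm r M T \<le> 1"
  unfolding Lp_mat_norm_def
proof (rule cSup_least)
  \<comment> \<open>The zero tuple shows that the set under the supremum is nonempty.\<close>
  define \<xi>0 where "\<xi>0 = (\<lambda>j::nat. Lp_class r M (\<lambda>x. 0))"
  have z: "(\<lambda>x. 0) \<in> Lp_functions r M" using r by (rule Lp_functions_zero)
  have "lp_norm r n (\<lambda>j. Lp_norm r M (\<xi>0 j)) \<le> 1"
    using r z by (simp add: lp_norm_Lp_norm \<xi>0_def pow_integral_rep_class) (simp add: pow_integral_def)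
  then show "{lp_norm r (dim_row T) (\<lambda>i. Lp_norm r M (Lp_mat_apply r M T \<xi> i)) |\<xi>.
     (\<forall>j<dim_col T. \<xi> j \<in> Lp r M) \<and> lp_norm r (dim_col T) (\<lambda>j. Lp_norm r M (\<xi> j)) \<le> 1} \<noteq> {}"
    using T(1) Lp_class_in_Lp[OF z] by (auto intro!: exI[of _ \<xi>0] simp: \<xi>0_def)
next
  fix a assume "a \<in> {lp_norm r (dim_row T) (\<lambda>i. Lp_norm r M (Lp_mat_apply r M T \<xi> i)) |\<xi>.
     (\<forall>j<dim_col T. \<xi> j \<in> Lp r M) \<and> lp_norm r (dim_col T) (\<lambda>j. Lp_norm r M (\<xi> j)) \<le> 1}"
  then obtain \<xi> where \<xi>: "\<And>j. j < n \<Longrightarrow> \<xi> j \<in> Lp r M" "lp_norm r n (\<lambda>j. Lp_norm r M (\<xi> j)) \<le> 1"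
    and a: "a = lp_norm r n (\<lambda>i. Lp_norm r M (Lp_mat_apply r M T \<xi> i))" using T(1) by auto
  have "(\<Sum>j<n. pow_integral r M (Lp_rep (\<xi> j))) \<le> 1"
    using \<xi>(2) r by (simp add: lp_norm_Lp_norm powr_inverse_le_1_iff sum_nonneg)
  then have "(\<Sum>i<n. pow_integral r M (\<lambda>x. \<Sum>j<n. act r M (T $$ (i, j)) (Lp_rep (\<xi> j)) x)) \<le> 1"
    by (intro le Lp_rep(1) \<xi>)
  then show "a \<le> 1"
    unfolding a using Lp_norm_mat_apply[OF r T \<xi>(1)] r by (simp add: powr_inverse_le_1_iff sum_nonneg)
qed

section \<open>The pairing of a completely contractive map\<close>

lemma mats_index: "v \<in> mats n m X \<Longrightarrow> i < n \<Longrightarrow> j < m \<Longrightarrow> v $$ (i, j) \<in> X"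
  by (auto simp: mats_def intro: elements_matI)

lemma mats_carrier: "v \<in> mats n m X \<Longrightarrow> v \<in> carrier_mat n m"
  by (simp add: mats_def)

lemma matsI: "v \<in> carrier_mat n m \<Longrightarrow> (\<And>i j. i < n \<Longrightarrow> j < m \<Longrightarrow> v $$ (i, j) \<in> X) \<Longrightarrow> v \<in> mats n m X"
  by (auto simp: mats_def elements_mat_def)

locale cc_map = conj_exp p q + p_operator_space sc p V N
  for p q :: real and sc :: "complex \<Rightarrow> 'a::ab_group_add \<Rightarrow> 'a" and V :: "'a set" and N :: "'a mat \<Rightarrow> real" +
  fixes M :: "'m measure" and \<phi> :: "'a \<Rightarrow> 'm Lp_op"
  assumes cc: "p_completely_contractive sc V N p M \<phi>"
begin

lemma phi_ops: "v \<in> V \<Longrightarrow> \<phi> v \<in> Lp_ops p M"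
  using cc by (simp add: p_completely_contractive_def)

lemma act_phi_add:
  assumes v: "v \<in> V" and w: "w \<in> V" and f: "f \<in> Lp_functions p M"
  shows "AE x in M. act p M (\<phi> (v + w)) f x = act p M (\<phi> v) f x + act p M (\<phi> w) f x"
proof -
  have "\<phi> (v + w) = Lp_op_add p M (\<phi> v) (\<phi> w)"
    using cc v w unfolding p_completely_contractive_def by blast
  then have "\<phi> (v + w) (Lp_class p M f) = Lp_class p M (\<lambda>x. act p M (\<phi> v) f x + act p M (\<phi> w) f x)"
    using Lp_class_in_Lp[OF f] by (simp add: Lp_op_add_def Lp_add_def)
  then show ?thesis
    using Lp_rep_class[OF Lp_functions_add[OF act_Lp[OF phi_ops[OF v] f] act_Lp[OF phi_ops[OF w] f] p0]] by simp
qed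

lemma act_phi_scale:
  assumes v: "v \<in> V" and f: "f \<in> Lp_functions p M"
  shows "AE x in M. act p M (\<phi> (sc c v)) f x = c * act p M (\<phi> v) f x"
proof -
  have "\<phi> (sc c v) = Lp_op_scale p M c (\<phi> v)"
    using cc v unfolding p_completely_contractive_def by blast
  then have "\<phi> (sc c v) (Lp_class p M f) = Lp_class p M (\<lambda>x. c * act p M (\<phi> v) f x)"
    using Lp_class_in_Lp[OF f] by (simp add: Lp_op_scale_def Lp_scale_def)
  then show ?thesis
    using Lp_rep_class[OF Lp_functions_cmult[OF act_Lp[OF phi_ops[OF v] f]]] by simp
qed

definition pair :: "('m \<Rightarrow> complex) \<Rightarrow> 'a \<Rightarrow> ('m \<Rightarrow> complex) \<Rightarrow> complex" where
  "pair g v f = (\<integral>x. act p M (\<phi> v) f x * g x \<partial>M)"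

lemma pair_integrable:
  assumes "g \<in> Lp_functions q M" "v \<in> V" "f \<in> Lp_functions p M"
  shows "integrable M (\<lambda>x. act p M (\<phi> v) f x * g x)"
  using assms by (intro integrable_mult act_Lp phi_ops)

lemma pair_cong:
  assumes "g \<in> Lp_functions q M" "g' \<in> Lp_functions q M" "f \<in> Lp_functions p M" "f' \<in> Lp_functions p M"
    and "AE x in M. g x = g' x" "AE x in M. f x = f' x" "v \<in> V"
  shows "pair g v f = pair g' v f'"
proof -
  have c: "Lp_class p M f = Lp_class p M f'" using assms Lp_class_eq_iff by blast
  show ?thesis unfolding pair_def c
    by (rule integral_cong_AE)
      (use assms pair_integrable in \<open>auto elim!: eventually_mono\<close>)
qed

lemma pair_add_v:
  assumes "g \<in> Lp_functions q M" "f \<in> Lp_functions p M" "v \<in> V" "w \<in> V"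
  shows "pair g (v + w) f = pair g v f + pair g w f"
proof -
  have "pair g (v + w) f = (\<integral>x. act p M (\<phi> v) f x * g x + act p M (\<phi> w) f x * g x \<partial>M)"
    unfolding pair_def
  proof (rule integral_cong_AE)
    show "AE x in M. act p M (\<phi> (v + w)) f x * g x = act p M (\<phi> v) f x * g x + act p M (\<phi> w) f x * g x"
      using act_phi_add[OF assms(3,4,2)] by eventually_elim (simp add: distrib_right)
  qed (use assms pair_integrable subspace_add[OF subspace_carrier] in \<open>auto intro!: borel_measurable_add\<close>)
  then show ?thesis using assms pair_integrable by (simp add: pair_def)
qed

lemma pair_scale_v:
  assumes "g \<in> Lp_functions q M" "f \<in> Lp_functions p M" "v \<in> V"
  shows "pair g (sc c v) f = c * pair g v f"
proof -
  have "pair g (sc c v) f = (\<integral>x. c * (act p M (\<phi> v) f x * g x) \<partial>M)"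
    unfolding pair_def
  proof (rule integral_cong_AE)
    show "AE x in M. act p M (\<phi> (sc c v)) f x * g x = c * (act p M (\<phi> v) f x * g x)"
      using act_phi_scale[OF assms(3,2), of c] by eventually_elim (simp add: mult.assoc)
  qed (use assms pair_integrable subspace_scale[OF subspace_carrier] in \<open>auto intro!: borel_measurable_times\<close>)
  then show ?thesis by (simp add: pair_def)
qed

lemma pair_sum_v:
  assumes "g \<in> Lp_functions q M" "f \<in> Lp_functions p M" "\<And>i. i \<in> I \<Longrightarrow> v i \<in> V"
  shows "pair g (\<Sum>i\<in>I. sc (c i) (v i)) f = (\<Sum>i\<in>I. c i * pair g (v i) f)"
proof -
  have z: "pair g 0 f = 0"
    using pair_scale_v[OF assms(1,2) subspace_0[OF subspace_carrier], of 0] by simp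
  show ?thesis
    using assms(3)
  proof (induction I rule: infinite_finite_induct)
    case (insert i I)
    then show ?case
      by (simp add: pair_add_v[OF assms(1,2)] pair_scale_v[OF assms(1,2)] subspace_scale[OF subspace_carrier]
          subspace_sum[OF subspace_carrier])
  qed (simp_all add: z)
qed

lemma pair_sum_g:
  assumes "\<And>i. i \<in> I \<Longrightarrow> g i \<in> Lp_functions q M" "f \<in> Lp_functions p M" "v \<in> V"
  shows "pair (\<lambda>x. \<Sum>i\<in>I. c i * g i x) v f = (\<Sum>i\<in>I. c i * pair (g i) v f)"
proof -
  have "pair (\<lambda>x. \<Sum>i\<in>I. c i * g i x) v f = (\<integral>x. (\<Sum>i\<in>I. c i * (act p M (\<phi> v) f x * g i x)) \<partial>M)"
    by (simp add: pair_def sum_distrib_left mult.left_commute)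
  also have "\<dots> = (\<Sum>i\<in>I. \<integral>x. c i * (act p M (\<phi> v) f x * g i x) \<partial>M)"
    using assms by (intro Bochner_Integration.integral_sum integrable_mult_right pair_integrable)
  finally show ?thesis by (simp add: pair_def)
qed

lemma pair_sum_f:
  assumes g: "g \<in> Lp_functions q M" and v: "v \<in> V" and "\<And>i. i \<in> I \<Longrightarrow> f i \<in> Lp_functions p M"
  shows "pair g v (\<lambda>x. \<Sum>i\<in>I. c i * f i x) = (\<Sum>i\<in>I. c i * pair g v (f i))"
proof -
  have scale: "pair g v (\<lambda>x. c * f x) = c * pair g v f" if f: "f \<in> Lp_functions p M" for c f
  proof -
    have "pair g v (\<lambda>x. c * f x) = (\<integral>x. c * (act p M (\<phi> v) f x * g x) \<partial>M)"
      unfolding pair_def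
    proof (rule integral_cong_AE)
      show "AE x in M. act p M (\<phi> v) (\<lambda>x. c * f x) x * g x = c * (act p M (\<phi> v) f x * g x)"
        using act_scale[OF phi_ops[OF v] f, of c] by eventually_elim (simp add: mult.assoc)
    qed (use pair_integrable[OF g v] f Lp_functions_cmult[OF f, of c] in \<open>auto intro!: borel_measurable_times\<close>)
    then show ?thesis by (simp add: pair_def)
  qed
  have add: "pair g v (\<lambda>x. f x + h x) = pair g v f + pair g v h"
    if f: "f \<in> Lp_functions p M" and h: "h \<in> Lp_functions p M" for f h
  proof -
    have "pair g v (\<lambda>x. f x + h x) = (\<integral>x. act p M (\<phi> v) f x * g x + act p M (\<phi> v) h x * g x \<partial>M)"
      unfolding pair_def
    proof (rule integral_cong_AE)
      show "AE x in M. act p M (\<phi> v) (\<lambda>x. f x + h x) x * g x = act p M (\<phi> v) f x * g x + act p M (\<phi> v) h x * g x"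
        using act_add[OF phi_ops[OF v] f h p0] by eventually_elim (simp add: distrib_right)
    qed (use pair_integrable[OF g v] f h Lp_functions_add[OF f h p0] in \<open>auto intro!: borel_measurable_add\<close>)
    then show ?thesis using pair_integrable[OF g v] f h by (simp add: pair_def)
  qed
  show ?thesis
    using assms(3)
  proof (induction I rule: infinite_finite_induct)
    case (insert i I)
    then have "(\<lambda>x. \<Sum>i\<in>I. c i * f i x) \<in> Lp_functions p M"
      using p0 by (intro Lp_functions_sum Lp_functions_cmult) auto
    with insert show ?case by (simp add: add scale Lp_functions_cmult)
  next
    case empty
    then show ?case using scale[OF Lp_functions_zero[OF p0], of 0] by simp
  next
    case (infinite I)
    then show ?case using scale[OF Lp_functions_zero[OF p0], of 0] by simp
  qed
qed

lemma pair_scale_g: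
  assumes "g \<in> Lp_functions q M" "v \<in> V" "f \<in> Lp_functions p M"
  shows "pair (\<lambda>x. c * g x) v f = c * pair g v f"
  using pair_sum_g[where I = "{0::nat}" and g = "\<lambda>_. g" and c = "\<lambda>_. c"] assms by simp

lemma pair_scale_f:
  assumes "g \<in> Lp_functions q M" "v \<in> V" "f \<in> Lp_functions p M"
  shows "pair g v (\<lambda>x. c * f x) = c * pair g v f"
  using pair_sum_f[where I = "{0::nat}" and f = "\<lambda>_. f" and c = "\<lambda>_. c"] assms by simp

lemma phi_contraction:
  assumes n: "1 \<le> n" and v: "v \<in> mats n n V" "N v \<le> 1"
    and f: "\<And>j. j < n \<Longrightarrow> f j \<in> Lp_functions p M" and f1: "(\<Sum>j<n. pow_integral p M (f j)) \<le> 1"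
  shows "(\<Sum>i<n. pow_integral p M (\<lambda>x. \<Sum>j<n. act p M (\<phi> (v $$ (i, j))) (f j) x)) \<le> 1"
proof -
  have cb: "cb_norm V N (Lp_mat_norm p M) \<phi> \<le> 1" using cc by (simp add: p_completely_contractive_def)
  have "ereal (Lp_mat_norm p M (map_mat \<phi> v)) \<le> cb_norm V N (Lp_mat_norm p M) \<phi>"
    unfolding cb_norm_def using n v by (intro SUP_upper2[of n] SUP_upper2[of v]) auto
  then have le1: "Lp_mat_norm p M (map_mat \<phi> v) \<le> 1"
    using cb order_trans by fastforce
  note vc = mats_carrier[OF v(1)] and vV = mats_index[OF v(1)]
  have "(\<Sum>i<n. pow_integral p M (\<lambda>x. \<Sum>j<n. act p M (map_mat \<phi> v $$ (i, j)) (f j) x)) powr (1 / p)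
      \<le> Lp_mat_norm p M (map_mat \<phi> v)"
    using vc vV phi_ops by (intro Lp_mat_norm_upper[OF p0 _ _ f f1]) auto
  then have "(\<Sum>i<n. pow_integral p M (\<lambda>x. \<Sum>j<n. act p M (map_mat \<phi> v $$ (i, j)) (f j) x)) \<le> 1"
    using le1 p0 by (subst powr_inverse_le_1_iff[symmetric, OF _ p0]) (auto intro: sum_nonneg)
  moreover have "(\<Sum>j<n. act p M (map_mat \<phi> v $$ (i, j)) (f j) x) = (\<Sum>j<n. act p M (\<phi> (v $$ (i, j))) (f j) x)"
    if "i < n" for i x using vc that by (intro sum.cong) auto
  ultimately show ?thesis by simp
qed

text \<open>Applying the matrix of operators to the column \<open>f\<close> and pairing the result
  with \<open>g\<close> by Hoelder gives \<open>unit\<close>; \<open>step\<close> frees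
  \<open>f\<close> from the unit ball, and the last part frees \<open>v\<close>. Dividing by
  \<open>N v + e\<close> covers matrices of norm 0.\<close>

lemma pair_bound:
  assumes n: "1 \<le> n" and v: "v \<in> mats n n V"
    and g: "\<And>k. k < n \<Longrightarrow> g k \<in> Lp_functions q M" and f: "\<And>l. l < n \<Longrightarrow> f l \<in> Lp_functions p M"
  shows "cmod (\<Sum>k<n. \<Sum>l<n. pair (g k) (v $$ (k, l)) (f l)) \<le>
    (\<Sum>k<n. pow_integral q M (g k)) powr (1 / q) * N v * (\<Sum>l<n. pow_integral p M (f l)) powr (1 / p)"
proof -
  define G where "G = (\<Sum>k<n. pow_integral q M (g k)) powr (1 / q)"
  have unit: "cmod (\<Sum>k<n. \<Sum>l<n. pair (g k) (v $$ (k, l)) (f l)) \<le> G"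
    if v: "v \<in> mats n n V" "N v \<le> 1"
      and f: "\<And>l. l < n \<Longrightarrow> f l \<in> Lp_functions p M" "(\<Sum>l<n. pow_integral p M (f l)) \<le> 1" for v f
  proof -
    have vV: "\<And>i j. i < n \<Longrightarrow> j < n \<Longrightarrow> v $$ (i, j) \<in> V"
      using mats_index[OF v(1)] .
    define h where "h k x = (\<Sum>l<n. act p M (\<phi> (v $$ (k, l))) (f l) x)" for k x
    have h: "h k \<in> Lp_functions p M" if "k < n" for k
      unfolding h_def using that vV f(1) by (intro Lp_functions_sum[OF p0] act_Lp phi_ops) auto
    have "(\<Sum>l<n. pair (g k) (v $$ (k, l)) (f l)) = (\<integral>x. g k x * h k x \<partial>M)" if k: "k < n" for k
    proof -
      have "(\<integral>x. g k x * h k x \<partial>M) = (\<integral>x. (\<Sum>l<n. act p M (\<phi> (v $$ (k, l))) (f l) x * g k x) \<partial>M)"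
        by (simp add: h_def sum_distrib_left mult.commute)
      also have "\<dots> = (\<Sum>l<n. pair (g k) (v $$ (k, l)) (f l))"
        unfolding pair_def using k g f(1) vV by (intro Bochner_Integration.integral_sum pair_integrable) auto
      finally show ?thesis by simp
    qed
    then have "(\<Sum>k<n. \<Sum>l<n. pair (g k) (v $$ (k, l)) (f l)) = (\<Sum>k<n. \<integral>x. g k x * h k x \<partial>M)" by simp
    also have "cmod \<dots> \<le> G * (\<Sum>k<n. pow_integral p M (h k)) powr (1 / p)"
      unfolding G_def by (rule Hoelder_sum[OF g h])
    also have "\<dots> \<le> G * 1"
      using phi_contraction[OF n v f] p0
      by (intro mult_left_mono) (auto simp: powr_inverse_le_1_iff sum_nonneg h_def[abs_def] G_def)
    finally show ?thesis by simp
  qed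
  define F where "F = (\<Sum>l<n. pow_integral p M (f l)) powr (1 / p)"
  have step: "cmod (\<Sum>k<n. \<Sum>l<n. pair (g k) (v $$ (k, l)) (f l)) \<le> G * F"
    if v: "v \<in> mats n n V" "N v \<le> 1" for v
    unfolding F_def
  proof (rule homogeneous_bound[where \<Phi> = "\<lambda>f. \<Sum>k<n. \<Sum>l<n. pair (g k) (v $$ (k, l)) (f l)", OF p0])
    fix c
    have "pair (g k) (v $$ (k, l)) (\<lambda>x. c * f l x) = c * pair (g k) (v $$ (k, l)) (f l)"
      if "k < n" "l < n" for k l
      using that by (intro pair_scale_f g f mats_index[OF v(1)])
    then show "(\<Sum>k<n. \<Sum>l<n. pair (g k) (v $$ (k, l)) (\<lambda>x. c * f l x)) =
        c * (\<Sum>k<n. \<Sum>l<n. pair (g k) (v $$ (k, l)) (f l))"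
      by (simp add: sum_distrib_left)
    assume "(\<Sum>l<n. pow_integral p M (\<lambda>x. c * f l x)) \<le> 1"
    then show "cmod (\<Sum>k<n. \<Sum>l<n. pair (g k) (v $$ (k, l)) (\<lambda>x. c * f l x)) \<le> G"
      by (intro unit v Lp_functions_cmult f)
  qed
  have "cmod (\<Sum>k<n. \<Sum>l<n. pair (g k) (v $$ (k, l)) (f l)) \<le> G * F * N v powr 1"
  proof (rule le_powr_limit)
    fix e :: real assume e: "0 < e"
    define t where "t = N v + e"
    have t: "0 < t" "N v \<le> t" using norm_nonneg[OF n v] e by (simp_all add: t_def)
    define v' where "v' = mat_scale sc (of_real (1 / t)) v"
    have v': "v' \<in> mats n n V"
      using mats_carrier[OF v] mats_index[OF v]
      by (intro matsI) (auto simp: v'_def mat_scale_def subspace_scale[OF subspace_carrier])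
    have "N v' = N v / t"
      unfolding v'_def norm_scale[OF n v] using t by (simp add: norm_divide)
    then have v'1: "N v' \<le> 1" using t by simp
    have "pair (g k) (v' $$ (k, l)) (f l) = of_real (1 / t) * pair (g k) (v $$ (k, l)) (f l)"
      if "k < n" "l < n" for k l
      using that mats_carrier[OF v] pair_scale_v[OF g f mats_index[OF v]]
      by (simp add: v'_def mat_scale_def)
    then have "(\<Sum>k<n. \<Sum>l<n. pair (g k) (v' $$ (k, l)) (f l)) =
        of_real (1 / t) * (\<Sum>k<n. \<Sum>l<n. pair (g k) (v $$ (k, l)) (f l))"
      by (simp add: sum_distrib_left)
    with step[OF v' v'1] have "cmod (of_real (1 / t) * (\<Sum>k<n. \<Sum>l<n. pair (g k) (v $$ (k, l)) (f l))) \<le> G * F"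
      by simp
    then show "cmod (\<Sum>k<n. \<Sum>l<n. pair (g k) (v $$ (k, l)) (f l)) \<le> G * F * (N v + e) powr 1"
      unfolding t_def[symmetric] using t by (simp add: norm_mult norm_divide field_simps)
  qed (use norm_nonneg[OF n v] in auto)
  then show ?thesis using norm_nonneg[OF n v] by (simp add: G_def F_def mult_ac)
qed

end

section \<open>Step functions on a finite partition\<close>

lemma sum_indicator_disjoint:
  fixes d :: "nat \<Rightarrow> complex"
  assumes "disjoint_family_on A {..<n}" and "0 < r"
  shows "cmod (\<Sum>i<n. d i * indicator (A i) x) powr r = (\<Sum>i<n. cmod (d i) powr r * indicator (A i) x)"
proof (cases "\<exists>i<n. x \<in> A i")
  case True
  then obtain i where i: "i < n" "x \<in> A i" by blast
  have ni: "x \<notin> A j" if "j < n" "j \<noteq> i" for j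
    using assms(1) i that by (auto simp: disjoint_family_on_def)
  have "(\<Sum>j<n. d j * indicator (A j) x) = d i"
    using i ni by (subst sum.remove[of _ i]) (auto intro!: sum.neutral)
  moreover have "(\<Sum>j<n. cmod (d j) powr r * indicator (A j) x) = cmod (d i) powr r"
    using i ni by (subst sum.remove[of _ i]) (auto intro!: sum.neutral)
  ultimately show ?thesis by simp
next
  case False
  then show ?thesis using assms(2) by (simp add: indicator_def)
qed

lemma pow_integral_step:
  fixes d :: "nat \<Rightarrow> complex"
  assumes "disjoint_family_on A {..<n}" and "0 < r"
    and A: "\<And>i. i < n \<Longrightarrow> A i \<in> sets M" "\<And>i. i < n \<Longrightarrow> emeasure M (A i) \<noteq> \<infinity>"
  shows "pow_integral r M (\<lambda>x. \<Sum>i<n. d i * indicator (A i) x) = (\<Sum>i<n. cmod (d i) powr r * measure M (A i))"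
proof -
  have "pow_integral r M (\<lambda>x. \<Sum>i<n. d i * indicator (A i) x) = (\<integral>x. (\<Sum>i<n. cmod (d i) powr r * indicator (A i) x) \<partial>M)"
    unfolding pow_integral_def sum_indicator_disjoint[OF assms(1,2)] ..
  also have "\<dots> = (\<Sum>i<n. \<integral>x. cmod (d i) powr r * indicator (A i) x \<partial>M)"
    using A by (intro Bochner_Integration.integral_sum integrable_mult_right integrable_real_indicator)
      (auto simp: less_top)
  also have "\<dots> = (\<Sum>i<n. cmod (d i) powr r * measure M (A i))"
    using A sets.sets_into_space by (intro sum.cong) (auto simp: Int_absorb2)
  finally show ?thesis .
qed

text \<open>The cells are the fibres of the joint value map \<open>\<Phi>\<close> over its values
  that are not identically 0. Each cell lies in the support of some member of \<open>F\<close>,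
  hence has finite measure. The coefficients are the values at a sample point \<open>y i\<close> of
  the cell, so the same points serve all members of \<open>F\<close>.\<close>

lemma simple_fns_common_partition:
  assumes fin: "finite F" and F: "F \<subseteq> simple_fns M"
  shows "\<exists>(n::nat) A y. 1 \<le> n \<and> (\<forall>i<n. A i \<in> sets M \<and> emeasure M (A i) \<noteq> \<infinity>) \<and>
    disjoint_family_on A {..<n} \<and> (\<forall>f\<in>F. f = (\<lambda>x. \<Sum>i<n. f (y i) * indicator (A i) x))"
proof -
  define \<Phi> where "\<Phi> x = (\<lambda>f. if f \<in> F then f x else 0)" for x
  define Z where "Z = \<Phi> ` {x \<in> space M. \<exists>f\<in>F. f x \<noteq> 0}"
  have "Z \<subseteq> (\<lambda>h f. if f \<in> F then h f else 0) ` (Pi\<^sub>E F (\<lambda>f. f ` space M))"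
  proof
    fix z assume "z \<in> Z"
    then obtain x where x: "x \<in> space M" "z = \<Phi> x" by (auto simp: Z_def)
    then show "z \<in> (\<lambda>h f. if f \<in> F then h f else 0) ` (Pi\<^sub>E F (\<lambda>f. f ` space M))"
      by (intro image_eqI[of _ _ "\<lambda>f\<in>F. f x"]) (auto simp: \<Phi>_def)
  qed
  moreover have "finite (Pi\<^sub>E F (\<lambda>f. f ` space M))"
    using fin F simple_fnsD(1) simple_functionD(1) by (intro finite_PiE) blast+
  ultimately have finZ: "finite Z" using finite_surj by blast
  define m where "m = card Z"
  obtain h where h: "bij_betw h {..<m} Z"
    using ex_bij_betw_nat_finite[OF finZ] by (auto simp: m_def atLeast0LessThan)
  \<comment> \<open>Index \<open>m\<close> receives an empty cell: the number \<open>Suc m\<close>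
    of cells is then positive even if all functions vanish. The sample point there is arbitrary, but
    its values are multiplied by 0.\<close>
  define A where "A i = (if i < m then {x \<in> space M. \<forall>f\<in>F. f x = h i f} else {})" for i
  define y where "y i = (SOME x. x \<in> A i)" for i
  have hZ: "h i \<in> Z" if "i < m" for i using h that by (auto simp: bij_betw_def)
  have hy: "f (y i) = h i f" if i: "i < m" and f: "f \<in> F" for i f
  proof -
    obtain x where x: "x \<in> space M" "h i = \<Phi> x" using hZ[OF i] by (auto simp: Z_def)
    then have "x \<in> A i" using i by (simp add: A_def \<Phi>_def)
    then have "y i \<in> A i" unfolding y_def by (rule someI[of "\<lambda>x. x \<in> A i"])
    then show ?thesis using i f by (simp add: A_def)
  qed
  have meas: "A i \<in> sets M" for i
  proof -
    have "{x \<in> space M. \<forall>f\<in>F. f x = h i f} \<in> sets M"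
    proof (rule sets.sets_Collect_finite_All[OF _ fin])
      fix f assume "f \<in> F"
      then have "simple_function M f" using F simple_fnsD(1) by blast
      then show "{x \<in> space M. f x = h i f} \<in> sets M"
        using simple_functionD(2)[of M f "{h i f}"] by (simp add: vimage_def Int_def conj_commute)
    qed
    then show ?thesis by (simp add: A_def)
  qed
  have finA: "emeasure M (A i) \<noteq> \<infinity>" for i
  proof (cases "i < m")
    case True
    then obtain x f where x: "h i = \<Phi> x" "f \<in> F" "f x \<noteq> 0" using hZ[OF True] by (auto simp: Z_def)
    then have f: "f \<in> simple_fns M" using F by blast
    have "emeasure M (A i) \<le> emeasure M {x \<in> space M. f x \<noteq> 0}"
    proof (rule emeasure_mono)
      show "A i \<subseteq> {x \<in> space M. f x \<noteq> 0}" using x by (auto simp: A_def \<Phi>_def)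
      show "{x \<in> space M. f x \<noteq> 0} \<in> sets M"
        using simple_fnsD(4)[OF f] by measurable
    qed
    then show ?thesis using simple_fnsD(2)[OF f] by (auto simp: top_unique)
  qed (simp add: A_def)
  have disj: "disjoint_family_on A {..<Suc m}"
    unfolding disjoint_family_on_def
  proof (intro ballI impI)
    fix i j assume ij: "i \<in> {..<Suc m}" "j \<in> {..<Suc m}" "i \<noteq> j"
    show "A i \<inter> A j = {}"
    proof (rule ccontr)
      assume "A i \<inter> A j \<noteq> {}"
      then obtain x where x: "x \<in> A i" "x \<in> A j" by blast
      then have lt: "i < m" "j < m" by (auto simp: A_def split: if_splits)
      have "h i f = h j f" for f
      proof (cases "f \<in> F")
        case True
        then show ?thesis using x lt by (simp add: A_def)
      next
        case False
        then show ?thesis using hZ[OF lt(1)] hZ[OF lt(2)] by (auto simp: Z_def \<Phi>_def)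
      qed
      then have "h i = h j" by blast
      then show False using h lt ij by (auto simp: bij_betw_def inj_on_def)
    qed
  qed
  have rep: "f x = (\<Sum>i<Suc m. f (y i) * indicator (A i) x)" if f: "f \<in> F" for f x
  proof (cases "x \<in> space M \<and> (\<exists>f\<in>F. f x \<noteq> 0)")
    case True
    then have "\<Phi> x \<in> Z" by (auto simp: Z_def)
    then obtain i where i: "i < m" "h i = \<Phi> x" using h by (auto simp: bij_betw_def)
    have xi: "x \<in> A i" using i True by (simp add: A_def \<Phi>_def)
    have "x \<notin> A j" if "j < Suc m" "j \<noteq> i" for j
      using disjoint_family_onD[OF disj, of j i] xi that i by auto
    then have "(\<Sum>i<Suc m. f (y i) * indicator (A i) x) = f (y i)"
      using i xi by (subst sum.remove[of _ i]) (auto intro!: sum.neutral)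
    then show ?thesis using hy[OF i(1) f] i f by (simp add: \<Phi>_def)
  next
    case False
    have "f x = 0"
    proof (cases "x \<in> space M")
      case True
      then show ?thesis using False f by blast
    next
      case notin: False
      have "f \<in> simple_fns M" using F f by blast
      then show ?thesis by (rule simple_fnsD(3)[OF _ notin])
    qed
    have "f (y i) * indicator (A i) x = 0" if "i < Suc m" for i
    proof (cases "x \<in> A i")
      case True
      then have "i < m" by (simp add: A_def split: if_splits)
      then have "f x = f (y i)" using True hy f by (simp add: A_def)
      then show ?thesis using \<open>f x = 0\<close> by simp
    qed simp
    then have "(\<Sum>i<Suc m. f (y i) * indicator (A i) x) = 0" by (intro sum.neutral) auto
    then show ?thesis using \<open>f x = 0\<close> by simp
  qed
  show ?thesis
    using meas finA disj rep by (intro exI[of _ "Suc m"] exI[of _ A] exI[of _ y]) (auto simp: fun_eq_iff)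
qed

section \<open>The trace norms and the extension of the pairing\<close>

lemma entry_norm_nonneg: "0 \<le> entry_norm r \<alpha>"
  by (simp add: entry_norm_def)

lemma entry_norm_carrier:
  assumes "\<alpha> \<in> carrier_mat n m"
  shows "entry_norm r \<alpha> = (\<Sum>i<n. \<Sum>j<m. cmod (\<alpha> $$ (i, j)) powr r) powr (1 / r)"
  using assms by (simp add: entry_norm_def)

lemma sum_swap_pairs:
  "(\<Sum>i\<in>A. \<Sum>j\<in>B. \<Sum>k\<in>C. \<Sum>l\<in>D. t i j k l) = (\<Sum>k\<in>C. \<Sum>l\<in>D. \<Sum>i\<in>A. \<Sum>j\<in>B. t i j k l)"
proof -
  have "(\<Sum>i\<in>A. \<Sum>j\<in>B. \<Sum>k\<in>C. \<Sum>l\<in>D. t i j k l) = (\<Sum>i\<in>A. \<Sum>k\<in>C. \<Sum>j\<in>B. \<Sum>l\<in>D. t i j k l)"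
    by (intro sum.cong refl sum.swap)
  also have "\<dots> = (\<Sum>k\<in>C. \<Sum>i\<in>A. \<Sum>j\<in>B. \<Sum>l\<in>D. t i j k l)" by (rule sum.swap)
  also have "\<dots> = (\<Sum>k\<in>C. \<Sum>i\<in>A. \<Sum>l\<in>D. \<Sum>j\<in>B. t i j k l)" by (intro sum.cong refl sum.swap)
  also have "\<dots> = (\<Sum>k\<in>C. \<Sum>l\<in>D. \<Sum>i\<in>A. \<Sum>j\<in>B. t i j k l)" by (intro sum.cong refl sum.swap)
  finally show ?thesis .
qed

context p_operator_space
begin

lemma T_norm_le:
  assumes "1 \<le> r" "\<alpha> \<in> carrier_mat n r" "\<beta> \<in> carrier_mat r n" "w \<in> mats r r X"
  shows "T_norm p q sc X N (mat_sandwich sc \<alpha> w \<beta>) \<le> entry_norm q \<alpha> * N w * entry_norm p \<beta>"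
  unfolding T_norm_def
proof (rule cInf_lower)
  show "entry_norm q \<alpha> * N w * entry_norm p \<beta> \<in> {entry_norm q \<alpha>' * N x * entry_norm p \<beta>' | r \<alpha>' x \<beta>'.
    r \<ge> 1 \<and> \<alpha>' \<in> carrier_mat (dim_row (mat_sandwich sc \<alpha> w \<beta>)) r \<and>
    \<beta>' \<in> carrier_mat r (dim_row (mat_sandwich sc \<alpha> w \<beta>)) \<and>
    x \<in> mats r r X \<and> mat_sandwich sc \<alpha> w \<beta> = mat_sandwich sc \<alpha>' x \<beta>'}" (is "_ \<in> ?A")
    using assms
    by (intro CollectI exI[of _ r] exI[of _ \<alpha>] exI[of _ w] exI[of _ \<beta>]) (auto simp: mat_sandwich_def)
  show "bdd_below ?A"
    by (rule bdd_belowI[of _ 0]) (clarify, intro mult_nonneg_nonneg entry_norm_nonneg, erule (1) norm_nonneg)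
qed

text \<open>Every vector is a positive multiple of one in the unit ball, and therefore every
  elementary tensor has finite gauge. Adding 1 to the norm keeps \<open>t\<close> positive for
  \<open>w = 0\<close>.\<close>

lemma ex_matrix_unit:
  assumes w: "w \<in> X"
  shows "\<exists>t>0. mat 1 1 (\<lambda>_. sc (of_real (1 / t)) w) \<in> mats 1 1 X \<and>
    N (mat 1 1 (\<lambda>_. sc (of_real (1 / t)) w)) \<le> 1"
proof -
  define w1 where "w1 = mat 1 1 (\<lambda>_. w)"
  have w1: "w1 \<in> mats 1 1 X" using w by (intro matsI) (auto simp: w1_def)
  define t where "t = N w1 + 1"
  have t: "0 < t" "N w1 \<le> t" using norm_nonneg[OF _ w1] by (auto simp: t_def)
  have "mat_scale sc (of_real (1 / t)) w1 = mat 1 1 (\<lambda>_. sc (of_real (1 / t)) w)"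
    by (rule eq_matI) (auto simp: w1_def mat_scale_def)
  then have "N (mat 1 1 (\<lambda>_. sc (of_real (1 / t)) w)) \<le> 1"
    using norm_scale[OF _ w1, of "of_real (1 / t)"] t by (simp add: norm_divide)
  moreover have "mat 1 1 (\<lambda>_. sc (of_real (1 / t)) w) \<in> mats 1 1 X"
    using w subspace_scale[OF subspace_carrier] by (intro matsI) auto
  ultimately show ?thesis using t by blast
qed

lemma T_norm_lessD:
  assumes n: "1 \<le> n" and v: "v \<in> mats n n X" and less: "T_norm p q sc X N v < t"
  shows "\<exists>r \<alpha> w \<beta>. 1 \<le> r \<and> \<alpha> \<in> carrier_mat n r \<and> \<beta> \<in> carrier_mat r n \<and> w \<in> mats r r X \<and>
    v = mat_sandwich sc \<alpha> w \<beta> \<and> entry_norm q \<alpha> * N w * entry_norm p \<beta> < t"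
proof -
  have dim: "dim_row v = n" "dim_col v = n" using mats_carrier[OF v] by auto
  let ?A = "{entry_norm q \<alpha> * N w * entry_norm p \<beta> | r \<alpha> w \<beta>.
    r \<ge> 1 \<and> \<alpha> \<in> carrier_mat (dim_row v) r \<and> \<beta> \<in> carrier_mat r (dim_row v) \<and>
    w \<in> mats r r X \<and> v = mat_sandwich sc \<alpha> w \<beta>}"
  \<comment> \<open>The trivial factorisation makes the set under the infimum nonempty; otherwise a
    bound on its \<open>Inf\<close> would yield no factorisation.\<close>
  have "v = mat_sandwich sc (1\<^sub>m n) v (1\<^sub>m n)"
  proof (rule eq_matI)
    fix i j assume "i < dim_row (mat_sandwich sc (1\<^sub>m n) v (1\<^sub>m n))" "j < dim_col (mat_sandwich sc (1\<^sub>m n) v (1\<^sub>m n))"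
    then have ij: "i < n" "j < n" by (auto simp: mat_sandwich_def)
    have "(\<Sum>k<n. \<Sum>l<n. sc (1\<^sub>m n $$ (i, k) * 1\<^sub>m n $$ (l, j)) (v $$ (k, l))) =
      (\<Sum>k<n. \<Sum>l<n. if l = j then (if k = i then v $$ (k, l) else 0) else 0)"
      using ij by (intro sum.cong refl) auto
    also have "\<dots> = v $$ (i, j)" using ij by simp
    finally show "v $$ (i, j) = mat_sandwich sc (1\<^sub>m n) v (1\<^sub>m n) $$ (i, j)"
      using ij dim by (simp add: mat_sandwich_def)
  qed (auto simp: mat_sandwich_def dim)
  then have "entry_norm q (1\<^sub>m n) * N v * entry_norm p (1\<^sub>m n) \<in> ?A"
    using n v dim by (intro CollectI exI[of _ n] exI[of _ "1\<^sub>m n"] exI[of _ v]) auto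
  then have "?A \<noteq> {}" by blast
  moreover have "Inf ?A < t" using less by (simp add: T_norm_def)
  ultimately obtain x where "x \<in> ?A" "x < t" by (rule cInf_lessD[THEN bexE]) 
  then show ?thesis unfolding dim by blast
qed

end

context cc_map
begin

text \<open>This is where the equality of the norms of \<open>T\<^sub>n\<close> enters. On a common
  partition with cell measures \<open>\<mu> i\<close>, the tensor has a value \<open>u i j\<close>
  on each product of cells and is encoded as the matrix with entries
  \<open>\<mu> i powr (1/q) * \<mu> j powr (1/p)\<close> times \<open>u i j\<close>. With these
  weights the entry norms of the coefficient matrices are the L_q and L_p norms of the tuples
  \<open>a\<close> and \<open>b\<close>, so the representation over \<open>W\<close> gives a trace
  norm of at most s^(1/q) s^(1/p) = s. The same bound over \<open>V\<close> supplies a factorisation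
  through a matrix over \<open>V\<close>, which is turned back into functions and estimated by
  \<open>pair_bound\<close>.\<close>

lemma tensor_bound:
  fixes n0 r :: nat
  assumes W: "p_operator_space sc p W N" and VW: "V \<subseteq> W"
    and T_eq: "\<forall>n\<ge>1. \<forall>v\<in>mats n n V. T_norm p q sc V N v = T_norm p q sc W N v"
    and \<alpha>: "\<And>m. m < n0 \<Longrightarrow> \<alpha> m \<in> simple_fns M" and \<beta>: "\<And>m. m < n0 \<Longrightarrow> \<beta> m \<in> simple_fns M"
    and v: "\<And>m. m < n0 \<Longrightarrow> v m \<in> V"
    and r: "1 \<le> r" and a: "\<And>k. k < r \<Longrightarrow> a k \<in> simple_fns M" and b: "\<And>k. k < r \<Longrightarrow> b k \<in> simple_fns M"
    and w: "w \<in> mats r r W" "N w \<le> 1"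
    and as: "(\<Sum>k<r. pow_integral q M (a k)) \<le> s" and bs: "(\<Sum>k<r. pow_integral p M (b k)) \<le> s"
    and eq: "\<And>x y. (\<Sum>m<n0. sc (\<alpha> m x * \<beta> m y) (v m)) = (\<Sum>k<r. \<Sum>l<r. sc (a k x * b l y) (w $$ (k, l)))"
  shows "cmod (\<Sum>m<n0. pair (\<alpha> m) (v m) (\<beta> m)) \<le> s"
proof -
  interpret W: p_operator_space sc p W N by fact
  let ?F = "\<alpha> ` {..<n0} \<union> \<beta> ` {..<n0} \<union> a ` {..<r} \<union> b ` {..<r}"
  have "\<exists>(n::nat) A y. 1 \<le> n \<and> (\<forall>i<n. A i \<in> sets M \<and> emeasure M (A i) \<noteq> \<infinity>) \<and>
    disjoint_family_on A {..<n} \<and> (\<forall>f\<in>?F. f = (\<lambda>x. \<Sum>i<n. f (y i) * indicator (A i) x))"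
    using \<alpha> \<beta> a b by (intro simple_fns_common_partition) auto
  then obtain n :: nat and A y where *: "1 \<le> n \<and> (\<forall>i<n. A i \<in> sets M \<and> emeasure M (A i) \<noteq> \<infinity>) \<and>
    disjoint_family_on A {..<n} \<and> (\<forall>f\<in>?F. f = (\<lambda>x. \<Sum>i<n. f (y i) * indicator (A i) x))"
    by (elim exE)
  then have n: "1 \<le> n" and A: "\<And>i. i < n \<Longrightarrow> A i \<in> sets M" "\<And>i. i < n \<Longrightarrow> emeasure M (A i) \<noteq> \<infinity>"
    and disj: "disjoint_family_on A {..<n}" by simp_all
  have rep: "f = (\<lambda>x. \<Sum>i<n. f (y i) * indicator (A i) x)" if "f \<in> ?F" for f
    using *[THEN conjunct2, THEN conjunct2, THEN conjunct2] that by (rule bspec)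
  define \<mu> where "\<mu> i = measure M (A i)" for i
  have \<mu>0: "0 \<le> \<mu> i" for i by (simp add: \<mu>_def)
  define u where "u i j = (\<Sum>m<n0. sc (\<alpha> m (y i) * \<beta> m (y j)) (v m))" for i j
  have uV: "u i j \<in> V" for i j
    unfolding u_def using v by (intro subspace_sum subspace_scale subspace_carrier) auto
  have ind: "(\<lambda>x. indicator (A i) x) \<in> simple_fns M" if "i < n" for i
    using A that by (intro simple_fns_indicator) auto
  note indL = simple_fns_Lp[OF ind]
  have pair_split: "pair (\<alpha> m) (v m) (\<beta> m) =
      (\<Sum>i<n. \<Sum>j<n. \<alpha> m (y i) * \<beta> m (y j) * pair (\<lambda>x. indicator (A i) x) (v m) (\<lambda>x. indicator (A j) x))"
    if m: "m < n0" for m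
  proof -
    have "pair (\<alpha> m) (v m) (\<beta> m) = pair (\<lambda>x. \<Sum>i<n. \<alpha> m (y i) * indicator (A i) x) (v m)
        (\<lambda>x. \<Sum>j<n. \<beta> m (y j) * indicator (A j) x)"
      using rep[of "\<alpha> m"] rep[of "\<beta> m"] m by simp
    also have "\<dots> = (\<Sum>i<n. \<alpha> m (y i) * pair (\<lambda>x. indicator (A i) x) (v m) (\<lambda>x. \<Sum>j<n. \<beta> m (y j) * indicator (A j) x))"
      using m v indL p0 by (intro pair_sum_g Lp_functions_sum Lp_functions_cmult) auto
    also have "\<dots> = (\<Sum>i<n. \<alpha> m (y i) * (\<Sum>j<n. \<beta> m (y j) * pair (\<lambda>x. indicator (A i) x) (v m) (\<lambda>x. indicator (A j) x)))"
      using m v indL by (intro sum.cong refl arg_cong2[where f = "(*)"] pair_sum_f) auto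
    finally show ?thesis by (simp add: sum_distrib_left mult.assoc)
  qed
  \<comment> \<open>Normalised indicators, which absorb the inverse weights. On a null cell
    \<open>0 powr a = 0\<close> makes them 0, and the indicator of the cell is 0 almost everywhere
    as well; hence \<open>normalise\<close> holds almost everywhere.\<close>
  define eP where "eP j x = complex_of_real (\<mu> j powr (- 1 / p)) * indicator (A j) x" for j x
  define eQ where "eQ i x = complex_of_real (\<mu> i powr (- 1 / q)) * indicator (A i) x" for i x
  have ePL: "eP j \<in> Lp_functions t M" and eQL: "eQ j \<in> Lp_functions t M" if "j < n" for j t
    unfolding eP_def eQ_def using that by (intro Lp_functions_cmult indL; simp)+
  have normalise: "AE x in M. indicator (A i) x = complex_of_real (\<mu> i powr (1 / t)) *
      (complex_of_real (\<mu> i powr (- 1 / t)) * indicator (A i) x)" if i: "i < n" for i t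
  proof (cases "\<mu> i = 0")
    case True
    then have "A i \<in> null_sets M" using A i by (auto simp: \<mu>_def measure_def enn2real_eq_0_iff)
    then have "AE x in M. x \<notin> A i" by (rule AE_not_in)
    then show ?thesis by eventually_elim simp
  next
    case False
    then have "complex_of_real (\<mu> i powr (1 / t)) * complex_of_real (\<mu> i powr (- 1 / t)) = 1"
      using \<mu>0[of i] by (simp flip: of_real_mult powr_add)
    then show ?thesis by (simp add: mult.assoc[symmetric])
  qed
  define v' where "v' = mat n n (\<lambda>(i, j). sc (of_real (\<mu> i powr (1 / q)) * of_real (\<mu> j powr (1 / p))) (u i j))"
  have v': "v' \<in> mats n n V"
    by (rule matsI) (auto simp: v'_def intro: subspace_scale[OF subspace_carrier] uV)
  have pair_ind: "pair (\<lambda>x. indicator (A i) x) (u i j) (\<lambda>x. indicator (A j) x) = pair (eQ i) (v' $$ (i, j)) (eP j)"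
    if ij: "i < n" "j < n" for i j
  proof -
    have "pair (\<lambda>x. indicator (A i) x) (u i j) (\<lambda>x. indicator (A j) x) =
        pair (\<lambda>x. of_real (\<mu> i powr (1 / q)) * eQ i x) (u i j) (\<lambda>x. of_real (\<mu> j powr (1 / p)) * eP j x)"
      using ij normalise[OF ij(1), of q] normalise[OF ij(2), of p]
      by (intro pair_cong indL Lp_functions_cmult ePL eQL uV) (auto simp: eP_def eQ_def)
    also have "\<dots> = of_real (\<mu> i powr (1 / q)) * (of_real (\<mu> j powr (1 / p)) * pair (eQ i) (u i j) (eP j))"
      by (simp add: pair_scale_g[OF eQL[OF ij(1)] uV Lp_functions_cmult[OF ePL[OF ij(2)]]]
          pair_scale_f[OF eQL[OF ij(1)] uV ePL[OF ij(2)]])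
    also have "\<dots> = pair (eQ i) (v' $$ (i, j)) (eP j)"
      using ij by (simp add: v'_def pair_scale_v[OF eQL ePL uV])
    finally show ?thesis .
  qed
  have "(\<Sum>m<n0. pair (\<alpha> m) (v m) (\<beta> m)) =
      (\<Sum>m<n0. \<Sum>i<n. \<Sum>j<n. \<alpha> m (y i) * \<beta> m (y j) * pair (\<lambda>x. indicator (A i) x) (v m) (\<lambda>x. indicator (A j) x))"
    by (simp add: pair_split)
  also have "\<dots> = (\<Sum>i<n. \<Sum>m<n0. \<Sum>j<n. \<alpha> m (y i) * \<beta> m (y j) * pair (\<lambda>x. indicator (A i) x) (v m) (\<lambda>x. indicator (A j) x))"
    by (rule sum.swap)
  also have "\<dots> = (\<Sum>i<n. \<Sum>j<n. \<Sum>m<n0. \<alpha> m (y i) * \<beta> m (y j) * pair (\<lambda>x. indicator (A i) x) (v m) (\<lambda>x. indicator (A j) x))"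
    by (intro sum.cong refl sum.swap)
  also have "\<dots> = (\<Sum>i<n. \<Sum>j<n. pair (\<lambda>x. indicator (A i) x) (u i j) (\<lambda>x. indicator (A j) x))"
    unfolding u_def using indL v by (intro sum.cong refl pair_sum_v[symmetric]) auto
  also have "\<dots> = (\<Sum>i<n. \<Sum>j<n. pair (eQ i) (v' $$ (i, j)) (eP j))"
    by (intro sum.cong refl pair_ind) auto
  finally have total: "(\<Sum>m<n0. pair (\<alpha> m) (v m) (\<beta> m)) = (\<Sum>i<n. \<Sum>j<n. pair (eQ i) (v' $$ (i, j)) (eP j))" .
  define a' where "a' = mat n r (\<lambda>(i, k). a k (y i) * of_real (\<mu> i powr (1 / q)))"
  define b' where "b' = mat r n (\<lambda>(l, j). b l (y j) * of_real (\<mu> j powr (1 / p)))"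
  have v'_eq: "v' = mat_sandwich sc a' w b'"
  proof (rule eq_matI)
    fix i j assume "i < dim_row (mat_sandwich sc a' w b')" "j < dim_col (mat_sandwich sc a' w b')"
    then have ij: "i < n" "j < n" by (auto simp: mat_sandwich_def a'_def b'_def)
    have "v' $$ (i, j) = sc (of_real (\<mu> i powr (1 / q)) * of_real (\<mu> j powr (1 / p)))
        (\<Sum>k<r. \<Sum>l<r. sc (a k (y i) * b l (y j)) (w $$ (k, l)))"
      using ij by (simp add: v'_def u_def eq)
    also have "\<dots> = mat_sandwich sc a' w b' $$ (i, j)"
      using ij mats_carrier[OF w(1)]
      by (simp add: mat_sandwich_def a'_def b'_def scale_sum_right mult_ac)
    finally show "v' $$ (i, j) = mat_sandwich sc a' w b' $$ (i, j)" .
  qed (auto simp: v'_def mat_sandwich_def a'_def b'_def)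
  have s0: "0 \<le> s" using as by (rule order_trans[rotated]) (simp add: sum_nonneg)
  have entries: "(\<Sum>i<n. \<Sum>k<r. cmod (c k (y i) * of_real (\<mu> i powr (1 / t))) powr t) = (\<Sum>k<r. pow_integral t M (c k))"
    if c: "\<And>k. k < r \<Longrightarrow> c k \<in> ?F" and t: "0 < t" for c t
  proof -
    have "pow_integral t M (c k) = (\<Sum>i<n. cmod (c k (y i) * of_real (\<mu> i powr (1 / t))) powr t)" if "k < r" for k
    proof -
      have "pow_integral t M (c k) = pow_integral t M (\<lambda>x. \<Sum>i<n. c k (y i) * indicator (A i) x)"
        using rep[OF c[OF that]] by simp
      also have "\<dots> = (\<Sum>i<n. cmod (c k (y i)) powr t * \<mu> i)"
        unfolding \<mu>_def by (rule pow_integral_step[OF disj t A])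
      also have "\<dots> = (\<Sum>i<n. cmod (c k (y i) * of_real (\<mu> i powr (1 / t))) powr t)"
        using t \<mu>0 by (simp add: norm_mult powr_mult powr_powr)
      finally show ?thesis .
    qed
    then show ?thesis by (subst sum.swap) simp
  qed
  have "entry_norm q a' \<le> s powr (1 / q)"
  proof -
    have "entry_norm q a' = (\<Sum>i<n. \<Sum>k<r. cmod (a k (y i) * of_real (\<mu> i powr (1 / q))) powr q) powr (1 / q)"
      by (subst entry_norm_carrier[of _ n r]) (auto simp: a'_def)
    then show ?thesis using as q0 entries[of a q] by (auto intro!: powr_mono2 sum_nonneg)
  qed
  moreover have "entry_norm p b' \<le> s powr (1 / p)"
  proof -
    have "entry_norm p b' = (\<Sum>i<n. \<Sum>k<r. cmod (b k (y i) * of_real (\<mu> i powr (1 / p))) powr p) powr (1 / p)"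
      by (subst entry_norm_carrier[of _ r n], simp add: b'_def, subst sum.swap) (auto simp: b'_def)
    then show ?thesis using bs p0 entries[of b p] by (auto intro!: powr_mono2 sum_nonneg)
  qed
  moreover have "T_norm p q sc W N v' \<le> entry_norm q a' * N w * entry_norm p b'"
    unfolding v'_eq by (rule W.T_norm_le[OF r _ _ w(1)]) (auto simp: a'_def b'_def)
  ultimately have "T_norm p q sc W N v' \<le> s powr (1 / q) * 1 * s powr (1 / p)"
    using w(2) W.norm_nonneg[OF r w(1)]
    by (elim order_trans) (intro mult_mono, auto intro: entry_norm_nonneg)
  also have "\<dots> = s" using s0 pq by (cases "s = 0") (simp_all flip: powr_add add: add.commute)
  finally have TV: "T_norm p q sc V N v' \<le> s" using T_eq n v' by simp
  show ?thesis
  proof (rule field_le_epsilon)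
    fix e :: real assume "0 < e"
    then have "T_norm p q sc V N v' < s + e" using TV by simp
    then obtain R c x d where R: "1 \<le> R" and c: "c \<in> carrier_mat n R" and d: "d \<in> carrier_mat R n"
      and x: "x \<in> mats R R V" and v'x: "v' = mat_sandwich sc c x d"
      and less: "entry_norm q c * N x * entry_norm p d < s + e"
      using T_norm_lessD[OF n v'] by blast
    \<comment> \<open>The scalar factors \<open>c\<close> and \<open>d\<close> of the factorisation
      over \<open>V\<close> become coefficients in the disjointly supported \<open>eQ i\<close> and
      \<open>eP j\<close>. These have norm 1, or 0 on a null cell, so the norms of the tuples
      \<open>g\<close> and \<open>f\<close> are at most the entry norms of \<open>c\<close> and
      \<open>d\<close>.\<close>
    define g where "g k x = (\<Sum>i<n. c $$ (i, k) * eQ i x)" for k x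
    define f where "f l x = (\<Sum>j<n. d $$ (l, j) * eP j x)" for l x
    have gL: "g k \<in> Lp_functions q M" for k
      unfolding g_def using eQL by (intro Lp_functions_sum[OF q0] Lp_functions_cmult) auto
    have fL: "f l \<in> Lp_functions p M" for l
      unfolding f_def using ePL by (intro Lp_functions_sum[OF p0] Lp_functions_cmult) auto
    have xV: "x $$ (k, l) \<in> V" if "k < R" "l < R" for k l using mats_index[OF x] that .
    have entry: "v' $$ (i, j) = (\<Sum>k<R. \<Sum>l<R. sc (c $$ (i, k) * d $$ (l, j)) (x $$ (k, l)))"
      if "i < n" "j < n" for i j
      unfolding v'x using that c d mats_carrier[OF x] by (simp add: mat_sandwich_def)
    have "(\<Sum>i<n. \<Sum>j<n. pair (eQ i) (v' $$ (i, j)) (eP j)) =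
      (\<Sum>i<n. \<Sum>j<n. \<Sum>k<R. \<Sum>l<R. c $$ (i, k) * d $$ (l, j) * pair (eQ i) (x $$ (k, l)) (eP j))"
    proof (intro sum.cong refl)
      fix i j assume "i \<in> {..<n}" "j \<in> {..<n}"
      then have ij: "i < n" "j < n" by auto
      have "pair (eQ i) (v' $$ (i, j)) (eP j) =
        pair (eQ i) (\<Sum>k<R. sc 1 (\<Sum>l<R. sc (c $$ (i, k) * d $$ (l, j)) (x $$ (k, l)))) (eP j)"
        using entry[OF ij] by simp
      also have "\<dots> = (\<Sum>k<R. 1 * pair (eQ i) (\<Sum>l<R. sc (c $$ (i, k) * d $$ (l, j)) (x $$ (k, l))) (eP j))"
        using ij xV by (intro pair_sum_v eQL ePL subspace_sum subspace_scale subspace_carrier) auto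
      also have "\<dots> = (\<Sum>k<R. \<Sum>l<R. c $$ (i, k) * d $$ (l, j) * pair (eQ i) (x $$ (k, l)) (eP j))"
        using ij xV by (intro sum.cong refl, simp, intro pair_sum_v eQL ePL) auto
      finally show "pair (eQ i) (v' $$ (i, j)) (eP j) =
        (\<Sum>k<R. \<Sum>l<R. c $$ (i, k) * d $$ (l, j) * pair (eQ i) (x $$ (k, l)) (eP j))" .
    qed
    also have "\<dots> = (\<Sum>k<R. \<Sum>l<R. \<Sum>i<n. \<Sum>j<n. c $$ (i, k) * d $$ (l, j) * pair (eQ i) (x $$ (k, l)) (eP j))"
      by (rule sum_swap_pairs)
    also have "\<dots> = (\<Sum>k<R. \<Sum>l<R. pair (g k) (x $$ (k, l)) (f l))"
    proof (intro sum.cong refl)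
      fix k l assume "k \<in> {..<R}" "l \<in> {..<R}"
      then have kl: "k < R" "l < R" by auto
      have "pair (g k) (x $$ (k, l)) (f l) = (\<Sum>i<n. c $$ (i, k) * pair (eQ i) (x $$ (k, l)) (f l))"
        unfolding g_def using xV[OF kl] eQL fL by (intro pair_sum_g) auto
      also have "\<dots> = (\<Sum>i<n. c $$ (i, k) * (\<Sum>j<n. d $$ (l, j) * pair (eQ i) (x $$ (k, l)) (eP j)))"
        unfolding f_def using xV[OF kl] eQL ePL
        by (intro sum.cong refl arg_cong2[where f = "(*)"] pair_sum_f) auto
      finally show "(\<Sum>i<n. \<Sum>j<n. c $$ (i, k) * d $$ (l, j) * pair (eQ i) (x $$ (k, l)) (eP j)) =
        pair (g k) (x $$ (k, l)) (f l)" by (simp add: sum_distrib_left mult.assoc)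
    qed
    finally have "cmod (\<Sum>m<n0. pair (\<alpha> m) (v m) (\<beta> m)) \<le>
        (\<Sum>k<R. pow_integral q M (g k)) powr (1 / q) * N x * (\<Sum>l<R. pow_integral p M (f l)) powr (1 / p)"
      unfolding total using pair_bound[OF R x gL fL] by simp
    also have "\<dots> \<le> entry_norm q c * N x * entry_norm p d"
    proof (intro mult_mono)
      have unit: "cmod (z * complex_of_real (\<mu> i powr (- 1 / t))) powr t * \<mu> i \<le> cmod z powr t" if "0 < t" for z i t
      proof (cases "\<mu> i = 0")
        case False
        have "cmod (z * complex_of_real (\<mu> i powr (- 1 / t))) powr t * \<mu> i =
            cmod z powr t * ((\<mu> i powr (- 1 / t)) powr t * \<mu> i)"
          unfolding norm_mult norm_of_real by (simp add: powr_mult mult.assoc)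
        also have "(\<mu> i powr (- 1 / t)) powr t = \<mu> i powr (- 1)"
          unfolding powr_powr using that by simp
        also have "\<mu> i powr (- 1) * \<mu> i = 1"
          using False \<mu>0[of i] by (simp add: powr_minus_divide)
        finally show ?thesis by simp
      qed simp
      have "pow_integral q M (g k) \<le> (\<Sum>i<n. cmod (c $$ (i, k)) powr q)" for k
      proof -
        have "g k = (\<lambda>x. \<Sum>i<n. (c $$ (i, k) * of_real (\<mu> i powr (- 1 / q))) * indicator (A i) x)"
          by (simp add: g_def eQ_def mult.assoc fun_eq_iff)
        then have "pow_integral q M (g k) = (\<Sum>i<n. cmod (c $$ (i, k) * of_real (\<mu> i powr (- 1 / q))) powr q * \<mu> i)"
          unfolding \<mu>_def by (simp only: pow_integral_step[OF disj q0 A])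
        then show ?thesis using unit[OF q0] by (simp only: sum_mono)
      qed
      then have "(\<Sum>k<R. pow_integral q M (g k)) \<le> (\<Sum>i<n. \<Sum>k<R. cmod (c $$ (i, k)) powr q)"
        by (subst sum.swap) (rule sum_mono)
      then show "(\<Sum>k<R. pow_integral q M (g k)) powr (1 / q) \<le> entry_norm q c"
        unfolding entry_norm_carrier[OF c] using q0 by (intro powr_mono2 sum_nonneg) auto
      have "pow_integral p M (f l) \<le> (\<Sum>j<n. cmod (d $$ (l, j)) powr p)" for l
      proof -
        have "f l = (\<lambda>x. \<Sum>j<n. (d $$ (l, j) * of_real (\<mu> j powr (- 1 / p))) * indicator (A j) x)"
          by (simp add: f_def eP_def mult.assoc fun_eq_iff)
        then have "pow_integral p M (f l) = (\<Sum>j<n. cmod (d $$ (l, j) * of_real (\<mu> j powr (- 1 / p))) powr p * \<mu> j)"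
          unfolding \<mu>_def by (simp only: pow_integral_step[OF disj p0 A])
        then show ?thesis using unit[OF p0] by (simp only: sum_mono)
      qed
      then have "(\<Sum>l<R. pow_integral p M (f l)) \<le> (\<Sum>l<R. \<Sum>j<n. cmod (d $$ (l, j)) powr p)"
        by (intro sum_mono)
      then show "(\<Sum>l<R. pow_integral p M (f l)) powr (1 / p) \<le> entry_norm p d"
        unfolding entry_norm_carrier[OF d] using p0 by (intro powr_mono2 sum_nonneg) auto
    qed (use norm_nonneg[OF R x] entry_norm_nonneg in auto)
    finally show "cmod (\<Sum>m<n0. pair (\<alpha> m) (v m) (\<beta> m)) \<le> s + e" using less by simp
  qed
qed

end

section \<open>Extension of the pairing by Hahn--Banach\<close>

lemma sum_split_shift:
  fixes f :: "nat \<Rightarrow> 'b::comm_monoid_add"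
  shows "(\<Sum>k<m + n. f k) = (\<Sum>k<m. f k) + (\<Sum>k<n. f (m + k))"
  by (induction n) (simp_all add: add.assoc)

lemma sum_fun_apply: "(\<Sum>i\<in>I. f i) x = (\<Sum>i\<in>I. f i x)"
  for f :: "'i \<Rightarrow> 'b \<Rightarrow> 'c::comm_monoid_add"
  by (induction I rule: infinite_finite_induct) auto

text \<open>What the extended functional provides before there are operators on \<open>W\<close>:
  \<open>b w f g\<close> stands for the integral of g times (the image of w) f. Boundedness is
  recorded for all matrix sizes at once, since it has to yield complete contractivity.\<close>

locale tensor_form = conj_exp p q + p_operator_space sc p W N
  for p q :: real and sc :: "complex \<Rightarrow> 'a::ab_group_add \<Rightarrow> 'a" and W :: "'a set" and N :: "'a mat \<Rightarrow> real" +
  fixes M :: "'m measure" and b :: "'a \<Rightarrow> ('m \<Rightarrow> complex) \<Rightarrow> ('m \<Rightarrow> complex) \<Rightarrow> complex"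
  assumes b_add_w: "\<And>w w' f g. w \<in> W \<Longrightarrow> w' \<in> W \<Longrightarrow> f \<in> simple_fns M \<Longrightarrow> g \<in> simple_fns M \<Longrightarrow>
      b (w + w') f g = b w f g + b w' f g"
    and b_scale_w: "\<And>c w f g. w \<in> W \<Longrightarrow> f \<in> simple_fns M \<Longrightarrow> g \<in> simple_fns M \<Longrightarrow>
      b (sc c w) f g = c * b w f g"
    and b_add_f: "\<And>w f f' g. w \<in> W \<Longrightarrow> f \<in> simple_fns M \<Longrightarrow> f' \<in> simple_fns M \<Longrightarrow> g \<in> simple_fns M \<Longrightarrow>
      b w (\<lambda>x. f x + f' x) g = b w f g + b w f' g"
    and b_scale_f: "\<And>c w f g. w \<in> W \<Longrightarrow> f \<in> simple_fns M \<Longrightarrow> g \<in> simple_fns M \<Longrightarrow>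
      b w (\<lambda>x. c * f x) g = c * b w f g"
    and b_add_g: "\<And>w f g g'. w \<in> W \<Longrightarrow> f \<in> simple_fns M \<Longrightarrow> g \<in> simple_fns M \<Longrightarrow> g' \<in> simple_fns M \<Longrightarrow>
      b w f (\<lambda>x. g x + g' x) = b w f g + b w f g'"
    and b_scale_g: "\<And>c w f g. w \<in> W \<Longrightarrow> f \<in> simple_fns M \<Longrightarrow> g \<in> simple_fns M \<Longrightarrow>
      b w f (\<lambda>x. c * g x) = c * b w f g"
    and b_bound: "\<And>r w f g. 1 \<le> r \<Longrightarrow> w \<in> mats r r W \<Longrightarrow> N w \<le> 1 \<Longrightarrow>
      (\<And>k. k < r \<Longrightarrow> f k \<in> simple_fns M) \<Longrightarrow> (\<And>k. k < r \<Longrightarrow> g k \<in> simple_fns M) \<Longrightarrow>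
      (\<Sum>k<r. pow_integral p M (f k)) \<le> 1 \<Longrightarrow> (\<Sum>k<r. pow_integral q M (g k)) \<le> 1 \<Longrightarrow>
      cmod (\<Sum>k<r. \<Sum>l<r. b (w $$ (k, l)) (f l) (g k)) \<le> 1"

context cc_map
begin

text \<open>Hahn--Banach for the gauge over \<open>W\<close> and the graph of the pairing over
  \<open>V\<close>; \<open>tensor_bound\<close> is precisely the domination hypothesis. Restricting
  the extension to elementary tensors gives \<open>b\<close>, and \<open>b_bound\<close> says that
  the extension is dominated by the gauge.\<close>

theorem functional_extension:
  assumes W: "p_operator_space sc p W N" and VW: "V \<subseteq> W"
    and T_eq: "\<forall>n\<ge>1. \<forall>v\<in>mats n n V. T_norm p q sc V N v = T_norm p q sc W N v"
  shows "\<exists>b. tensor_form p q sc W N M b \<and>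
    (\<forall>v\<in>V. \<forall>f\<in>simple_fns M. \<forall>g\<in>simple_fns M. b v f g = pair g v f)"
proof -
  interpret W: p_operator_space sc p W N by fact
  let ?S = "simple_fns M"
  define scF where "scF c u = (\<lambda>z. sc c (u z))" for c and u :: "'m \<times> 'm \<Rightarrow> 'a"
  define tens where "tens g w f = (\<lambda>z. sc (g (fst z) * f (snd z)) w)" for g f :: "'m \<Rightarrow> complex" and w
  define R where "R u s \<longleftrightarrow> (\<exists>(r::nat) a b w. 1 \<le> r \<and> (\<forall>k<r. a k \<in> ?S) \<and> (\<forall>k<r. b k \<in> ?S) \<and> w \<in> mats r r W \<and> N w \<le> 1 \<and>
      (\<Sum>k<r. pow_integral q M (a k)) \<le> s \<and> (\<Sum>k<r. pow_integral p M (b k)) \<le> s \<and>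
      u = (\<lambda>z. \<Sum>k<r. \<Sum>l<r. tens (a k) (w $$ (k, l)) (b l) z))" for u s
  \<comment> \<open>A relation, because the second component is computed from a representation. Its
    independence of the representation is covered by the domination: two values of one tensor differ
    by a value of the tensor 0.\<close>
  define H0 where "H0 = {(\<lambda>z. \<Sum>m<n. tens (\<alpha> m) (v m) (\<beta> m) z, \<Sum>m<n. pair (\<alpha> m) (v m) (\<beta> m)) | (n::nat) \<alpha> v \<beta>.
      \<forall>m<n. \<alpha> m \<in> ?S \<and> \<beta> m \<in> ?S \<and> v m \<in> V}"
  have H0I: "(u, t) \<in> H0" if "\<forall>m<n. \<alpha> m \<in> ?S \<and> \<beta> m \<in> ?S \<and> v m \<in> V"
    "u = (\<lambda>z. \<Sum>m<n. tens (\<alpha> m) (v m) (\<beta> m) z)" "t = (\<Sum>m<n. pair (\<alpha> m) (v m) (\<beta> m))"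
    for u t \<alpha> \<beta> v and n :: nat
    using that unfolding H0_def by blast
  have R_add: "R (x + y) (s + t)" if xy: "R x s" "R y t" for x s y t
  proof -
    from xy obtain r r' :: nat and a a' b b' w w' where
      1: "1 \<le> r" "\<forall>k<r. a k \<in> ?S" "\<forall>k<r. b k \<in> ?S" "w \<in> mats r r W" "N w \<le> 1"
         "(\<Sum>k<r. pow_integral q M (a k)) \<le> s" "(\<Sum>k<r. pow_integral p M (b k)) \<le> s"
         "x = (\<lambda>z. \<Sum>k<r. \<Sum>l<r. tens (a k) (w $$ (k, l)) (b l) z)"
      and 2: "1 \<le> r'" "\<forall>k<r'. a' k \<in> ?S" "\<forall>k<r'. b' k \<in> ?S" "w' \<in> mats r' r' W" "N w' \<le> 1"
         "(\<Sum>k<r'. pow_integral q M (a' k)) \<le> t" "(\<Sum>k<r'. pow_integral p M (b' k)) \<le> t"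
         "y = (\<lambda>z. \<Sum>k<r'. \<Sum>l<r'. tens (a' k) (w' $$ (k, l)) (b' l) z)"
      unfolding R_def by blast
    define A where "A m = (if m < r then a m else a' (m - r))" for m
    define B where "B m = (if m < r then b m else b' (m - r))" for m
    \<comment> \<open>The direct sum keeps the norm at most 1, and concatenating the tuples adds the
      sums of powers; a sum of tensors thus has the sum of the bounds.\<close>
    define w'' where "w'' = mat_dsum w w'"
    have wc: "w \<in> carrier_mat r r" "w' \<in> carrier_mat r' r'" using 1 2 mats_carrier by auto
    have ind: "w'' $$ (k, l) = (if k < r then if l < r then w $$ (k, l) else 0
        else if l < r then 0 else w' $$ (k - r, l - r))" if "k < r + r'" "l < r + r'" for k l
      using that wc by (auto simp: w''_def mat_dsum_def)
    have tens0: "tens g 0 f z = 0" for g f z by (simp add: tens_def)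
    show ?thesis
      unfolding R_def
    proof (intro exI conjI)
      show "1 \<le> r + r'" using 1 by simp
      show "\<forall>k<r + r'. A k \<in> ?S" "\<forall>k<r + r'. B k \<in> ?S" using 1 2 by (auto simp: A_def B_def)
      have "w'' \<in> carrier_mat (r + r') (r + r')" using wc by (simp add: w''_def mat_dsum_def)
      then show "w'' \<in> mats (r + r') (r + r') W"
        using mats_index[OF 1(4)] mats_index[OF 2(4)] subspace_0[OF W.subspace_carrier]
        by (intro matsI) (auto simp: ind)
      show "N w'' \<le> 1" unfolding w''_def using W.norm_dsum[OF 1(1) 2(1) 1(4) 2(4)] 1(5) 2(5) by simp
      show "(\<Sum>k<r + r'. pow_integral q M (A k)) \<le> s + t"
        using 1(6) 2(6) by (simp add: sum_split_shift A_def)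
      show "(\<Sum>k<r + r'. pow_integral p M (B k)) \<le> s + t"
        using 1(7) 2(7) by (simp add: sum_split_shift B_def)
      show "x + y = (\<lambda>z. \<Sum>k<r + r'. \<Sum>l<r + r'. tens (A k) (w'' $$ (k, l)) (B l) z)"
        unfolding 1 2 by (simp add: fun_eq_iff sum_split_shift A_def B_def ind tens0)
    qed
  qed
  have R_scale: "R (scF c x) (cmod c * s)" if Rx: "R x s" for c x s
  proof -
    from Rx obtain r :: nat and a b w where
      1: "1 \<le> r" "\<forall>k<r. a k \<in> ?S" "\<forall>k<r. b k \<in> ?S" "w \<in> mats r r W" "N w \<le> 1"
         "(\<Sum>k<r. pow_integral q M (a k)) \<le> s" "(\<Sum>k<r. pow_integral p M (b k)) \<le> s"
         "x = (\<lambda>z. \<Sum>k<r. \<Sum>l<r. tens (a k) (w $$ (k, l)) (b l) z)"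
      unfolding R_def by blast
    \<comment> \<open>The scalar is split as c = d e with |d|^q = |e|^p = |c|, so that both sums of
      powers are scaled by |c|; the phase of \<open>c\<close> goes into \<open>d\<close>.\<close>
    define d where "d = sgn c * of_real (cmod c powr (1 / q))"
    define e where "e = complex_of_real (cmod c powr (1 / p))"
    have de: "d * e = c"
    proof (cases "c = 0")
      case False
      have "cmod c powr (1 / q) * cmod c powr (1 / p) = cmod c"
        using pq False by (simp flip: powr_add add: add.commute)
      then have "d * e = sgn c * of_real (cmod c)"
        unfolding d_def e_def mult.assoc of_real_mult[symmetric] by simp
      then show ?thesis using False by (simp add: sgn_eq)
    qed (simp add: d_def)
    have dq: "cmod d powr q = cmod c"
      using q0 by (cases "c = 0") (auto simp: d_def norm_mult norm_sgn powr_powr)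
    have ep: "cmod e powr p = cmod c" using p0 by (simp add: e_def powr_powr)
    show ?thesis
      unfolding R_def
    proof (intro exI conjI)
      show "\<forall>k<r. (\<lambda>x. d * a k x) \<in> ?S" "\<forall>k<r. (\<lambda>x. e * b k x) \<in> ?S"
        using 1 simple_fns_cmult by blast+
      show "(\<Sum>k<r. pow_integral q M (\<lambda>x. d * a k x)) \<le> cmod c * s"
        unfolding pow_integral_cmult dq sum_distrib_left[symmetric] by (intro mult_left_mono 1) simp
      show "(\<Sum>k<r. pow_integral p M (\<lambda>x. e * b k x)) \<le> cmod c * s"
        unfolding pow_integral_cmult ep sum_distrib_left[symmetric] by (intro mult_left_mono 1) simp
      have mul: "d * a k y * (e * b l z) = c * (a k y * b l z)" for k l y z
        using de by (metis mult.assoc mult.left_commute)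
      show "scF c x = (\<lambda>z. \<Sum>k<r. \<Sum>l<r. tens (\<lambda>x. d * a k x) (w $$ (k, l)) (\<lambda>x. e * b l x) z)"
        unfolding 1 scF_def tens_def scale_sum_right scale_scale mul ..
    qed (rule 1)+
  qed
  have "\<exists>G. (\<forall>x s y t. R x s \<longrightarrow> R y t \<longrightarrow> G (x + y) = G x + G y) \<and>
             (\<forall>c x s. R x s \<longrightarrow> G (scF c x) = c * G x) \<and>
             (\<forall>x s. R x s \<longrightarrow> cmod (G x) \<le> s) \<and>
             (\<forall>x t s. (x, t) \<in> H0 \<longrightarrow> R x s \<longrightarrow> G x = t)"
  proof (rule complex_hahn_banach_graph)
    show "vector_space scF"
      by unfold_locales (auto simp: scF_def fun_eq_iff scale_right_distrib scale_left_distrib)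
    show "(0, 0) \<in> H0" by (rule H0I[of 0]) (auto simp: fun_eq_iff)
  next
    fix x s y t assume "(x, s) \<in> H0" "(y, t) \<in> H0"
    then obtain n n' :: nat and \<alpha> \<alpha>' \<beta> \<beta>' v v' where
      1: "\<forall>m<n. \<alpha> m \<in> ?S \<and> \<beta> m \<in> ?S \<and> v m \<in> V" "x = (\<lambda>z. \<Sum>m<n. tens (\<alpha> m) (v m) (\<beta> m) z)"
         "s = (\<Sum>m<n. pair (\<alpha> m) (v m) (\<beta> m))"
      and 2: "\<forall>m<n'. \<alpha>' m \<in> ?S \<and> \<beta>' m \<in> ?S \<and> v' m \<in> V" "y = (\<lambda>z. \<Sum>m<n'. tens (\<alpha>' m) (v' m) (\<beta>' m) z)"
         "t = (\<Sum>m<n'. pair (\<alpha>' m) (v' m) (\<beta>' m))"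
      unfolding H0_def by blast
    define A where "A m = (if m < n then \<alpha> m else \<alpha>' (m - n))" for m
    define B where "B m = (if m < n then \<beta> m else \<beta>' (m - n))" for m
    define v'' where "v'' m = (if m < n then v m else v' (m - n))" for m
    show "(x + y, s + t) \<in> H0"
    proof (rule H0I)
      show "\<forall>m<n + n'. A m \<in> ?S \<and> B m \<in> ?S \<and> v'' m \<in> V"
        using 1(1) 2(1) by (auto simp: A_def B_def v''_def)
      show "x + y = (\<lambda>z. \<Sum>m<n + n'. tens (A m) (v'' m) (B m) z)"
        unfolding 1 2 by (simp add: fun_eq_iff sum_split_shift A_def B_def v''_def)
      show "s + t = (\<Sum>m<n + n'. pair (A m) (v'' m) (B m))"
        unfolding 1 2 by (simp add: sum_split_shift A_def B_def v''_def)
    qed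
  next
    fix c x s assume "(x, s) \<in> H0"
    then obtain n :: nat and \<alpha> \<beta> v where
      1: "\<forall>m<n. \<alpha> m \<in> ?S \<and> \<beta> m \<in> ?S \<and> v m \<in> V" "x = (\<lambda>z. \<Sum>m<n. tens (\<alpha> m) (v m) (\<beta> m) z)"
         "s = (\<Sum>m<n. pair (\<alpha> m) (v m) (\<beta> m))"
      unfolding H0_def by blast
    show "(scF c x, c * s) \<in> H0"
    proof (rule H0I)
      show "\<forall>m<n. \<alpha> m \<in> ?S \<and> \<beta> m \<in> ?S \<and> sc c (v m) \<in> V"
        using 1(1) subspace_scale[OF subspace_carrier] by auto
      show "scF c x = (\<lambda>z. \<Sum>m<n. tens (\<alpha> m) (sc c (v m)) (\<beta> m) z)"
        unfolding 1 by (simp add: scF_def tens_def scale_sum_right mult.commute)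
      show "c * s = (\<Sum>m<n. pair (\<alpha> m) (sc c (v m)) (\<beta> m))"
        unfolding 1 sum_distrib_left
        using 1(1) by (intro sum.cong refl pair_scale_v[symmetric]) (auto intro: simple_fns_Lp)
    qed
  next
    show "\<And>x s y t. R x s \<Longrightarrow> R y t \<Longrightarrow> R (x + y) (s + t)" by (rule R_add)
    show "\<And>c x s. R x s \<Longrightarrow> R (scF c x) (cmod c * s)" by (rule R_scale)
  next
    fix x t s assume "(x, t) \<in> H0" "R x s"
    then obtain n r :: nat and \<alpha> \<beta> v a b w where
      1: "\<forall>m<n. \<alpha> m \<in> ?S \<and> \<beta> m \<in> ?S \<and> v m \<in> V" "x = (\<lambda>z. \<Sum>m<n. tens (\<alpha> m) (v m) (\<beta> m) z)"
         "t = (\<Sum>m<n. pair (\<alpha> m) (v m) (\<beta> m))"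
      and 2: "1 \<le> r" "\<forall>k<r. a k \<in> ?S" "\<forall>k<r. b k \<in> ?S" "w \<in> mats r r W" "N w \<le> 1"
         "(\<Sum>k<r. pow_integral q M (a k)) \<le> s" "(\<Sum>k<r. pow_integral p M (b k)) \<le> s"
         "x = (\<lambda>z. \<Sum>k<r. \<Sum>l<r. tens (a k) (w $$ (k, l)) (b l) z)"
      unfolding H0_def R_def by blast
    have eq: "(\<Sum>m<n. sc (\<alpha> m y * \<beta> m y') (v m)) = (\<Sum>k<r. \<Sum>l<r. sc (a k y * b l y') (w $$ (k, l)))" for y y'
      using fun_cong[OF trans[OF 1(2)[symmetric] 2(8)], of "(y, y')"] by (simp add: tens_def)
    show "cmod t \<le> s"
      unfolding 1(3) using 1(1) 2
      by (intro tensor_bound[OF W VW T_eq _ _ _ 2(1) _ _ 2(4,5,6,7) eq]) auto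
  qed
  then obtain G where G_add: "\<And>x s y t. R x s \<Longrightarrow> R y t \<Longrightarrow> G (x + y) = G x + G y"
    and G_scale: "\<And>c x s. R x s \<Longrightarrow> G (scF c x) = c * G x"
    and G_le: "\<And>x s. R x s \<Longrightarrow> cmod (G x) \<le> s"
    and G_eq: "\<And>x t s. (x, t) \<in> H0 \<Longrightarrow> R x s \<Longrightarrow> G x = t" by blast
  \<comment> \<open>Additivity and homogeneity of \<open>G\<close> are available only where the
    gauge is finite. The factor \<open>t\<close> that brings \<open>w\<close> into the unit ball is
    moved into \<open>g\<close>, and the sum of the two integrals bounds each of them.\<close>
  have dom_tens: "\<exists>s. R (tens g w f) s" if w: "w \<in> W" and f: "f \<in> ?S" and g: "g \<in> ?S" for w f g
  proof -
    obtain t where t: "t > 0" and t1: "mat 1 1 (\<lambda>_. sc (of_real (1 / t)) w) \<in> mats 1 1 W"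
      "N (mat 1 1 (\<lambda>_. sc (of_real (1 / t)) w)) \<le> 1" using W.ex_matrix_unit[OF w] by blast
    have "R (tens g w f) (pow_integral q M (\<lambda>x. of_real t * g x) + pow_integral p M f)"
      unfolding R_def
    proof (intro exI conjI)
      show "(1::nat) \<le> 1" by simp
      show "\<forall>k<1. (\<lambda>x. of_real t * g x) \<in> ?S" using g simple_fns_cmult by blast
      show "\<forall>k<1. f \<in> ?S" using f by blast
      show "mat 1 1 (\<lambda>_. sc (of_real (1 / t)) w) \<in> mats 1 1 W"
        "N (mat 1 1 (\<lambda>_. sc (of_real (1 / t)) w)) \<le> 1" by (rule t1)+
      show "tens g w f = (\<lambda>z. \<Sum>k<1. \<Sum>l<1. tens (\<lambda>x. of_real t * g x) (mat 1 1 (\<lambda>_. sc (of_real (1 / t)) w) $$ (k, l)) f z)"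
        using t by (simp add: tens_def)
    qed simp_all
    then show ?thesis by blast
  qed
  \<comment> \<open>The induction starts from a singleton, since everything known about
    \<open>G\<close> concerns tensors with a bound.\<close>
  have G_sum: "(\<exists>s. R (\<Sum>i\<in>I. u i) s) \<and> G (\<Sum>i\<in>I. u i) = (\<Sum>i\<in>I. G (u i))"
    if "finite I" "I \<noteq> {}" "\<And>i. i \<in> I \<Longrightarrow> \<exists>s. R (u i) s" for I :: "nat set" and u
    using that
  proof (induction I rule: finite_ne_induct)
    case (insert i I)
    have "\<exists>s. R (u i) s" using insert.prems by simp
    moreover have "\<exists>t. R (\<Sum>i\<in>I. u i) t" using insert.IH insert.prems by simp
    ultimately obtain s t where st: "R (u i) s" "R (\<Sum>i\<in>I. u i) t" by blast
    have "G (\<Sum>i\<in>I. u i) = (\<Sum>i\<in>I. G (u i))" using insert by blast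
    then show ?case
      unfolding sum.insert[OF insert.hyps(1,3)] using R_add[OF st] G_add[OF st] by metis
  qed auto
  define b where "b w f g = G (tens g w f)" for w f g
  have tens_lin: "tens g (w + w') f = tens g w f + tens g w' f" "tens g (sc c w) f = scF c (tens g w f)"
    "tens g w (\<lambda>x. f x + f' x) = tens g w f + tens g w f'" "tens g w (\<lambda>x. c * f x) = scF c (tens g w f)"
    "tens (\<lambda>x. g x + g' x) w f = tens g w f + tens g' w f" "tens (\<lambda>x. c * g x) w f = scF c (tens g w f)"
    for g g' f f' w w' c
    by (simp_all add: fun_eq_iff tens_def scF_def scale_right_distrib scale_left_distrib ring_distribs mult_ac)
  show ?thesis
  proof (intro exI[of _ b] conjI ballI)
    show "tensor_form p q sc W N M b"
    proof unfold_locales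
      fix w w' f g assume "w \<in> W" "w' \<in> W" "f \<in> ?S" "g \<in> ?S"
      then show "b (w + w') f g = b w f g + b w' f g"
        unfolding b_def tens_lin(1) using dom_tens G_add by meson
    next
      fix c w f g assume "w \<in> W" "f \<in> ?S" "g \<in> ?S"
      then obtain s where "R (tens g w f) s" using dom_tens by meson
      then show "b (sc c w) f g = c * b w f g" "b w (\<lambda>x. c * f x) g = c * b w f g"
        "b w f (\<lambda>x. c * g x) = c * b w f g"
        unfolding b_def tens_lin by (rule G_scale)+
    next
      fix w f f' g assume "w \<in> W" "f \<in> ?S" "f' \<in> ?S" "g \<in> ?S"
      then show "b w (\<lambda>x. f x + f' x) g = b w f g + b w f' g"
        unfolding b_def tens_lin(3) using dom_tens G_add by meson
    next
      fix w f g g' assume "w \<in> W" "f \<in> ?S" "g \<in> ?S" "g' \<in> ?S"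
      then show "b w f (\<lambda>x. g x + g' x) = b w f g + b w f g'"
        unfolding b_def tens_lin(5) using dom_tens G_add by meson
    next
      fix r :: nat and w f g
      assume r: "1 \<le> r" and w: "w \<in> mats r r W" "N w \<le> 1"
        and f: "\<And>k. k < r \<Longrightarrow> f k \<in> ?S" and g: "\<And>k. k < r \<Longrightarrow> g k \<in> ?S"
        and 1: "(\<Sum>k<r. pow_integral p M (f k)) \<le> 1" "(\<Sum>k<r. pow_integral q M (g k)) \<le> 1"
      define u where "u k = (\<Sum>l<r. tens (g k) (w $$ (k, l)) (f l))" for k
      have ne: "{..<r} \<noteq> {}" using r by (simp add: lessThan_empty_iff)
      have inner: "(\<exists>s. R (u k) s) \<and> G (u k) = (\<Sum>l<r. b (w $$ (k, l)) (f l) (g k))" if k: "k < r" for k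
        unfolding u_def b_def using dom_tens[OF mats_index[OF w(1) k] f g[OF k]]
        by (intro G_sum[OF _ ne]) auto
      have "G (\<Sum>k<r. u k) = (\<Sum>k<r. G (u k))"
        using G_sum[OF _ ne, of u] inner by simp
      then have "G (\<Sum>k<r. u k) = (\<Sum>k<r. \<Sum>l<r. b (w $$ (k, l)) (f l) (g k))" using inner by simp
      \<comment> \<open>The data of \<open>b_bound\<close> are themselves a representation with
        bound 1.\<close>
      moreover have "R (\<Sum>k<r. u k) 1"
        unfolding R_def using r w f g 1
        by (intro exI[of _ r] exI[of _ g] exI[of _ f] exI[of _ w])
          (simp add: u_def fun_eq_iff sum_fun_apply)
      ultimately show "cmod (\<Sum>k<r. \<Sum>l<r. b (w $$ (k, l)) (f l) (g k)) \<le> 1" using G_le by metis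
    qed
  next
    fix v f g assume v: "v \<in> V" and f: "f \<in> ?S" and g: "g \<in> ?S"
    obtain s where s: "R (tens g v f) s" using dom_tens[OF _ f g] v VW by blast
    have "(tens g v f, pair g v f) \<in> H0"
      by (rule H0I[of "1" "\<lambda>_. g" "\<lambda>_. f" "\<lambda>_. v"]) (use v f g in auto)
    then show "b v f g = pair g v f" unfolding b_def using G_eq s by blast
  qed
qed

end

section \<open>Operators from bounded forms\<close>

context tensor_form
begin

lemma form_operator:
  assumes w: "w \<in> W"
  shows "\<exists>T \<kappa>. represents M (b w) T \<kappa>"
proof -
  obtain t where t: "t > 0" and t1: "mat 1 1 (\<lambda>_. sc (of_real (1 / t)) w) \<in> mats 1 1 W"
    "N (mat 1 1 (\<lambda>_. sc (of_real (1 / t)) w)) \<le> 1" using ex_matrix_unit[OF w] by blast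
  have "cmod (b w f g) \<le> t" if f: "f \<in> simple_fns M" and g: "g \<in> simple_fns M"
    and 1: "pow_integral p M f \<le> 1" "pow_integral q M g \<le> 1" for f g
  proof -
    have "cmod (b (sc (of_real (1 / t)) w) f g) \<le> 1"
      using b_bound[OF _ t1, of "\<lambda>_. f" "\<lambda>_. g"] f g 1 by simp
    then show ?thesis unfolding b_scale_w[OF w f g] using t by (simp add: norm_mult norm_divide field_simps)
  qed
  then show ?thesis
    by (intro bilinear_form_operator[where C = t]) (simp_all add: b_add_f b_add_g b_scale_f b_scale_g w)
qed

text \<open>Chosen for each \<open>w\<close> separately and acting on functions, so linearity in
  \<open>w\<close> and in \<open>f\<close> is not built in; it is recovered almost everywhere
  through \<open>form_op_unique\<close>.\<close>

definition form_op :: "'a \<Rightarrow> ('m \<Rightarrow> complex) \<Rightarrow> 'm \<Rightarrow> complex" where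
  "form_op w = (SOME T. \<exists>\<kappa>. represents M (b w) T \<kappa>)"

definition form_kernel :: "'a \<Rightarrow> ('m \<Rightarrow> complex) \<Rightarrow> 'm \<Rightarrow> complex" where
  "form_kernel w = (SOME \<kappa>. represents M (b w) (form_op w) \<kappa>)"

lemma form_op:
  assumes w: "w \<in> W"
  shows form_op_Lp: "f \<in> Lp_functions p M \<Longrightarrow> form_op w f \<in> Lp_functions p M"
    and form_kernel_Lq: "g \<in> simple_fns M \<Longrightarrow> form_kernel w g \<in> Lp_functions q M"
    and form_kernel: "f \<in> simple_fns M \<Longrightarrow> g \<in> simple_fns M \<Longrightarrow>
      b w f g = (\<integral>x. form_kernel w g x * f x \<partial>M)"
    and form_op_kernel: "f \<in> Lp_functions p M \<Longrightarrow> g \<in> simple_fns M \<Longrightarrow>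
      (\<integral>x. form_op w f x * g x \<partial>M) = (\<integral>x. form_kernel w g x * f x \<partial>M)"
proof -
  have "\<exists>\<kappa>. represents M (b w) (form_op w) \<kappa>"
    using someI_ex[OF form_operator[OF w]] unfolding form_op_def .
  then have "represents M (b w) (form_op w) (form_kernel w)"
    unfolding form_kernel_def by (rule someI_ex)
  then show "f \<in> Lp_functions p M \<Longrightarrow> form_op w f \<in> Lp_functions p M"
    "g \<in> simple_fns M \<Longrightarrow> form_kernel w g \<in> Lp_functions q M"
    "f \<in> simple_fns M \<Longrightarrow> g \<in> simple_fns M \<Longrightarrow> b w f g = (\<integral>x. form_kernel w g x * f x \<partial>M)"
    "f \<in> Lp_functions p M \<Longrightarrow> g \<in> simple_fns M \<Longrightarrow>
      (\<integral>x. form_op w f x * g x \<partial>M) = (\<integral>x. form_kernel w g x * f x \<partial>M)"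
    by (simp_all add: represents_def)
qed

lemma form_kernel_integrable:
  assumes "w \<in> W" "g \<in> simple_fns M" "f \<in> Lp_functions p M"
  shows "integrable M (\<lambda>x. form_kernel w g x * f x)"
  using conj_exp.integrable_mult[OF swap form_kernel_Lq[OF assms(1,2)] assms(3)] .

lemma form_op_integrable:
  assumes "w \<in> W" "f \<in> Lp_functions p M" "g \<in> simple_fns M"
  shows "integrable M (\<lambda>x. form_op w f x * g x)"
  by (intro integrable_mult form_op_Lp simple_fns_Lp assms)

text \<open>\<open>b\<close> can be compared only on simple \<open>f\<close>; separation by simple
  functions identifies the kernel almost everywhere and so carries the identity to all of L_p. This
  transports linearity of \<open>b\<close> in \<open>w\<close> to \<open>form_op\<close>.\<close>

lemma form_kernel_unique:
  assumes w: "w \<in> W" and g: "g \<in> simple_fns M" and k: "k \<in> Lp_functions q M"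
    and eq: "\<And>f. f \<in> simple_fns M \<Longrightarrow> b w f g = (\<integral>x. k x * f x \<partial>M)"
    and f: "f \<in> Lp_functions p M"
  shows "(\<integral>x. form_kernel w g x * f x \<partial>M) = (\<integral>x. k x * f x \<partial>M)"
proof (rule integral_cong_AE)
  have "AE x in M. form_kernel w g x = k x"
  proof (rule conj_exp.simple_fns_separate[OF swap form_kernel_Lq[OF w g] k])
    fix u assume u: "u \<in> simple_fns M"
    show "(\<integral>x. form_kernel w g x * u x \<partial>M) = (\<integral>x. k x * u x \<partial>M)"
      using form_kernel[OF w u g] eq[OF u] by simp
  qed
  then show "AE x in M. form_kernel w g x * f x = k x * f x" by eventually_elim simp
  show "(\<lambda>x. form_kernel w g x * f x) \<in> borel_measurable M" "(\<lambda>x. k x * f x) \<in> borel_measurable M"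
    using Lp_functionsD(1)[OF form_kernel_Lq[OF w g]] Lp_functionsD(1)[OF k] Lp_functionsD(1)[OF f]
    by (auto intro: borel_measurable_times)
qed

lemma form_op_unique:
  assumes w: "w \<in> W" and f: "f \<in> Lp_functions p M" and h: "h \<in> Lp_functions p M"
    and eq: "\<And>g. g \<in> simple_fns M \<Longrightarrow> (\<integral>x. form_kernel w g x * f x \<partial>M) = (\<integral>x. h x * g x \<partial>M)"
  shows "AE x in M. form_op w f x = h x"
  by (rule simple_fns_separate[OF form_op_Lp[OF w f] h]) (simp add: form_op_kernel[OF w f] eq)

lemma form_op_cong:
  assumes w: "w \<in> W" and f: "f \<in> Lp_functions p M" "f' \<in> Lp_functions p M" and "AE x in M. f x = f' x"
  shows "AE x in M. form_op w f x = form_op w f' x"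
proof (rule form_op_unique[OF w f(1) form_op_Lp[OF w f(2)]])
  fix g assume g: "g \<in> simple_fns M"
  show "(\<integral>x. form_kernel w g x * f x \<partial>M) = (\<integral>x. form_op w f' x * g x \<partial>M)"
    unfolding form_op_kernel[OF w f(2) g]
  proof (rule integral_cong_AE)
    show "AE x in M. form_kernel w g x * f x = form_kernel w g x * f' x"
      using assms(4) by eventually_elim simp
  qed (use form_kernel_integrable[OF w g] f in auto)
qed

lemma form_op_add:
  assumes w: "w \<in> W" and f: "f \<in> Lp_functions p M" "f' \<in> Lp_functions p M"
  shows "AE x in M. form_op w (\<lambda>x. f x + f' x) x = form_op w f x + form_op w f' x"
proof (rule form_op_unique[OF w Lp_functions_add[OF f p0] Lp_functions_add[OF form_op_Lp[OF w f(1)] form_op_Lp[OF w f(2)] p0]])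
  fix g assume g: "g \<in> simple_fns M"
  have "(\<integral>x. (form_op w f x + form_op w f' x) * g x \<partial>M) =
      (\<integral>x. form_kernel w g x * f x \<partial>M) + (\<integral>x. form_kernel w g x * f' x \<partial>M)"
    using form_op_integrable[OF w f(1) g] form_op_integrable[OF w f(2) g]
    by (simp add: distrib_right form_op_kernel[OF w f(1) g] form_op_kernel[OF w f(2) g])
  also have "\<dots> = (\<integral>x. form_kernel w g x * (f x + f' x) \<partial>M)"
    using form_kernel_integrable[OF w g f(1)] form_kernel_integrable[OF w g f(2)] by (simp add: distrib_left)
  finally show "(\<integral>x. form_kernel w g x * (f x + f' x) \<partial>M) = (\<integral>x. (form_op w f x + form_op w f' x) * g x \<partial>M)" ..
qed

lemma form_op_scale:
  assumes w: "w \<in> W" and f: "f \<in> Lp_functions p M"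
  shows "AE x in M. form_op w (\<lambda>x. c * f x) x = c * form_op w f x"
proof (rule form_op_unique[OF w Lp_functions_cmult[OF f] Lp_functions_cmult[OF form_op_Lp[OF w f]]])
  fix g assume g: "g \<in> simple_fns M"
  show "(\<integral>x. form_kernel w g x * (c * f x) \<partial>M) = (\<integral>x. c * form_op w f x * g x \<partial>M)"
    using form_op_kernel[OF w f g] by (simp add: mult.assoc mult.left_commute)
qed

lemma form_op_add_w:
  assumes w: "w \<in> W" "w' \<in> W" and f: "f \<in> Lp_functions p M"
  shows "AE x in M. form_op (w + w') f x = form_op w f x + form_op w' f x"
proof (rule form_op_unique[OF subspace_add[OF subspace_carrier w] f
      Lp_functions_add[OF form_op_Lp[OF w(1) f] form_op_Lp[OF w(2) f] p0]])
  fix g assume g: "g \<in> simple_fns M"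
  have "(\<integral>x. form_kernel (w + w') g x * f x \<partial>M) = (\<integral>x. (form_kernel w g x + form_kernel w' g x) * f x \<partial>M)"
  proof (rule form_kernel_unique[OF subspace_add[OF subspace_carrier w] g _ _ f])
    show "(\<lambda>x. form_kernel w g x + form_kernel w' g x) \<in> Lp_functions q M"
      by (intro Lp_functions_add form_kernel_Lq w g q0)
    fix u assume u: "u \<in> simple_fns M"
    show "b (w + w') u g = (\<integral>x. (form_kernel w g x + form_kernel w' g x) * u x \<partial>M)"
      using form_kernel_integrable[OF w(1) g simple_fns_Lp[OF u]] form_kernel_integrable[OF w(2) g simple_fns_Lp[OF u]]
      by (simp add: distrib_right b_add_w[OF w u g] form_kernel[OF w(1) u g] form_kernel[OF w(2) u g])
  qed
  also have "\<dots> = (\<integral>x. form_kernel w g x * f x \<partial>M) + (\<integral>x. form_kernel w' g x * f x \<partial>M)"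
    using form_kernel_integrable[OF w(1) g f] form_kernel_integrable[OF w(2) g f] by (simp add: distrib_right)
  also have "\<dots> = (\<integral>x. (form_op w f x + form_op w' f x) * g x \<partial>M)"
    using form_op_integrable[OF w(1) f g] form_op_integrable[OF w(2) f g]
    by (simp add: distrib_right form_op_kernel[OF w(1) f g] form_op_kernel[OF w(2) f g])
  finally show "(\<integral>x. form_kernel (w + w') g x * f x \<partial>M) = (\<integral>x. (form_op w f x + form_op w' f x) * g x \<partial>M)" .
qed

lemma form_op_scale_w:
  assumes w: "w \<in> W" and f: "f \<in> Lp_functions p M"
  shows "AE x in M. form_op (sc c w) f x = c * form_op w f x"
proof (rule form_op_unique[OF subspace_scale[OF subspace_carrier w] f Lp_functions_cmult[OF form_op_Lp[OF w f]]])
  fix g assume g: "g \<in> simple_fns M"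
  have "(\<integral>x. form_kernel (sc c w) g x * f x \<partial>M) = (\<integral>x. (c * form_kernel w g x) * f x \<partial>M)"
  proof (rule form_kernel_unique[OF subspace_scale[OF subspace_carrier w] g _ _ f])
    show "(\<lambda>x. c * form_kernel w g x) \<in> Lp_functions q M" by (intro Lp_functions_cmult form_kernel_Lq w g)
    fix u assume u: "u \<in> simple_fns M"
    show "b (sc c w) u g = (\<integral>x. c * form_kernel w g x * u x \<partial>M)"
      by (simp add: mult.assoc b_scale_w[OF w u g] form_kernel[OF w u g])
  qed
  then show "(\<integral>x. form_kernel (sc c w) g x * f x \<partial>M) = (\<integral>x. c * form_op w f x * g x \<partial>M)"
    by (simp add: mult.assoc form_op_kernel[OF w f g])
qed

text \<open>\<open>b_bound\<close> gives this for simple \<open>f\<close> by homogeneity in both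
  tuples. For general \<open>f\<close> the kernel takes over the role of \<open>b\<close>, and the
  estimate passes to the limit along approximating simple functions while \<open>g\<close> stays
  fixed.\<close>

lemma form_bound:
  assumes n: "1 \<le> n" and w: "w \<in> mats n n W" "N w \<le> 1"
    and f: "\<And>l. l < n \<Longrightarrow> f l \<in> Lp_functions p M" and g: "\<And>k. k < n \<Longrightarrow> g k \<in> simple_fns M"
  shows "cmod (\<Sum>k<n. \<Sum>l<n. \<integral>x. form_op (w $$ (k, l)) (f l) x * g k x \<partial>M) \<le>
    (\<Sum>k<n. pow_integral q M (g k)) powr (1 / q) * (\<Sum>l<n. pow_integral p M (f l)) powr (1 / p)"
proof -
  note wW = mats_index[OF w(1)]
  define Q where "Q = (\<Sum>k<n. pow_integral q M (g k)) powr (1 / q)"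
  have simple: "cmod (\<Sum>k<n. \<Sum>l<n. b (w $$ (k, l)) (f l) (g k)) \<le> Q * (\<Sum>l<n. pow_integral p M (f l)) powr (1 / p)"
    if f: "\<And>l. l < n \<Longrightarrow> f l \<in> simple_fns M" for f
  proof (rule homogeneous_bound[where \<Phi> = "\<lambda>f. \<Sum>k<n. \<Sum>l<n. b (w $$ (k, l)) (f l) (g k)", OF p0])
    fix c
    show "(\<Sum>k<n. \<Sum>l<n. b (w $$ (k, l)) (\<lambda>x. c * f l x) (g k)) = c * (\<Sum>k<n. \<Sum>l<n. b (w $$ (k, l)) (f l) (g k))"
      by (simp add: sum_distrib_left b_scale_f wW f g)
    assume c: "(\<Sum>l<n. pow_integral p M (\<lambda>x. c * f l x)) \<le> 1"
    have "cmod (\<Sum>k<n. \<Sum>l<n. b (w $$ (k, l)) (\<lambda>x. c * f l x) (g k)) \<le> 1 * Q"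
      unfolding Q_def
    proof (rule homogeneous_bound[where \<Phi> = "\<lambda>g. \<Sum>k<n. \<Sum>l<n. b (w $$ (k, l)) (\<lambda>x. c * f l x) (g k)", OF q0])
      fix d
      show "(\<Sum>k<n. \<Sum>l<n. b (w $$ (k, l)) (\<lambda>x. c * f l x) (\<lambda>x. d * g k x)) =
          d * (\<Sum>k<n. \<Sum>l<n. b (w $$ (k, l)) (\<lambda>x. c * f l x) (g k))"
        by (simp add: sum_distrib_left b_scale_g wW f g simple_fns_cmult)
      assume d: "(\<Sum>k<n. pow_integral q M (\<lambda>x. d * g k x)) \<le> 1"
      show "cmod (\<Sum>k<n. \<Sum>l<n. b (w $$ (k, l)) (\<lambda>x. c * f l x) (\<lambda>x. d * g k x)) \<le> 1"
        by (rule b_bound[OF n w _ _ c d]) (auto intro: simple_fns_cmult f g)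
    qed
    then show "cmod (\<Sum>k<n. \<Sum>l<n. b (w $$ (k, l)) (\<lambda>x. c * f l x) (g k)) \<le> Q" by simp
  qed
  have "\<forall>l. \<exists>F. l < n \<longrightarrow> (\<forall>i. F i \<in> simple_fns M) \<and>
    (\<forall>h\<in>Lp_functions q M. (\<lambda>i. \<integral>x. h x * F i x \<partial>M) \<longlonglongrightarrow> (\<integral>x. h x * f l x \<partial>M)) \<and>
    (\<lambda>i. pow_integral p M (F i)) \<longlonglongrightarrow> pow_integral p M (f l)"
    using conj_exp.simple_fns_approx[OF swap f] by blast
  from choice[OF this] obtain F where "\<forall>l. l < n \<longrightarrow> (\<forall>i. F l i \<in> simple_fns M) \<and>
    (\<forall>h\<in>Lp_functions q M. (\<lambda>i. \<integral>x. h x * F l i x \<partial>M) \<longlonglongrightarrow> (\<integral>x. h x * f l x \<partial>M)) \<and>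
    (\<lambda>i. pow_integral p M (F l i)) \<longlonglongrightarrow> pow_integral p M (f l)" by blast
  then have F: "\<And>l i. l < n \<Longrightarrow> F l i \<in> simple_fns M"
    "\<And>l h. l < n \<Longrightarrow> h \<in> Lp_functions q M \<Longrightarrow> (\<lambda>i. \<integral>x. h x * F l i x \<partial>M) \<longlonglongrightarrow> (\<integral>x. h x * f l x \<partial>M)"
    "\<And>l. l < n \<Longrightarrow> (\<lambda>i. pow_integral p M (F l i)) \<longlonglongrightarrow> pow_integral p M (f l)"
    by auto
  have "cmod (\<Sum>k<n. \<Sum>l<n. \<integral>x. form_kernel (w $$ (k, l)) (g k) x * f l x \<partial>M) \<le>
      Q * (\<Sum>l<n. pow_integral p M (f l)) powr (1 / p)"
  proof (rule tendsto_le[OF trivial_limit_sequentially])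
    show "(\<lambda>i. Q * (\<Sum>l<n. pow_integral p M (F l i)) powr (1 / p)) \<longlonglongrightarrow> Q * (\<Sum>l<n. pow_integral p M (f l)) powr (1 / p)"
      using p0 F(3) by (intro tendsto_mult tendsto_powr' tendsto_sum tendsto_const) (auto simp: sum_nonneg)
    show "(\<lambda>i. cmod (\<Sum>k<n. \<Sum>l<n. \<integral>x. form_kernel (w $$ (k, l)) (g k) x * F l i x \<partial>M)) \<longlonglongrightarrow>
        cmod (\<Sum>k<n. \<Sum>l<n. \<integral>x. form_kernel (w $$ (k, l)) (g k) x * f l x \<partial>M)"
      using F(2) form_kernel_Lq wW g by (intro tendsto_norm tendsto_sum) auto
    have "(\<Sum>k<n. \<Sum>l<n. \<integral>x. form_kernel (w $$ (k, l)) (g k) x * F l i x \<partial>M) =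
        (\<Sum>k<n. \<Sum>l<n. b (w $$ (k, l)) (F l i) (g k))" for i
      by (intro sum.cong refl form_kernel[symmetric] wW F g) auto
    then show "\<forall>\<^sub>F i in sequentially. cmod (\<Sum>k<n. \<Sum>l<n. \<integral>x. form_kernel (w $$ (k, l)) (g k) x * F l i x \<partial>M)
        \<le> Q * (\<Sum>l<n. pow_integral p M (F l i)) powr (1 / p)"
      using simple[of "\<lambda>l. F l i" for i] F(1) by simp
  qed
  moreover have "(\<Sum>k<n. \<Sum>l<n. \<integral>x. form_op (w $$ (k, l)) (f l) x * g k x \<partial>M) =
      (\<Sum>k<n. \<Sum>l<n. \<integral>x. form_kernel (w $$ (k, l)) (g k) x * f l x \<partial>M)"
    by (intro sum.cong refl form_op_kernel wW f g) auto
  ultimately show ?thesis by (simp add: Q_def)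
qed

text \<open>By \<open>dual_norm_le_1\<close> the norm of the image column is tested on simple
  tuples, where \<open>form_bound\<close> applies.\<close>

lemma form_contraction:
  assumes n: "1 \<le> n" and w: "w \<in> mats n n W" "N w \<le> 1"
    and f: "\<And>l. l < n \<Longrightarrow> f l \<in> Lp_functions p M" and f1: "(\<Sum>l<n. pow_integral p M (f l)) \<le> 1"
  shows "(\<Sum>k<n. pow_integral p M (\<lambda>x. \<Sum>l<n. form_op (w $$ (k, l)) (f l) x)) \<le> 1"
proof (rule dual_norm_le_1)
  note wW = mats_index[OF w(1)]
  show "(\<lambda>x. \<Sum>l<n. form_op (w $$ (k, l)) (f l) x) \<in> Lp_functions p M" if "k < n" for k
    using that by (intro Lp_functions_sum[OF p0] form_op_Lp wW f) auto
  fix g assume g: "\<And>k. k < n \<Longrightarrow> g k \<in> simple_fns M"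
  have "(\<integral>x. (\<Sum>l<n. form_op (w $$ (k, l)) (f l) x) * g k x \<partial>M) =
      (\<Sum>l<n. \<integral>x. form_op (w $$ (k, l)) (f l) x * g k x \<partial>M)" if "k < n" for k
    unfolding sum_distrib_right
    using that by (intro Bochner_Integration.integral_sum form_op_integrable wW f g) auto
  then have "cmod (\<Sum>k<n. \<integral>x. (\<Sum>l<n. form_op (w $$ (k, l)) (f l) x) * g k x \<partial>M) \<le>
    (\<Sum>k<n. pow_integral q M (g k)) powr (1 / q) * (\<Sum>l<n. pow_integral p M (f l)) powr (1 / p)"
    using form_bound[OF n w f g] by simp
  also have "\<dots> \<le> (\<Sum>k<n. pow_integral q M (g k)) powr (1 / q) * 1"
    using f1 p0 by (intro mult_left_mono) (simp_all add: powr_inverse_le_1_iff sum_nonneg)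
  finally show "cmod (\<Sum>k<n. \<integral>x. (\<Sum>l<n. form_op (w $$ (k, l)) (f l) x) * g k x \<partial>M) \<le>
    (\<Sum>k<n. pow_integral q M (g k)) powr (1 / q)" by simp
qed

text \<open>The case of 1 by 1 matrices: \<open>t\<close> scales \<open>w\<close> into the unit ball
  and \<open>s\<close> scales \<open>f\<close>, with \<open>e\<close> keeping \<open>s\<close>
  positive.\<close>

lemma form_op_bounded:
  assumes w: "w \<in> W"
  shows "\<exists>C. \<forall>f\<in>Lp_functions p M. pow_integral p M (form_op w f) powr (1 / p) \<le> C * pow_integral p M f powr (1 / p)"
proof -
  obtain t where t: "t > 0" and t1: "mat 1 1 (\<lambda>_. sc (of_real (1 / t)) w) \<in> mats 1 1 W"
    "N (mat 1 1 (\<lambda>_. sc (of_real (1 / t)) w)) \<le> 1" using ex_matrix_unit[OF w] by blast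
  have sw: "sc (of_real (1 / t)) w \<in> W" using w subspace_scale[OF subspace_carrier] by blast
  have "pow_integral p M (form_op w f) powr (1 / p) \<le> t * pow_integral p M f powr (1 / p)"
    if f: "f \<in> Lp_functions p M" for f
  proof (rule le_powr_limit)
    fix e :: real assume e: "0 < e"
    define s where "s = (pow_integral p M f + e) powr (1 / p)"
    have I0: "0 < pow_integral p M f + e" using e by (simp add: add_nonneg_pos)
    have s: "0 < s" "s powr p = pow_integral p M f + e" using I0 p0 by (simp_all add: s_def powr_powr)
    have "pow_integral p M (\<lambda>x. of_real (1 / s) * f x) = (1 / s) powr p * pow_integral p M f"
      unfolding pow_integral_cmult using s by (simp add: norm_divide)
    also have "\<dots> \<le> 1" using s I0 e by (simp add: powr_divide)
    finally have "pow_integral p M (form_op (sc (of_real (1 / t)) w) (\<lambda>x. of_real (1 / s) * f x)) \<le> 1"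
      using form_contraction[OF _ t1, of "\<lambda>_ x. of_real (1 / s) * f x"]
        Lp_functions_cmult[OF f, of "of_real (1 / s)"] by simp
    moreover have "pow_integral p M (form_op (sc (of_real (1 / t)) w) (\<lambda>x. of_real (1 / s) * f x)) =
      pow_integral p M (\<lambda>x. of_real (1 / (t * s)) * form_op w f x)"
    proof (rule pow_integral_cong_AE)
      show "AE x in M. form_op (sc (of_real (1 / t)) w) (\<lambda>x. of_real (1 / s) * f x) x = of_real (1 / (t * s)) * form_op w f x"
        using form_op_scale_w[OF w Lp_functions_cmult[OF f], of "of_real (1 / t)" "of_real (1 / s)"]
          form_op_scale[OF w f, of "of_real (1 / s)"]
        by eventually_elim simp
    qed (rule Lp_functionsD(1)[OF form_op_Lp[OF sw Lp_functions_cmult[OF f]]]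
        Lp_functionsD(1)[OF Lp_functions_cmult[OF form_op_Lp[OF w f]]])+
    ultimately have "(1 / (t * s)) powr p * pow_integral p M (form_op w f) \<le> 1"
      unfolding pow_integral_cmult norm_of_real using t s by simp
    then have "pow_integral p M (form_op w f) \<le> (t * s) powr p"
      using t s by (simp add: powr_divide field_simps)
    then have "pow_integral p M (form_op w f) powr (1 / p) \<le> ((t * s) powr p) powr (1 / p)"
      using p0 by (intro powr_mono2) auto
    also have "\<dots> = t * s" using t s p0 by (simp add: powr_powr)
    finally show "pow_integral p M (form_op w f) powr (1 / p) \<le> t * (pow_integral p M f + e) powr (1 / p)"
      by (simp add: s_def)
  qed (use p0 in auto)
  then show ?thesis by blast
qed

section \<open>The extension as a map into the bounded operators\<close>

definition form_map :: "'a \<Rightarrow> 'm Lp_op" where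
  "form_map w = (\<lambda>\<xi>\<in>Lp p M. Lp_class p M (form_op w (Lp_rep \<xi>)))"

lemma form_map_class:
  assumes w: "w \<in> W" and f: "f \<in> Lp_functions p M"
  shows "form_map w (Lp_class p M f) = Lp_class p M (form_op w f)"
proof -
  have "AE x in M. form_op w (Lp_rep (Lp_class p M f)) x = form_op w f x"
    by (rule form_op_cong[OF w Lp_rep(1)[OF Lp_class_in_Lp[OF f]] f Lp_rep_class[OF f]])
  then show ?thesis
    using Lp_class_in_Lp[OF f] Lp_class_eq_iff[OF form_op_Lp[OF w Lp_rep(1)[OF Lp_class_in_Lp[OF f]]] form_op_Lp[OF w f]]
    by (simp add: form_map_def)
qed

lemma form_map_contractive: "p_completely_contractive sc W N p M form_map"
  unfolding p_completely_contractive_def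
proof (intro conjI ballI allI)
  have ops: "form_map w \<in> Lp_ops p M" if w: "w \<in> W" for w
    unfolding Lp_ops_def
  proof (intro CollectI conjI ballI allI)
    show "form_map w \<in> Lp p M \<rightarrow>\<^sub>E Lp p M"
      by (auto simp: form_map_def intro!: Lp_class_in_Lp form_op_Lp[OF w] Lp_rep)
    fix \<xi> assume \<xi>: "\<xi> \<in> Lp p M"
    note f = Lp_rep[OF \<xi>]
    show "form_map w (Lp_scale p M c \<xi>) = Lp_scale p M c (form_map w \<xi>)" for c
    proof -
      have "form_map w (Lp_scale p M c (Lp_class p M (Lp_rep \<xi>))) =
          Lp_scale p M c (form_map w (Lp_class p M (Lp_rep \<xi>)))"
        unfolding Lp_scale_class[OF f(1)] form_map_class[OF w Lp_functions_cmult[OF f(1)]]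
          form_map_class[OF w f(1)] Lp_scale_class[OF form_op_Lp[OF w f(1)]]
        by (subst Lp_class_eq_iff[OF form_op_Lp[OF w Lp_functions_cmult[OF f(1)]] Lp_functions_cmult[OF form_op_Lp[OF w f(1)]]])
          (rule form_op_scale[OF w f(1)])
      then show ?thesis unfolding f(2) .
    qed
    fix \<eta> assume \<eta>: "\<eta> \<in> Lp p M"
    note g = Lp_rep[OF \<eta>]
    have "form_map w (Lp_add p M (Lp_class p M (Lp_rep \<xi>)) (Lp_class p M (Lp_rep \<eta>))) =
        Lp_add p M (form_map w (Lp_class p M (Lp_rep \<xi>))) (form_map w (Lp_class p M (Lp_rep \<eta>)))"
      unfolding Lp_add_class[OF f(1) g(1) p0] form_map_class[OF w Lp_functions_add[OF f(1) g(1) p0]]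
        form_map_class[OF w f(1)] form_map_class[OF w g(1)] Lp_add_class[OF form_op_Lp[OF w f(1)] form_op_Lp[OF w g(1)] p0]
      by (subst Lp_class_eq_iff[OF form_op_Lp[OF w Lp_functions_add[OF f(1) g(1) p0]]
            Lp_functions_add[OF form_op_Lp[OF w f(1)] form_op_Lp[OF w g(1)] p0]])
        (rule form_op_add[OF w f(1) g(1)])
    then show "form_map w (Lp_add p M \<xi> \<eta>) = Lp_add p M (form_map w \<xi>) (form_map w \<eta>)"
      unfolding f(2) g(2) .
  next
    obtain C where C: "\<forall>f\<in>Lp_functions p M. pow_integral p M (form_op w f) powr (1 / p) \<le> C * pow_integral p M f powr (1 / p)"
      using form_op_bounded[OF w] ..
    show "\<exists>C. \<forall>\<xi>\<in>Lp p M. Lp_norm p M (form_map w \<xi>) \<le> C * Lp_norm p M \<xi>"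
    proof (intro exI ballI)
      fix \<xi> assume \<xi>: "\<xi> \<in> Lp p M"
      note f = Lp_rep[OF \<xi>]
      have "Lp_norm p M (form_map w \<xi>) = pow_integral p M (form_op w (Lp_rep \<xi>)) powr (1 / p)"
        using \<xi> pow_integral_rep_class[OF form_op_Lp[OF w f(1)]] by (simp add: Lp_norm_rep form_map_def)
      then show "Lp_norm p M (form_map w \<xi>) \<le> C * Lp_norm p M \<xi>"
        using C f(1) by (simp add: Lp_norm_rep)
    qed
  qed
  show "form_map w \<in> Lp_ops p M" if "w \<in> W" for w using ops[OF that] .
  show "form_map (w + w') = Lp_op_add p M (form_map w) (form_map w')" if w: "w \<in> W" "w' \<in> W" for w w'
  proof (rule ext)
    fix \<xi>
    show "form_map (w + w') \<xi> = Lp_op_add p M (form_map w) (form_map w') \<xi>"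
    proof (cases "\<xi> \<in> Lp p M")
      case True
      note f = Lp_rep(1)[OF True]
      note L = form_op_Lp[OF w(1) f] form_op_Lp[OF w(2) f]
      have "Lp_class p M (form_op (w + w') (Lp_rep \<xi>)) = Lp_class p M (\<lambda>x. form_op w (Lp_rep \<xi>) x + form_op w' (Lp_rep \<xi>) x)"
        by (subst Lp_class_eq_iff[OF form_op_Lp[OF subspace_add[OF subspace_carrier w] f] Lp_functions_add[OF L p0]])
          (rule form_op_add_w[OF w f])
      then show ?thesis using True Lp_add_class[OF L p0] by (simp add: form_map_def Lp_op_add_def)
    qed (simp add: form_map_def Lp_op_add_def)
  qed
  show "form_map (sc c w) = Lp_op_scale p M c (form_map w)" if w: "w \<in> W" for c w
  proof (rule ext)
    fix \<xi>
    show "form_map (sc c w) \<xi> = Lp_op_scale p M c (form_map w) \<xi>"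
    proof (cases "\<xi> \<in> Lp p M")
      case True
      note f = Lp_rep(1)[OF True]
      have "Lp_class p M (form_op (sc c w) (Lp_rep \<xi>)) = Lp_class p M (\<lambda>x. c * form_op w (Lp_rep \<xi>) x)"
        by (subst Lp_class_eq_iff[OF form_op_Lp[OF subspace_scale[OF subspace_carrier w] f] Lp_functions_cmult[OF form_op_Lp[OF w f]]])
          (rule form_op_scale_w[OF w f])
      then show ?thesis using True Lp_scale_class[OF form_op_Lp[OF w f]] by (simp add: form_map_def Lp_op_scale_def)
    qed (simp add: form_map_def Lp_op_scale_def)
  qed
  show "cb_norm W N (Lp_mat_norm p M) form_map \<le> 1"
    unfolding cb_norm_def
  proof (intro SUP_least)
    fix n w assume "n \<in> {1::nat..}" "w \<in> {v \<in> mats n n W. N v \<le> 1}"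
    then have n: "1 \<le> n" and w: "w \<in> mats n n W" "N w \<le> 1" by auto
    note wc = mats_carrier[OF w(1)] and wW = mats_index[OF w(1)]
    have "Lp_mat_norm p M (map_mat form_map w) \<le> 1"
    proof (rule Lp_mat_norm_le_1[OF p0])
      show "map_mat form_map w \<in> carrier_mat n n" using wc by simp
      show "map_mat form_map w $$ (i, j) \<in> Lp_ops p M" if "i < n" "j < n" for i j
        using that wc ops[OF wW] by simp
      fix f assume f: "\<And>j. j < n \<Longrightarrow> f j \<in> Lp_functions p M" and f1: "(\<Sum>j<n. pow_integral p M (f j)) \<le> 1"
      have "pow_integral p M (\<lambda>x. \<Sum>j<n. act p M (map_mat form_map w $$ (i, j)) (f j) x) =
          pow_integral p M (\<lambda>x. \<Sum>j<n. form_op (w $$ (i, j)) (f j) x)" if i: "i < n" for i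
      proof (rule pow_integral_cong_AE)
        have "AE x in M. \<forall>j\<in>{..<n}. act p M (map_mat form_map w $$ (i, j)) (f j) x = form_op (w $$ (i, j)) (f j) x"
        proof (rule AE_finite_allI)
          fix j assume "j \<in> {..<n}"
          then have j: "j < n" by simp
          show "AE x in M. act p M (map_mat form_map w $$ (i, j)) (f j) x = form_op (w $$ (i, j)) (f j) x"
            using Lp_rep_class[OF form_op_Lp[OF wW[OF i j] f[OF j]]] i j wc
            by (simp add: form_map_class[OF wW[OF i j] f[OF j]])
        qed simp
        then show "AE x in M. (\<Sum>j<n. act p M (map_mat form_map w $$ (i, j)) (f j) x) = (\<Sum>j<n. form_op (w $$ (i, j)) (f j) x)"
          by eventually_elim simp
        show "(\<lambda>x. \<Sum>j<n. act p M (map_mat form_map w $$ (i, j)) (f j) x) \<in> borel_measurable M"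
          using i wc ops[OF wW] f
          by (intro Lp_functionsD(1)[of _ p] Lp_functions_sum[OF p0] act_Lp) auto
        show "(\<lambda>x. \<Sum>j<n. form_op (w $$ (i, j)) (f j) x) \<in> borel_measurable M"
          using i by (intro Lp_functionsD(1)[of _ p] Lp_functions_sum[OF p0] form_op_Lp wW f) auto
      qed
      then show "(\<Sum>i<n. pow_integral p M (\<lambda>x. \<Sum>j<n. act p M (map_mat form_map w $$ (i, j)) (f j) x)) \<le> 1"
        using form_contraction[OF n w f f1] by simp
    qed
    then show "ereal (Lp_mat_norm p M (map_mat form_map w)) \<le> 1" by simp
  qed
qed

end

context cc_map
begin

text \<open>\<open>b\<close> and \<open>pair\<close> are known to agree on simple functions only.
  For general \<open>f\<close> both sides are limits along one approximating sequence: the pairing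
  by its norm continuity in \<open>f\<close>, which is \<open>pair_bound\<close> for 1 by 1
  matrices, and the kernel integral by the choice of the sequence.\<close>

lemma form_map_extends:
  assumes tf: "tensor_form p q sc W N M b" and VW: "V \<subseteq> W"
    and b: "\<forall>v\<in>V. \<forall>f\<in>simple_fns M. \<forall>g\<in>simple_fns M. b v f g = pair g v f"
    and v: "v \<in> V"
  shows "tensor_form.form_map p q M b v = \<phi> v"
proof -
  interpret B: tensor_form p q sc W N M b by (rule tf)
  have w: "v \<in> W" using v VW by blast
  have AE_eq: "AE x in M. B.form_op v f x = act p M (\<phi> v) f x" if f: "f \<in> Lp_functions p M" for f
  proof (rule B.form_op_unique[OF w f act_Lp[OF phi_ops[OF v] f]])
    fix g assume g: "g \<in> simple_fns M"
    note gL = simple_fns_Lp[OF g]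
    obtain F where F: "\<forall>i. F i \<in> simple_fns M"
      "\<forall>h\<in>Lp_functions q M. (\<lambda>i. \<integral>x. h x * F i x \<partial>M) \<longlonglongrightarrow> (\<integral>x. h x * f x \<partial>M)"
      "(\<lambda>i. pow_integral p M (\<lambda>x. F i x - f x)) \<longlonglongrightarrow> 0"
      using conj_exp.simple_fns_approx[OF swap f] by (elim exE conjE)
    have FS: "F i \<in> simple_fns M" for i using F(1) ..
    note FL = simple_fns_Lp[OF FS]
    define v1 where "v1 = mat 1 1 (\<lambda>_. v)"
    have v1: "v1 \<in> mats 1 1 V" using v by (intro matsI) (auto simp: v1_def)
    define C where "C = pow_integral q M g powr (1 / q) * N v1"
    have pair_lim: "(\<lambda>i. pair g v (F i)) \<longlonglongrightarrow> pair g v f"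
    proof (rule LIM_zero_cancel, rule Lim_null_comparison)
      show "(\<lambda>i. C * pow_integral p M (\<lambda>x. F i x - f x) powr (1 / p)) \<longlonglongrightarrow> 0"
        using tendsto_mult[OF tendsto_const tendsto_powr'[OF F(3) tendsto_const], of "1 / p" C] p0 by simp
      have "pair g v (F i) - pair g v f = pair g v (\<lambda>x. F i x - f x)" for i
        using pair_sum_f[of g v "{0::nat, 1}" "\<lambda>k. if k = 0 then F i else f" "\<lambda>k. if k = 0 then 1 else - 1"]
          gL v FL f by simp
      then have "cmod (pair g v (F i) - pair g v f) \<le> C * pow_integral p M (\<lambda>x. F i x - f x) powr (1 / p)" for i
        using pair_bound[OF _ v1, of "\<lambda>_. g" "\<lambda>_ x. F i x - f x"] gL Lp_functions_diff[OF FL f p0]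
        by (simp add: v1_def C_def)
      then show "\<forall>\<^sub>F i in sequentially. norm (pair g v (F i) - pair g v f) \<le> C * pow_integral p M (\<lambda>x. F i x - f x) powr (1 / p)"
        by simp
    qed
    have "pair g v (F i) = (\<integral>x. B.form_kernel v g x * F i x \<partial>M)" for i
      using b v FS g B.form_kernel[OF w FS g] by simp
    then have "(\<lambda>i. pair g v (F i)) \<longlonglongrightarrow> (\<integral>x. B.form_kernel v g x * f x \<partial>M)"
      using F(2) B.form_kernel_Lq[OF w g] by simp
    then show "(\<integral>x. B.form_kernel v g x * f x \<partial>M) = (\<integral>x. act p M (\<phi> v) f x * g x \<partial>M)"
      using LIMSEQ_unique[OF pair_lim] by (simp add: pair_def)
  qed
  \<comment> \<open>Agreement on \<open>Lp p M\<close> gives equality of functions because both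
    operators are extensional.\<close>
  show ?thesis
  proof (rule extensionalityI[where A = "Lp p M"])
    show "B.form_map v \<in> extensional (Lp p M)" by (simp add: B.form_map_def)
    show "\<phi> v \<in> extensional (Lp p M)" using phi_ops[OF v] by (auto simp: Lp_ops_def PiE_def)
    fix \<xi> assume \<xi>: "\<xi> \<in> Lp p M"
    note f = Lp_rep[OF \<xi>]
    have "\<phi> v \<xi> \<in> Lp p M" using phi_ops[OF v] \<xi> by (auto simp: Lp_ops_def)
    then have "\<phi> v \<xi> = Lp_class p M (Lp_rep (\<phi> v \<xi>))" by (rule Lp_rep(2)[symmetric])
    also have "\<dots> = Lp_class p M (act p M (\<phi> v) (Lp_rep \<xi>))" unfolding f(2) ..
    also have "\<dots> = Lp_class p M (B.form_op v (Lp_rep \<xi>))"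
      using AE_eq[OF f(1)] Lp_class_eq_iff[OF B.form_op_Lp[OF w f(1)] act_Lp[OF phi_ops[OF v] f(1)]] by simp
    finally show "B.form_map v \<xi> = \<phi> v \<xi>" using \<xi> by (simp add: B.form_map_def)
  qed
qed

end

theorem proposition3p5:
  fixes p p' :: real
    and sc :: "complex \<Rightarrow> 'a::ab_group_add \<Rightarrow> 'a"
    and V W :: "'a set"
    and N :: "'a mat \<Rightarrow> real"
  assumes "1 < p" and "1 < p'" and "1 / p + 1 / p' = 1"
    and "p_operator_space sc p V N" and "p_operator_space sc p W N"
    and "p_operator_subspace sc p V W N"
    and "\<forall>n\<ge>1. \<forall>v\<in>mats n n V. T_norm p p' sc V N v = T_norm p p' sc W N v"
  shows "\<forall>(\<Omega> :: 'm measure) \<phi>. p_completely_contractive sc V N p \<Omega> \<phi> \<longrightarrow>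
           (\<exists>\<phi>'. p_completely_contractive sc W N p \<Omega> \<phi>' \<and> (\<forall>v\<in>V. \<phi>' v = \<phi> v))"
proof (intro allI impI)
  fix \<Omega> :: "'m measure" and \<phi> assume cc: "p_completely_contractive sc V N p \<Omega> \<phi>"
  have VW: "V \<subseteq> W" using assms(6) by (simp add: p_operator_subspace_def)
  interpret V: p_operator_space sc p V N by fact
  interpret C: cc_map p p' sc V N \<Omega> \<phi>
    using assms(1-3) cc by unfold_locales
  obtain b where tf: "tensor_form p p' sc W N \<Omega> b"
    and b: "\<forall>v\<in>V. \<forall>f\<in>simple_fns \<Omega>. \<forall>g\<in>simple_fns \<Omega>. b v f g = C.pair g v f"
    using C.functional_extension[OF assms(5) VW assms(7)] by (elim exE conjE)
  show "\<exists>\<phi>'. p_completely_contractive sc W N p \<Omega> \<phi>' \<and> (\<forall>v\<in>V. \<phi>' v = \<phi> v)"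
    using tensor_form.form_map_contractive[OF tf] C.form_map_extends[OF tf VW b] by blast
qed

end
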